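(* Let $\mathbb{B}$ be the unit disc in $\mathbb{R}^2$. For any $\alpha$ with $0\leq \alpha<\lambda_1(\mathbb{B})$, there exists a constant $C>0$ depending only on $\alpha$ such that $$\int_{\mathbb{B}}|\nabla u|^2dx-\int_{\mathbb{B}}\frac{u^2}{(1-|x|^2)^2}dx-\alpha\int_{\mathbb{B}}u^2dx-16\pi\log\int_{\mathbb{B}}e^u\,dx\geq -C,\quad\forall u\in W_0^{1,2}(\mathbb{B}).$$
   Context: $\mathbb{B}$ is the open unit disc in $\mathbb{R}^2$ and $\|\cdot\|_p$ is the $L^p(\mathbb{B})$-norm. $\mathscr{H}$ is the Hilbert space obtained as the completion of $C_0^\infty(\mathbb{B})$ under the norm $$\|u\|_{\mathscr{H}}=\left(\int_{\mathbb{B}}|\nabla u|^2dx-\int_{\mathbb{B}}\frac{u^2}{(1-|x|^2)^2}dx\right)^{1/2}.$$ It is known that for every $p>1$ there is $C_p>0$ with $\|u\|_p\le C_p\|u\|_{\mathscr{H}}$, so elements of $\mathscr{H}$ are regarded as functions, and $W_0^{1,2}(\mathbb{B})\subset\mathscr{H}\subset\bigcap_{p\ge1}L^p(\mathbb{B})$. Define $$\lambda_1(\mathbb{B})=\inf_{u\in\mathscr{H},\,u\not\equiv 0}\frac{\|u\|_{\mathscr{H}}^2}{\|u\|_2^2}>0.$$ *)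

theory Defs
  imports "HOL-Analysis.Analysis"
begin

type_synonym plane = "real ^ 2"

abbreviation disc :: "plane set" where
  "disc \<equiv> ball 0 1"

abbreviation disc_measure :: "plane measure" where
  "disc_measure \<equiv> lebesgue_on disc"


definition partial :: "2 \<Rightarrow> (plane \<Rightarrow> real) \<Rightarrow> plane \<Rightarrow> real" where
  "partial i f x = frechet_derivative f (at x) (axis i 1)"

definition grad :: "(plane \<Rightarrow> real) \<Rightarrow> plane \<Rightarrow> plane" where
  "grad f x = (\<chi> i. partial i f x)"

(* Every iterated partial derivative is differentiable, hence continuous. *)
definition smooth :: "(plane \<Rightarrow> real) \<Rightarrow> bool" where
  "smooth f \<longleftrightarrow> (\<forall>ks x. foldr partial ks f differentiable (at x))"

(* C_0^\<infinity>(disc), each function being extended by 0 to the whole plane.  The support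
   is a closed subset of the bounded set disc, hence compact. *)
definition test_functions :: "(plane \<Rightarrow> real) set" where
  "test_functions = {f. smooth f \<and> closure {x. f x \<noteq> 0} \<subseteq> disc}"


(* Elements of L^p and of the spaces below are functions on the plane of which only the
   values on disc matter, up to null sets; no quotient is taken. *)
definition Lp_space :: "real \<Rightarrow> (plane \<Rightarrow> real) set" where
  "Lp_space p = {u \<in> borel_measurable disc_measure.
                   integrable disc_measure (\<lambda>x. \<bar>u x\<bar> powr p)}"

definition Lp_norm :: "real \<Rightarrow> (plane \<Rightarrow> real) \<Rightarrow> real" where
  "Lp_norm p u = (LINT x|disc_measure. \<bar>u x\<bar> powr p) powr (1 / p)"


definition has_weak_grad :: "(plane \<Rightarrow> real) \<Rightarrow> (plane \<Rightarrow> plane) \<Rightarrow> bool" where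
  "has_weak_grad u G \<longleftrightarrow>
     (\<forall>i. (\<lambda>x. G x $ i) \<in> Lp_space 2) \<and>
     (\<forall>\<phi>\<in>test_functions. \<forall>i.
        (LINT x|disc_measure. u x * partial i \<phi> x) = - (LINT x|disc_measure. G x $ i * \<phi> x))"

definition W12 :: "(plane \<Rightarrow> real) set" where
  "W12 = {u \<in> Lp_space 2. \<exists>G. has_weak_grad u G}"

(* Weak gradients are unique up to null sets, so integrals do not depend on the choice. *)
definition weak_grad :: "(plane \<Rightarrow> real) \<Rightarrow> plane \<Rightarrow> plane" where
  "weak_grad u = (SOME G. has_weak_grad u G)"

(* The closure of C_0^\<infinity>(disc) in W^{1,2}(disc). *)
definition W012 :: "(plane \<Rightarrow> real) set" where
  "W012 = {u \<in> W12. \<exists>\<phi>. (\<forall>n. \<phi> n \<in> test_functions) \<and>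
             (\<lambda>n. Lp_norm 2 (\<lambda>x. \<phi> n x - u x)) \<longlonglongrightarrow> 0 \<and>
             (\<lambda>n. Lp_norm 2 (\<lambda>x. norm (grad (\<phi> n) x - weak_grad u x))) \<longlonglongrightarrow> 0}"


definition test_norm :: "(plane \<Rightarrow> real) \<Rightarrow> real" where
  "test_norm \<phi> = sqrt ((LINT x|disc_measure. (norm (grad \<phi> x))\<^sup>2)
                     - (LINT x|disc_measure. (\<phi> x)\<^sup>2 / (1 - (norm x)\<^sup>2)\<^sup>2))"

(* The Cauchy sequence \<phi> of the pre-Hilbert space (test_functions, test_norm) is a
   representative of an element of its completion; by the embedding of the completion into
   every L^p, p > 1, that element is identified with the common L^p-limit u of \<phi>. *)
definition represents :: "(nat \<Rightarrow> plane \<Rightarrow> real) \<Rightarrow> (plane \<Rightarrow> real) \<Rightarrow> bool" where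
  "represents \<phi> u \<longleftrightarrow>
     (\<forall>n. \<phi> n \<in> test_functions) \<and>
     (\<forall>e>0. \<exists>N. \<forall>m\<ge>N. \<forall>n\<ge>N. test_norm (\<lambda>x. \<phi> m x - \<phi> n x) < e) \<and>
     (\<forall>p>1. u \<in> Lp_space p \<and> (\<lambda>n. Lp_norm p (\<lambda>x. \<phi> n x - u x)) \<longlonglongrightarrow> 0)"

definition H_space :: "(plane \<Rightarrow> real) set" where
  "H_space = {u. \<exists>\<phi>. represents \<phi> u}"

(* The norm of the completion: the limit of the norms along a representing Cauchy sequence.
   It is independent of the sequence because the embedding into L^p is injective. *)
definition H_norm :: "(plane \<Rightarrow> real) \<Rightarrow> real" where
  "H_norm u = (THE r. \<exists>\<phi>. represents \<phi> u \<and> (\<lambda>n. test_norm (\<phi> n)) \<longlonglongrightarrow> r)"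

definition lambda1 :: real where
  "lambda1 = Inf {(H_norm u)\<^sup>2 / (Lp_norm 2 u)\<^sup>2 | u.
                    u \<in> H_space \<and> \<not> (AE x in disc_measure. u x = 0)}"

end

theory Submission
  imports Defs
begin

text \<open>The inequality is dual to a sharp logarithmic Hardy-Littlewood-Sobolev inequality. Approximate
  \<open>exp u / Z\<close>, where \<open>Z\<close> is the integral of \<open>exp u\<close>, by point masses \<open>q\<close> on a fine grid. Their
  Gibbs identity turns \<open>ln Z\<close> into \<open>\<Sum> q u - \<Sum> q ln q\<close>. For \<open>\<Sum> q u\<close> one completes the square with an
  explicit parametrix \<open>w\<close> of the Laplacian, a superposition of logarithms truncated at a quarter of the
  distance to the boundary. The errors are of lower order in \<open>z = u - w\<close>: an improved Hardy inequality
  with a pole at a boundary point bounds them by the square root of the energy of \<open>z\<close>, uniformly up to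
  the boundary, and \<open>\<alpha> < lambda1\<close> makes the form coercive at \<open>z\<close>. What remains is the logarithmic
  energy of \<open>q\<close>. It is compared with the entropy by averaging over shifted dyadic grids, because for
  a dyadic kernel the sharp inequality follows from a one-step inequality along the tree.\<close>

section \<open>Discrete logarithmic Hardy-Littlewood-Sobolev inequality\<close>

text \<open>The constant 16 pi is critical. The parametrix carries 8 pi times the measure
  \<open>q\<close>, so the linear term is 16 pi \<Sum> q u and the energy of \<open>w\<close> is 32
  pi \<Sum>\<Sum> q q ln (1 / distance) up to a constant. The kernel inequality bounds the latter by
  16 pi \<Sum> q ln q = 16 pi (\<Sum> q u - ln S), with S the sum of \<open>exp u\<close> over the
  grid points, and the terms \<Sum> q u have to cancel exactly. Hence every loss must be an additive
  constant, independent of \<open>u\<close>, of the mesh and of the distance to the circle; no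
  coefficient may be worsened anywhere. For the dyadic kernel this is possible because a square has
  four children: \<open>ln 4\<close> per level is at once the entropy of an even split and the
  increment of \<open>2 * ln (1 / distance)\<close> under halving. The second obstacle is the
  boundary, where the masses may concentrate and the potential blows up. With a truncation radius R
  comparable to the gap, the potential on the support is of order 1 / R^2, the squared logarithm
  integrates to order R^2, and R drops out of each estimate. The mesh may depend on
  \<open>u\<close>: its size only enters through \<open>ln S - n * ln 4\<close>, which is the
  logarithm of a Riemann sum.\<close>

text \<open>\<open>x ln x\<close> corrected by a bounded term, so that passing to the children of a dyadic square costs no
  more than \<open>ln 4 * (m - \<Sum> m\<^sub>i\<^sup>2)\<close>. The constant 30 is generous.\<close>
definition node_pot :: "real \<Rightarrow> real" where
  "node_pot x = x * ln x - 30 * (x + (1 - x) * ln (1 - x))"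

text \<open>Tangent of \<open>ln\<close> at 4. The slope 1/4 leaves room below \<open>ln 2\<close>
  in the unbalanced cases of the node inequality.\<close>

lemma ln_le_quarter:
  fixes x :: real assumes "x > 0" shows "ln x \<le> x / 4 + 2/5"
proof -
  have "ln (x/4) \<le> x/4 - 1" using assms by (intro ln_le_minus_one) simp
  moreover have "ln (x/4) = ln x - ln 4" using assms by (simp add: ln_div)
  moreover have "ln (4::real) = 2 * ln 2" using ln_realpow[of 2 2] by simp
  moreover have "ln 2 \<le> (25/36::real)" by (rule ln2_le_25_over_36)
  ultimately show ?thesis by simp
qed

text \<open>The log-sum inequality for the pairs \<open>(1 - a - b, 1 - a)\<close> and \<open>(a, a)\<close>.\<close>
lemma split_gain:
  fixes a b :: real
  assumes "0 \<le> a" "0 \<le> b" "a + b \<le> 1"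
  shows "(1-a-b) * ln (1-a-b) - (1-a) * ln (1-a) - (1-b) * ln (1-b) \<ge> - b * ln (1-a)"
\<comment> \<open>The degenerate cases are split off because the generic argument divides by
  \<open>1 - a - b\<close> and takes its logarithm.\<close>
proof (cases "a + b = 1 \<or> a = 0")
  case True
  then show ?thesis
  proof
    assume "a + b = 1"
    hence b: "b = 1 - a" by simp
    have "a * ln a \<le> 0" using assms b by (cases "a = 0") (auto simp: mult_nonneg_nonpos)
    then show ?thesis unfolding b by (simp add: algebra_simps)
  qed simp
next
  case False
  hence p: "1 - a - b > 0" "a > 0" using assms by auto
  define k where "k = 1 - b"
  have k: "k > 0" "k \<le> 1" using p assms by (auto simp: k_def)
  have c: "1 - a > 0" using p assms by auto
  have 1: "ln ((1-a)*k/(1-a-b)) \<le> (1-a)*k/(1-a-b) - 1"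
    using p c k by (intro ln_le_minus_one) simp
  have "ln ((1-a)*k/(1-a-b)) = ln (1-a) + ln k - ln (1-a-b)"
    using p c k by (simp add: ln_div ln_mult)
  hence "(1-a-b) * (ln (1-a) + ln k - ln (1-a-b)) \<le> (1-a-b) * ((1-a)*k/(1-a-b) - 1)"
    using 1 p by (intro mult_left_mono) auto
  also have "\<dots> = (1-a)*k - (1-a-b)" using p by (simp add: field_simps)
  finally have 2: "(1-a-b) * (ln (1-a) + ln k - ln (1-a-b)) \<le> (1-a)*k - (1-a-b)" .
  have 3: "a * ln k \<le> a * (k - 1)" using k p by (intro mult_left_mono ln_le_minus_one) auto
  have "(1-a)*k - (1-a-b) + a * (k - 1) = 0" unfolding k_def by (simp add: algebra_simps)
  with 2 3 have "(1-a-b) * (ln (1-a) + ln k - ln (1-a-b)) + a * ln k \<le> 0" by linarith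
  then show ?thesis unfolding k_def by (simp add: algebra_simps)
qed

text \<open>With \<open>H\<close> the entropy lost by merging \<open>a\<close> and \<open>b\<close>,
  and \<open>T\<close> the gain of the correction term, the claim reads
  \<open>H \<le> 30 * T + ln 2 * (m - a^2 - b^2)\<close>. For an even split of a small mass,
  \<open>H\<close> equals \<open>m * ln 2\<close>, so the squares must be paid for by
  \<open>T\<close>; the bounds \<open>T \<ge> a * b\<close> and
  \<open>T \<ge> - b * ln (1 - a)\<close> serve this purpose.\<close>

lemma node_pot_add_aux:
  fixes a b :: real
  assumes "0 \<le> b" "b \<le> a" "a + b \<le> 1"
  shows "node_pot (a + b) \<le> node_pot a + node_pot b + ln 2 * (a + b - a\<^sup>2 - b\<^sup>2)"
proof (cases "b = 0")
  case True
  have "a\<^sup>2 \<le> a" using assms True by (simp add: power2_eq_square mult_left_le_one_le)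
  then show ?thesis using True by (simp add: node_pot_def)
next
  case False
  hence b: "b > 0" and a: "a > 0" using assms by auto
  have a1: "a < 1" using assms b by auto
  define m where "m = a + b"
  have m: "m > 0" "m \<le> 1" using a b assms by (auto simp: m_def)
  define T where "T = (1-a-b) * ln (1-a-b) - (1-a) * ln (1-a) - (1-b) * ln (1-b)"
  have T: "T \<ge> - b * ln (1-a)" unfolding T_def using split_gain[of a b] assms a by simp
  have lna: "ln (1-a) \<le> - a" using ln_le_minus_one[of "1-a"] a1 by simp
  have "b * a \<le> b * (- ln (1-a))" using lna b by (intro mult_left_mono) auto
  hence Tab: "T \<ge> a * b" using T by (simp add: mult.commute)
  have ln2: "ln 2 \<ge> (2/3::real)" "ln 2 \<le> (25/36::real)" using ln2_ge_two_thirds ln2_le_25_over_36 by auto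
  define H where "H = m * ln m - a * ln a - b * ln b"
  have key: "H \<le> 30 * T + ln 2 * (m - a\<^sup>2 - b\<^sup>2)"
  \<comment> \<open>Comparable masses: the squares are at most 21 times \<open>a * b\<close>, and
    \<open>T \<ge> a * b\<close>. This regime forces a large coefficient of \<open>T\<close>.
    Otherwise \<open>H\<close> itself is well below \<open>m * ln 2\<close>.\<close>
  proof (cases "a \<le> 20 * b")
    case True
    have 1: "a * ln (m/(2*a)) \<le> a * (m/(2*a) - 1)"
      using a m by (intro mult_left_mono ln_le_minus_one) auto
    have 2: "b * ln (m/(2*b)) \<le> b * (m/(2*b) - 1)"
      using b m by (intro mult_left_mono ln_le_minus_one) auto
    have e: "a * (m/(2*a) - 1) = m/2 - a" "b * (m/(2*b) - 1) = m/2 - b" using a b by (auto simp: field_simps)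
    have "a * ln (m/(2*a)) = a * ln m - a * ln 2 - a * ln a" "b * ln (m/(2*b)) = b * ln m - b * ln 2 - b * ln b"
      using a b m by (simp_all add: ln_div ln_mult algebra_simps)
    with 1 2 e have "(a + b) * ln m - (a+b) * ln 2 - a * ln a - b * ln b \<le> m - (a + b)"
      by (simp add: algebra_simps)
    hence "H \<le> m * ln 2" unfolding H_def by (simp add: m_def[symmetric])
    moreover have "ln 2 * (a\<^sup>2 + b\<^sup>2) \<le> 30 * T"
    proof -
      have "a * a \<le> 20 * b * a" using True a by (intro mult_right_mono) auto
      moreover have "b * b \<le> b * a" using assms b by (intro mult_left_mono) auto
      ultimately have "a\<^sup>2 + b\<^sup>2 \<le> 21 * (a * b)" by (simp add: power2_eq_square mult_ac)
      hence "ln 2 * (a\<^sup>2 + b\<^sup>2) \<le> 25/36 * (21 * (a * b))" using ln2 by (intro mult_mono) auto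
      also have "\<dots> \<le> 30 * (a * b)" using a b by simp
      also have "\<dots> \<le> 30 * T" using Tab by simp
      finally show ?thesis .
    qed
    ultimately show ?thesis by (simp add: algebra_simps)
  next
    case False
    hence ab: "a > 20 * b" by simp
    have "a * ln (m/a) \<le> a * (m/a - 1)" using a m by (intro mult_left_mono ln_le_minus_one) auto
    also have "\<dots> = b" using a by (simp add: field_simps m_def)
    finally have "a * ln m - a * ln a \<le> b" using a m by (simp add: ln_div algebra_simps)
    hence H1: "H \<le> b * ln (m/b) + b" unfolding H_def using b m by (simp add: ln_div algebra_simps m_def)
    show ?thesis
    \<comment> \<open>For small \<open>m\<close> the quadratic terms take away at most half of the
      budget \<open>m * ln 2\<close>, and \<open>m/3\<close> suffices. For \<open>m\<close> near 1
      the budget \<open>m - a^2 - b^2\<close> may itself be small, and \<open>T\<close> has to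
      help.\<close>
    proof (cases "m \<le> 1/2")
      case True
      have "b * ln (m/b) \<le> b * (m/b/4 + 2/5)" using b m by (intro mult_left_mono ln_le_quarter) auto
      also have "\<dots> = m/4 + 2/5*b" using b by (simp add: field_simps)
      finally have "H \<le> m/4 + 7/5 * b" using H1 by simp
      also have "\<dots> \<le> m/3"
      proof -
        have "84 * b \<le> 5 * (a + b)" using ab b by simp
        thus ?thesis unfolding m_def by (simp add: field_simps)
      qed
      also have "\<dots> \<le> 2/3 * (m * (1-m))" 
      proof -
        have "m * (1/2) \<le> m * (1-m)" using True m by (intro mult_left_mono) auto
        thus ?thesis by simp
      qed
      also have "\<dots> \<le> ln 2 * (m * (1-m))" using ln2 m by (intro mult_right_mono) auto
      also have "\<dots> \<le> ln 2 * (m - a\<^sup>2 - b\<^sup>2)"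
        using a b ln2 by (intro mult_left_mono) (auto simp: m_def power2_eq_square algebra_simps)
      finally show ?thesis using Tab a b by (smt (verit) mult_nonneg_nonneg)
    next
      case False
      hence a2: "a \<ge> 10/21" using ab by (simp add: m_def)
      define c where "c = 1 - a"
      have c: "c > 0" using a1 by (simp add: c_def)
      \<comment> \<open>The splitting \<open>ln (1/b) = - ln c + ln (c/b)\<close> isolates
        \<open>- b * ln c\<close>, which is exactly the lower bound of \<open>T\<close>. The
        remaining ratio \<open>c / b\<close> is at least 1, so its tangent bound costs a multiple of
        \<open>c\<close>, which is comparable to the quadratic deficit.\<close>
      have "ln (m/b) \<le> ln (1/b)" using m b by (intro ln_mono) (auto simp: divide_right_mono)
      also have "ln (1/b) = - ln c + ln (c/b)" using b c by (simp add: ln_div)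
      also have "ln (c/b) \<le> c/b/4 + 2/5" using b c by (intro ln_le_quarter) simp
      finally have "b * ln (m/b) \<le> b * (- ln c + (c/b/4 + 2/5))" using b by simp
      also have "\<dots> = - b * ln c + c/4 + 2/5*b" using b by (simp add: field_simps)
      also have "\<dots> \<le> T + c/4 + 2/5*b" using T by (simp add: c_def)
      finally have "H \<le> T + c/4 + 7/5*b" using H1 by simp
      moreover have "7/5*b \<le> 29 * T"
      proof -
        have "b * (10/21) \<le> b * a" using a2 b by (intro mult_left_mono) auto
        moreover have "a * b \<ge> 0" using a b by simp
        ultimately show ?thesis using Tab by (simp add: mult.commute)
      qed
      moreover have "c/4 \<le> ln 2 * (m - a\<^sup>2 - b\<^sup>2)"
      proof -
        have "c/4 \<le> 2/3 * (10/21 * c)" using c by simp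
        also have "\<dots> \<le> ln 2 * (a * c)" using ln2 a2 c a by (intro mult_mono) auto
        also have "\<dots> \<le> ln 2 * (m - a\<^sup>2 - b\<^sup>2)"
        proof -
          have "b * b \<le> b * 1" using a1 assms b by (intro mult_left_mono) auto
          thus ?thesis using ln2 by (intro mult_left_mono) (auto simp: c_def m_def power2_eq_square algebra_simps)
        qed
        finally show ?thesis .
      qed
      ultimately show ?thesis by linarith
    qed
  qed
  then show ?thesis unfolding H_def T_def m_def node_pot_def by (simp add: algebra_simps)
qed

lemma node_pot_add:
  fixes a b :: real
  assumes "0 \<le> a" "0 \<le> b" "a + b \<le> 1"
  shows "node_pot (a + b) \<le> node_pot a + node_pot b + ln 2 * (a + b - a\<^sup>2 - b\<^sup>2)"
  using node_pot_add_aux[of a b] node_pot_add_aux[of b a] assms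
  by (cases "a \<le> b") (auto simp: algebra_simps)

text \<open>A split into four is made of two levels of binary splits, each costing
  \<open>ln 2\<close> per unit of mass.\<close>

lemma node_pot_add4:
  fixes a b c d :: real
  assumes "0 \<le> a" "0 \<le> b" "0 \<le> c" "0 \<le> d" "a + b + c + d \<le> 1"
  shows "node_pot (a + b + c + d) \<le> node_pot a + node_pot b + node_pot c + node_pot d
           + ln 4 * (a + b + c + d - (a\<^sup>2 + b\<^sup>2 + c\<^sup>2 + d\<^sup>2))"
proof -
  have 1: "node_pot (a+b) \<le> node_pot a + node_pot b + ln 2 * (a + b - a\<^sup>2 - b\<^sup>2)"
    using assms by (intro node_pot_add) auto
  have 2: "node_pot (c+d) \<le> node_pot c + node_pot d + ln 2 * (c + d - c\<^sup>2 - d\<^sup>2)"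
    using assms by (intro node_pot_add) auto
  have 3: "node_pot ((a+b)+(c+d)) \<le> node_pot (a+b) + node_pot (c+d) 
      + ln 2 * ((a + b) + (c + d) - (a+b)\<^sup>2 - (c+d)\<^sup>2)"
    using assms by (intro node_pot_add) auto
  \<comment> \<open>The upper level subtracts squares of pair sums, which dominate the sums of the
    four squares.\<close>
  have "ln 2 * ((a + b) + (c + d) - (a+b)\<^sup>2 - (c+d)\<^sup>2) 
      \<le> ln 2 * ((a+b)+(c+d) - (a\<^sup>2 + b\<^sup>2 + c\<^sup>2 + d\<^sup>2))"
    using assms by (intro mult_left_mono) (auto simp: power2_sum intro: add_nonneg_nonneg order_trans[of _ 0])
  moreover have "ln (4::real) = 2 * ln 2" using ln_realpow[of 2 2] by simp
  ultimately show ?thesis using 1 2 3 by (simp add: algebra_simps)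
qed

section \<open>Summation of the node inequality over the dyadic tree\<close>

lemma sum_box_double:
  fixes f :: "nat \<times> nat \<Rightarrow> real"
  shows "(\<Sum>Z\<in>{..<2*M} \<times> {..<2*M}. f Z) = (\<Sum>(i,j)\<in>{..<M} \<times> {..<M}.
           f (2*i, 2*j) + f (2*i, Suc (2*j)) + f (Suc (2*i), 2*j) + f (Suc (2*i), Suc (2*j)))"
proof -
  have d: "(\<Sum>i<2*M. g i) = (\<Sum>i<M. g (2*i) + g (Suc (2*i)))" for g :: "nat \<Rightarrow> real" and M
    by (induction M) auto
  show ?thesis
  proof -
    have *: "(\<Sum>Z\<in>A \<times> B. g Z) = (\<Sum>i\<in>A. \<Sum>j\<in>B. g (i, j))" for A B :: "nat set" and g :: "nat \<times> nat \<Rightarrow> real"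
      by (simp add: sum.cartesian_product)
    show ?thesis unfolding * d by (simp add: sum.distrib)
  qed
qed

text \<open>The number of pairs in a common cell, weighted by \<open>q\<close>, is the sum of
  squared cell masses. At each level the node inequality trades this sum for a change of the total
  potential, and telescoping leaves the entropy of \<open>q\<close> at the leaves and
  \<open>node_pot 1 = -30\<close> at the root. Injectivity guarantees that a cell of side 1 carries
  a single mass.\<close>

lemma discrete_tree_inequality:
  fixes q :: "'i \<Rightarrow> real" and p1 p2 :: "'i \<Rightarrow> nat"
  assumes fin: "finite I" and q0: "\<And>X. X \<in> I \<Longrightarrow> q X \<ge> 0" and q1: "(\<Sum>X\<in>I. q X) = 1"
    and p: "\<And>X. X \<in> I \<Longrightarrow> p1 X < 2^n" "\<And>X. X \<in> I \<Longrightarrow> p2 X < 2^n"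
    and inj: "inj_on (\<lambda>X. (p1 X, p2 X)) I"
  shows "ln 4 * (\<Sum>k<n. \<Sum>X\<in>I. \<Sum>Y\<in>I. q X * q Y *
            of_bool (p1 X div 2^k = p1 Y div 2^k \<and> p2 X div 2^k = p2 Y div 2^k))
         \<le> (\<Sum>X\<in>I. q X * ln (q X)) + real n * ln 4 + 30"
proof -
  define c where "c k X = (p1 X div 2^k, p2 X div 2^k)" for k X
  define m where "m k Z = (\<Sum>X\<in>I. q X * of_bool (c k X = Z))" for k and Z :: "nat \<times> nat"
  define B where "B k = {..<(2::nat)^(n-k)} \<times> {..<(2::nat)^(n-k)}" for k
  have finB: "finite (B k)" for k by (simp add: B_def)
  have div_lt: "a div 2^k < 2^(n-k)" if "a < 2^n" "k \<le> n" for a k :: nat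
  proof (rule less_mult_imp_div_less)
    have "(2::nat)^(n-k) * 2^k = 2^n" using that by (simp flip: power_add)
    thus "a < 2^(n-k) * 2^k" using that by simp
  qed
  have cB: "c k X \<in> B k" if "X \<in> I" "k \<le> n" for k X
    using p[OF that(1)] that(2) by (auto simp: c_def B_def div_lt)
  have m0: "m k Z \<ge> 0" for k Z unfolding m_def by (intro sum_nonneg) (auto simp: q0)
  have sum_m: "(\<Sum>Z\<in>B k. m k Z) = 1" if "k \<le> n" for k
  proof -
    have "(\<Sum>Z\<in>B k. m k Z) = (\<Sum>X\<in>I. \<Sum>Z\<in>B k. q X * of_bool (c k X = Z))"
      unfolding m_def by (rule sum.swap)
    also have "\<dots> = (\<Sum>X\<in>I. q X)"
      using cB[OF _ that] finB by (intro sum.cong refl) (simp add: of_bool_def sum.delta' if_distrib cong: if_cong)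
    finally show ?thesis using q1 by simp
  qed
  have sum_sq: "(\<Sum>Z\<in>B k. (m k Z)\<^sup>2) = (\<Sum>X\<in>I. \<Sum>Y\<in>I. q X * q Y * of_bool (c k X = c k Y))"
    if "k \<le> n" for k
  proof -
    have "(\<Sum>Z\<in>B k. (m k Z)\<^sup>2) = 
      (\<Sum>Z\<in>B k. \<Sum>X\<in>I. \<Sum>Y\<in>I. (q X * q Y * of_bool (c k Y = Z)) * of_bool (c k X = Z))"
      unfolding m_def power2_eq_square sum_product by (intro sum.cong refl) (simp add: mult_ac)
    also have "\<dots> = (\<Sum>X\<in>I. \<Sum>Z\<in>B k. \<Sum>Y\<in>I. (q X * q Y * of_bool (c k Y = Z)) * of_bool (c k X = Z))"
      by (rule sum.swap)
    also have "\<dots> = (\<Sum>X\<in>I. \<Sum>Y\<in>I. \<Sum>Z\<in>B k. (q X * q Y * of_bool (c k Y = Z)) * of_bool (c k X = Z))"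
      by (intro sum.cong refl) (rule sum.swap)
    also have "\<dots> = (\<Sum>X\<in>I. \<Sum>Y\<in>I. q X * q Y * of_bool (c k X = c k Y))"
    proof (intro sum.cong refl)
      fix X Y assume "X \<in> I" "Y \<in> I"
      have "(\<Sum>Z\<in>B k. (q X * q Y * of_bool (c k Y = Z)) * of_bool (c k X = Z))
         = (\<Sum>Z\<in>B k. if c k X = Z then q X * q Y * of_bool (c k Y = Z) else 0)"
        by (intro sum.cong) auto
      also have "\<dots> = q X * q Y * of_bool (c k Y = c k X)"
        using cB[OF \<open>X \<in> I\<close> that] finB by (simp add: sum.delta')
      finally show "(\<Sum>Z\<in>B k. (q X * q Y * of_bool (c k Y = Z)) * of_bool (c k X = Z)) = q X * q Y * of_bool (c k X = c k Y)"
        by (simp add: eq_commute)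
    qed
    finally show ?thesis .
  qed
  have m_Suc: "m (Suc k) (i,j) = m k (2*i,2*j) + m k (2*i,Suc(2*j)) + m k (Suc(2*i),2*j) + m k (Suc(2*i),Suc(2*j))"
    for k i j
  proof -
    have "of_bool (c (Suc k) X = (i,j)) = of_bool (c k X = (2*i,2*j)) + of_bool (c k X = (2*i,Suc(2*j)))
       + of_bool (c k X = (Suc(2*i),2*j)) + (of_bool (c k X = (Suc(2*i),Suc(2*j)))::real)" for X
    proof -
      have *: "a div 2^Suc k = (a div 2^k) div 2" for a :: nat
        by (metis div_mult2_eq power_Suc2)
      have **: "of_bool (a div 2 = i \<and> b div 2 = j) = of_bool (a = 2*i \<and> b = 2*j) + of_bool (a = 2*i \<and> b = Suc(2*j))
       + of_bool (a = Suc(2*i) \<and> b = 2*j) + (of_bool (a = Suc(2*i) \<and> b = Suc(2*j))::real)" for a b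
      proof -
        have "a div 2 = i \<longleftrightarrow> a = 2*i \<or> a = Suc(2*i)" "b div 2 = j \<longleftrightarrow> b = 2*j \<or> b = Suc(2*j)" by linarith+
        moreover have "2*i \<noteq> Suc(2*i)" "2*j \<noteq> Suc(2*j)" by auto
        ultimately show ?thesis by (auto simp: of_bool_def)
      qed
      show ?thesis unfolding c_def * prod.inject by (rule **)
    qed
    thus ?thesis unfolding m_def by (simp only: distrib_left sum.distrib)
  qed
  have step: "(\<Sum>Z\<in>B (Suc k). node_pot (m (Suc k) Z)) 
     \<le> (\<Sum>Z\<in>B k. node_pot (m k Z)) + ln 4 - ln 4 * (\<Sum>Z\<in>B k. (m k Z)\<^sup>2)" if k: "k < n" for k
  proof -
    have Bk: "B k = {..<2 * 2^(n - Suc k)} \<times> {..<2 * 2^(n - Suc k)}"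
      using k unfolding B_def by (metis Suc_diff_Suc power_Suc)
    let ?g = "\<lambda>Z. node_pot (m k Z) + ln 4 * (m k Z - (m k Z)\<^sup>2)"
    have "(\<Sum>Z\<in>B (Suc k). node_pot (m (Suc k) Z)) \<le> (\<Sum>(i,j)\<in>B (Suc k).
           ?g (2*i, 2*j) + ?g (2*i, Suc (2*j)) + ?g (Suc (2*i), 2*j) + ?g (Suc (2*i), Suc (2*j)))"
    proof (intro sum_mono, clarify)
      fix i j assume ij: "(i,j) \<in> B (Suc k)"
      have "m (Suc k) (i,j) \<le> (\<Sum>Z\<in>B (Suc k). m (Suc k) Z)"
        using ij finB m0 by (intro member_le_sum) auto
      also have "\<dots> = 1" using k by (intro sum_m) auto
      finally have "m (Suc k) (i,j) \<le> 1" .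
      hence "node_pot (m (Suc k) (i,j)) \<le> node_pot (m k (2*i,2*j)) + node_pot (m k (2*i,Suc(2*j))) 
        + node_pot (m k (Suc(2*i),2*j)) + node_pot (m k (Suc(2*i),Suc(2*j))) 
        + ln 4 * (m k (2*i,2*j) + m k (2*i,Suc(2*j)) + m k (Suc(2*i),2*j) + m k (Suc(2*i),Suc(2*j)) - 
          ((m k (2*i,2*j))\<^sup>2 + (m k (2*i,Suc(2*j)))\<^sup>2 + (m k (Suc(2*i),2*j))\<^sup>2 + (m k (Suc(2*i),Suc(2*j)))\<^sup>2))"
        unfolding m_Suc by (intro node_pot_add4 m0)
      thus "node_pot (m (Suc k) (i,j)) \<le> ?g (2*i, 2*j) + ?g (2*i, Suc (2*j)) + ?g (Suc (2*i), 2*j) + ?g (Suc (2*i), Suc (2*j))"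
        by (simp add: algebra_simps)
    qed
    also have "\<dots> = (\<Sum>Z\<in>B k. ?g Z)" unfolding Bk sum_box_double by (simp add: B_def)
    also have "\<dots> = (\<Sum>Z\<in>B k. node_pot (m k Z)) + ln 4 * ((\<Sum>Z\<in>B k. m k Z) - (\<Sum>Z\<in>B k. (m k Z)\<^sup>2))"
      by (simp add: sum.distrib sum_subtractf flip: sum_distrib_left)
    finally show ?thesis using sum_m[of k] k by (simp add: algebra_simps)
  qed
  have tele: "(\<Sum>Z\<in>B l. node_pot (m l Z)) + ln 4 * (\<Sum>k<l. \<Sum>Z\<in>B k. (m k Z)\<^sup>2)
     \<le> (\<Sum>Z\<in>B 0. node_pot (m 0 Z)) + real l * ln 4" if "l \<le> n" for l
    using that
  proof (induction l)
    case (Suc l)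
    then show ?case using step[of l] by (simp add: algebra_simps)
  qed simp
  \<comment> \<open>At scale \<open>2^n\<close> everything lies in one cell of mass 1; only its
    correction term survives and becomes the additive constant.\<close>
  have "B n = {(0,0)}" by (auto simp: B_def)
  hence last: "(\<Sum>Z\<in>B n. node_pot (m n Z)) = -30" using sum_m[of n] by (simp add: node_pot_def)
  have start: "(\<Sum>Z\<in>B 0. node_pot (m 0 Z)) \<le> (\<Sum>X\<in>I. q X * ln (q X))"
  proof -
    have inj': "inj_on (c 0) I" using inj by (simp add: c_def inj_on_def)
    have sub: "c 0 ` I \<subseteq> B 0" using cB[of _ 0] by auto
    have pot: "node_pot x \<le> x * ln x" if "0 \<le> x" "x \<le> 1" for x :: real
    proof (cases "x = 1")
      case False
      hence "ln (1/(1-x)) \<le> 1/(1-x) - 1" using that by (intro ln_le_minus_one) auto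
      hence "(1-x) * (- ln (1-x)) \<le> (1-x) * (1/(1-x) - 1)"
        using that False by (intro mult_left_mono) (auto simp: ln_div)
      also have "\<dots> = x" using that False by (simp add: field_simps)
      finally show ?thesis by (simp add: node_pot_def)
    qed (simp add: node_pot_def)
    have "(\<Sum>Z\<in>B 0. node_pot (m 0 Z)) \<le> (\<Sum>Z\<in>B 0. m 0 Z * ln (m 0 Z))"
    proof (intro sum_mono pot m0)
      fix Z assume "Z \<in> B 0"
      hence "m 0 Z \<le> (\<Sum>Z\<in>B 0. m 0 Z)" using finB m0 by (intro member_le_sum) auto
      thus "m 0 Z \<le> 1" by (simp add: sum_m)
    qed
    also have "\<dots> = (\<Sum>Z\<in>c 0 ` I. m 0 Z * ln (m 0 Z))"
    proof (intro sum.mono_neutral_right finB sub ballI)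
      fix Z assume "Z \<in> B 0 - c 0 ` I"
      hence "m 0 Z = 0" unfolding m_def by (intro sum.neutral) auto
      thus "m 0 Z * ln (m 0 Z) = 0" by simp
    qed
    also have "\<dots> = (\<Sum>X\<in>I. m 0 (c 0 X) * ln (m 0 (c 0 X)))" by (simp add: sum.reindex[OF inj'])
    also have "\<dots> = (\<Sum>X\<in>I. q X * ln (q X))"
    proof (intro sum.cong refl)
      fix X assume X: "X \<in> I"
      have "m 0 (c 0 X) = (\<Sum>Y\<in>I. if Y = X then q Y else 0)"
        unfolding m_def using inj' X by (intro sum.cong refl) (auto dest: inj_onD)
      hence "m 0 (c 0 X) = q X" using X fin by simp
      thus "m 0 (c 0 X) * ln (m 0 (c 0 X)) = q X * ln (q X)" by simp
    qed
    finally show ?thesis .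
  qed
  have "ln 4 * (\<Sum>k<n. \<Sum>Z\<in>B k. (m k Z)\<^sup>2) \<le> (\<Sum>X\<in>I. q X * ln (q X)) + real n * ln 4 + 30"
    using tele[of n] last start by simp
  also have "(\<Sum>k<n. \<Sum>Z\<in>B k. (m k Z)\<^sup>2) = (\<Sum>k<n. \<Sum>X\<in>I. \<Sum>Y\<in>I. q X * q Y * of_bool (c k X = c k Y))"
    by (intro sum.cong refl sum_sq) auto
  finally show ?thesis by (simp add: c_def)
qed

section \<open>Averaging over shifted dyadic grids\<close>

lemma shifted_div_sum:
  fixes x d :: nat
  assumes "M > 0"
  shows "(\<Sum>t<K*M. (x + d + t) div M) = (\<Sum>t<K*M. (x + t) div M) + K * d"
proof (induction d)
  case (Suc d)
  \<comment> \<open>Moving the window of shifts by one exchanges the term \<open>y div M\<close> for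
    \<open>(y + K*M) div M\<close>, which is larger by exactly \<open>K\<close>.\<close>
  have "(\<Sum>t<K*M. (y + Suc t) div M) + y div M = (\<Sum>t<K*M. (y + t) div M) + (y + K*M) div M" for y
    using sum.lessThan_Suc_shift[of "\<lambda>t. (y + t) div M" "K*M"] sum.lessThan_Suc[of "\<lambda>t. (y + t) div M" "K*M"]
    by simp
  from this[of "x+d"] have "(\<Sum>t<K*M. (x + d + Suc t) div M) = (\<Sum>t<K*M. (x + d + t) div M) + K"
    using assms by simp
  thus ?case using Suc by simp
qed simp

text \<open>When a cell boundary separates the two points, the quotients differ by at least 1; so
  the indicator is at most their difference, whose sum over all shifts is known exactly. In relative
  terms a random grid of mesh \<open>M\<close> separates them with probability at most
  \<open>\<bar>x - y\<bar> / M\<close>.\<close>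

lemma separating_shifts:
  fixes x y :: nat
  assumes "M > 0"
  shows "(\<Sum>t<K*M. of_bool ((x + t) div M \<noteq> (y + t) div M)) \<le> real K * \<bar>real x - real y\<bar>"
proof -
  have *: "(\<Sum>t<K*M. of_bool ((x + t) div M \<noteq> (y + t) div M)) \<le> real K * (real y - real x)"
    if xy: "x \<le> y" for x y :: nat
  proof -
    obtain d where d: "y = x + d" using le_Suc_ex[OF xy] ..
    have "(\<Sum>t<K*M. (of_bool ((x + t) div M \<noteq> (y + t) div M)::real)) \<le> 
        (\<Sum>t<K*M. real ((y + t) div M) - real ((x + t) div M))"
    proof (intro sum_mono)
      fix t
      have "(x + t) div M \<le> (y + t) div M" using that by (intro div_le_mono) simp
      moreover have "(of_bool (a \<noteq> b)::real) \<le> real b - real a" if "a \<le> b" for a b :: nat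
        using that by auto
      ultimately show "(of_bool ((x + t) div M \<noteq> (y + t) div M)::real) \<le> real ((y + t) div M) - real ((x + t) div M)"
        by blast
    qed
    also have "\<dots> = real K * real d" using arg_cong[OF shifted_div_sum[OF assms, of x d K], of real]
      unfolding of_nat_sum of_nat_add of_nat_mult d sum_subtractf by linarith
    also have "real d = real y - real x" by (simp add: d)
    finally show ?thesis .
  qed
  show ?thesis
  proof (cases "x \<le> y")
    case True
    then have "\<bar>real x - real y\<bar> = real y - real x" by simp
    then show ?thesis using *[OF True] by (simp only:)
  next
    case False
    hence le: "y \<le> x" by simp
    have ab: "\<bar>real x - real y\<bar> = real x - real y" using False by simp
    have sym: "of_bool (a \<noteq> b) = (of_bool (b \<noteq> a) :: real)" for a b :: nat by (cases "a = b") auto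
    show ?thesis using *[OF le] unfolding ab sym[of "(y + _) div M"] .
  qed
qed

text \<open>The weight \<open>1 - D / 2^k\<close> bounds from below the share of shifts that keep a
  pair at distance \<open>D\<close> in one cell of side \<open>2^k\<close>. Summed over the scales
  it recovers the logarithm with its exact coefficient and a bounded additive error.\<close>

lemma log_scale_count:
  fixes D :: real
  assumes "D \<ge> 1"
  shows "ln 2 * (\<Sum>k<Suc n. max 0 (1 - D / 2^k)) \<ge> ln (2^n / D) - 2 * ln 2"
proof -
  \<comment> \<open>The extra term \<open>ln 2 * (D / 2^n)\<close> is the geometric tail of the
    subtracted ratios. With it, the induction step for \<open>D \<le> 2^n\<close> is an
    identity.\<close>
  have *: "ln 2 * (\<Sum>k<Suc n. max 0 (1 - D / 2^k)) \<ge> ln (2^n / D) - 2 * ln 2 + ln 2 * (D / 2^n)" if "D \<le> 2^n"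
    using that
  proof (induction n)
    case 0
    then show ?case using assms by simp
  next
    case (Suc n)
    show ?case
    proof (cases "D \<le> 2^n")
      case True
      have "ln (2^Suc n / D) = ln 2 + ln (2^n / D)" using assms by (simp add: ln_div ln_mult)
      moreover have "max 0 (1 - D / 2^Suc n) = 1 - D / 2^Suc n" using Suc by simp
      moreover have "D / 2^n = 2 * (D / 2^Suc n)" by simp
      moreover have *: "ln 2 * (S + (1 - x)) \<ge> ln 2 + L - 2 * ln 2 + ln 2 * x"
        if "ln 2 * S \<ge> L - 2 * ln 2 + ln 2 * (2 * x)" for L x S :: real
        using that by (simp add: algebra_simps)
      ultimately show ?thesis using *[of "ln (2^n / D)" "D / 2^Suc n", OF Suc.IH[OF True, unfolded \<open>D / 2^n = 2 * (D / 2^Suc n)\<close>]]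
        unfolding sum.lessThan_Suc[of _ "Suc n"] by (simp only:)
    next
      case False
      have "ln (2^Suc n / D) \<le> ln 2" using False assms by (intro ln_mono) (auto simp: field_simps)
      moreover have "ln 2 * (D / 2^Suc n) \<le> ln 2 * 1" using Suc by (intro mult_left_mono) auto
      moreover have "ln 2 * (\<Sum>k<Suc (Suc n). max 0 (1 - D / 2^k)) \<ge> 0" by (intro mult_nonneg_nonneg sum_nonneg) auto
      ultimately show ?thesis by linarith
    qed
  qed
  show ?thesis
  proof (cases "D \<le> 2^n")
    case True
    have "ln 2 * (D / 2^n) \<ge> 0" using assms by simp
    then show ?thesis using *[OF True] by linarith
  next
    case False
    have "ln (2^n / D) \<le> 0" using False assms by (intro ln_le_zero_iff[THEN iffD2]) (auto simp: field_simps)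
    moreover have "ln 2 * (\<Sum>k<Suc n. max 0 (1 - D / 2^k)) \<ge> 0" by (intro mult_nonneg_nonneg sum_nonneg) auto
    moreover have "ln 2 > (0::real)" by simp
    ultimately show ?thesis by linarith
  qed
qed

text \<open>Each shifted grid satisfies the tree inequality with the same right-hand side, hence so
  does the average over all shifts, whose kernel dominates the logarithm up to a constant. A union
  bound over the two coordinates produces the l1 distance; \<open>max 1\<close> regularizes the
  diagonal at the mesh.\<close>

lemma discrete_log_HLS:
  fixes q :: "'i \<Rightarrow> real" and p1 p2 :: "'i \<Rightarrow> nat"
  assumes fin: "finite I" and q0: "\<And>X. X \<in> I \<Longrightarrow> q X \<ge> 0" and q1: "(\<Sum>X\<in>I. q X) = 1"
    and p: "\<And>X. X \<in> I \<Longrightarrow> p1 X < 2^n" "\<And>X. X \<in> I \<Longrightarrow> p2 X < 2^n"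
    and inj: "inj_on (\<lambda>X. (p1 X, p2 X)) I"
  shows "(\<Sum>X\<in>I. \<Sum>Y\<in>I. q X * q Y * (2 * ln (2^n / 
             max 1 (\<bar>real (p1 X) - real (p1 Y)\<bar> + \<bar>real (p2 X) - real (p2 Y)\<bar>))))
         \<le> (\<Sum>X\<in>I. q X * ln (q X)) + real n * ln 4 + 35"
proof -
  define D where "D X Y = max 1 (\<bar>real (p1 X) - real (p1 Y)\<bar> + \<bar>real (p2 X) - real (p2 Y)\<bar>)" for X Y
  define same where "same s t k X Y = (of_bool ((p1 X + s) div 2^k = (p1 Y + s) div 2^k 
       \<and> (p2 X + t) div 2^k = (p2 Y + t) div 2^k) :: real)" for s t k X Y
  define N :: nat where "N = 2^n"
  let ?E = "(\<Sum>X\<in>I. q X * ln (q X)) + real (Suc n) * ln 4 + 30"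
  have N: "N > 0" by (simp add: N_def)
  \<comment> \<open>Shifting by less than \<open>2^n\<close> moves indices up to below
    \<open>2^(n+1)\<close>, so one additional level is required. It costs \<open>ln 4\<close>, an
    additive constant.\<close>
  have tree: "ln 4 * (\<Sum>k<Suc n. \<Sum>X\<in>I. \<Sum>Y\<in>I. q X * q Y * same s t k X Y) \<le> ?E" 
    if "s < N" "t < N" for s t
    unfolding same_def
  proof (rule discrete_tree_inequality[OF fin q0 q1])
    show "p1 X + s < 2 ^ Suc n" if "X \<in> I" for X using p(1)[OF that] \<open>s < N\<close> by (simp add: N_def)
    show "p2 X + t < 2 ^ Suc n" if "X \<in> I" for X using p(2)[OF that] \<open>t < N\<close> by (simp add: N_def)
    show "inj_on (\<lambda>X. (p1 X + s, p2 X + t)) I" using inj by (auto simp: inj_on_def)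
  qed
  have avg: "(\<Sum>s<N. \<Sum>t<N. same s t k X Y) \<ge> real N ^ 2 * max 0 (1 - D X Y / 2^k)" if "k < Suc n" for k X Y
  proof (cases "1 - D X Y / 2^k \<le> 0")
    case True
    then show ?thesis by (simp add: sum_nonneg same_def)
  next
    case False
    define M :: nat where "M = 2^k"
    define K :: nat where "K = 2^(n-k)"
    have NKM: "N = K * M" using that by (simp add: N_def K_def M_def flip: power_add)
    have M: "M > 0" by (simp add: M_def)
    let ?f = "\<lambda>s. of_bool ((p1 X + s) div M \<noteq> (p1 Y + s) div M) :: real"
    let ?g = "\<lambda>t. of_bool ((p2 X + t) div M \<noteq> (p2 Y + t) div M) :: real"
    have gen: "(\<Sum>s<N. \<Sum>t<N. 1 - f s - g t) = real N ^ 2 - real N * (\<Sum>s<N. f s) - real N * (\<Sum>t<N. g t)"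
      for f g :: "nat \<Rightarrow> real"
      by (simp add: sum_subtractf power2_eq_square right_diff_distrib flip: sum_distrib_left)
    have "(\<Sum>s<N. \<Sum>t<N. 1 - ?f s - ?g t) \<le> (\<Sum>s<N. \<Sum>t<N. same s t k X Y)"
      by (intro sum_mono) (auto simp: same_def M_def)
    moreover have "(\<Sum>s<N. \<Sum>t<N. 1 - ?f s - ?g t) 
       \<ge> real N ^ 2 - real N * (real K * \<bar>real (p1 X) - real (p1 Y)\<bar>) - real N * (real K * \<bar>real (p2 X) - real (p2 Y)\<bar>)"
      unfolding gen using separating_shifts[OF M, where K = K and x = "p1 X" and y = "p1 Y"] 
        separating_shifts[OF M, where K = K and x = "p2 X" and y = "p2 Y"]
      unfolding NKM[symmetric] by (intro diff_mono mult_left_mono order_refl) auto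
    ultimately have "real N ^ 2 - real N * (real K * (\<bar>real (p1 X) - real (p1 Y)\<bar> + \<bar>real (p2 X) - real (p2 Y)\<bar>))
       \<le> (\<Sum>s<N. \<Sum>t<N. same s t k X Y)"
      by (simp add: algebra_simps)
    moreover have "real N * (real K * (\<bar>real (p1 X) - real (p1 Y)\<bar> + \<bar>real (p2 X) - real (p2 Y)\<bar>)) \<le> real N * (real K * D X Y)"
      by (intro mult_left_mono) (auto simp: D_def)
    moreover have "real N * (real K * D X Y) = real N ^ 2 * (D X Y / 2^k)"
      using NKM by (simp add: power2_eq_square M_def)
    ultimately show ?thesis using False by (simp add: algebra_simps)
  qed
  have qq: "q X * q Y \<ge> 0" if "X \<in> I" "Y \<in> I" for X Y using q0 that by simp
  have "real N ^ 2 * (ln 4 * (\<Sum>X\<in>I. \<Sum>Y\<in>I. q X * q Y * (\<Sum>k<Suc n. max 0 (1 - D X Y / 2^k))))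
     = ln 4 * (\<Sum>X\<in>I. \<Sum>Y\<in>I. q X * q Y * (\<Sum>k<Suc n. real N ^ 2 * max 0 (1 - D X Y / 2^k)))"
    by (simp add: sum_distrib_left mult_ac del: sum.lessThan_Suc)
  also have "\<dots> \<le> ln 4 * (\<Sum>X\<in>I. \<Sum>Y\<in>I. q X * q Y * (\<Sum>k<Suc n. (\<Sum>s<N. \<Sum>t<N. same s t k X Y)))"
    by (intro mult_left_mono sum_mono avg qq) auto
  also have "\<dots> = (\<Sum>s<N. \<Sum>t<N. ln 4 * (\<Sum>k<Suc n. \<Sum>X\<in>I. \<Sum>Y\<in>I. q X * q Y * same s t k X Y))"
  proof -
    let ?g = "\<lambda>XY k st. q (fst XY) * q (snd XY) * same (fst st) (snd st) k (fst XY) (snd XY)"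
    let ?S = "{..<N} \<times> {..<N}" and ?K = "{..<Suc n}"
    have "(\<Sum>X\<in>I. \<Sum>Y\<in>I. q X * q Y * (\<Sum>k<Suc n. \<Sum>s<N. \<Sum>t<N. same s t k X Y)) 
       = (\<Sum>XY\<in>I\<times>I. \<Sum>k\<in>?K. \<Sum>st\<in>?S. ?g XY k st)"
      unfolding sum_distrib_left sum.cartesian_product[where A = "{..<N}" and B = "{..<N}"]
        sum.cartesian_product[where A = I and B = I] by (simp only: case_prod_unfold)
    also have "\<dots> = (\<Sum>k\<in>?K. \<Sum>XY\<in>I\<times>I. \<Sum>st\<in>?S. ?g XY k st)" by (rule sum.swap)
    also have "\<dots> = (\<Sum>k\<in>?K. \<Sum>st\<in>?S. \<Sum>XY\<in>I\<times>I. ?g XY k st)"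
      by (rule sum.cong[OF refl]) (rule sum.swap)
    also have "\<dots> = (\<Sum>st\<in>?S. \<Sum>k\<in>?K. \<Sum>XY\<in>I\<times>I. ?g XY k st)" by (rule sum.swap)
    also have "\<dots> = (\<Sum>s<N. \<Sum>t<N. \<Sum>k<Suc n. \<Sum>X\<in>I. \<Sum>Y\<in>I. q X * q Y * same s t k X Y)"
      unfolding sum.cartesian_product[where A = "{..<N}" and B = "{..<N}"]
        sum.cartesian_product[where A = I and B = I] by (simp only: case_prod_unfold)
    finally show ?thesis by (simp only: sum_distrib_left[symmetric])
  qed
  also have "\<dots> \<le> (\<Sum>s<N. \<Sum>t<N. ?E)"
    by (intro sum_mono tree) auto
  also have "\<dots> = real N ^ 2 * ?E" by (simp add: power2_eq_square)
  finally have main: "ln 4 * (\<Sum>X\<in>I. \<Sum>Y\<in>I. q X * q Y * (\<Sum>k<Suc n. max 0 (1 - D X Y / 2^k))) \<le> ?E"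
    using N by (simp del: sum.lessThan_Suc)
  have ln4: "ln (4::real) = 2 * ln 2" using ln_realpow[of 2 2] by simp
  have "(\<Sum>X\<in>I. \<Sum>Y\<in>I. q X * q Y * (2 * ln (2^n / D X Y)))
     \<le> (\<Sum>X\<in>I. \<Sum>Y\<in>I. q X * q Y * (ln 4 * (\<Sum>k<Suc n. max 0 (1 - D X Y / 2^k)) + 4 * ln 2))"
  proof (intro sum_mono mult_left_mono qq)
    fix X Y
    have "D X Y \<ge> 1" by (simp add: D_def)
    from log_scale_count[OF this, of n]
    show "2 * ln (2^n / D X Y) \<le> ln 4 * (\<Sum>k<Suc n. max 0 (1 - D X Y / 2^k)) + 4 * ln 2"
      unfolding ln4 by linarith
  qed
  also have "\<dots> = ln 4 * (\<Sum>X\<in>I. \<Sum>Y\<in>I. q X * q Y * (\<Sum>k<Suc n. max 0 (1 - D X Y / 2^k))) 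
       + 4 * ln 2 * ((\<Sum>X\<in>I. q X) * (\<Sum>Y\<in>I. q Y))"
    unfolding sum_product by (simp add: distrib_left sum.distrib sum_distrib_left mult_ac del: sum.lessThan_Suc)
  also have "\<dots> \<le> ?E + 4 * ln 2" using main q1 by simp
  \<comment> \<open>The additional level and the error in the count of scales amount to
    \<open>6 * ln 2\<close>, which is less than 5.\<close>
  also have "\<dots> \<le> (\<Sum>X\<in>I. q X * ln (q X)) + real n * ln 4 + 35"
    using ln2_le_25_over_36 unfolding ln4 by (simp add: algebra_simps)
  finally show ?thesis unfolding D_def .
qed

section \<open>Compactly supported functions and integration by parts\<close>

lemma integral_lborel_translate:
  fixes g :: "'a::euclidean_space \<Rightarrow> real"
  assumes "g \<in> borel_measurable borel"
  shows "(LINT x|lborel. g (x + c)) = (LINT x|lborel. g x)"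
    and "integrable lborel (\<lambda>x. g (x + c)) \<longleftrightarrow> integrable lborel g"
proof -
  have 1: "(LINT x|distr lborel borel ((+) c). g x) = (LINT x|lborel. g (c + x))"
    by (rule integral_distr) (use assms in auto)
  have 2: "integrable (distr lborel borel ((+) c)) g \<longleftrightarrow> integrable lborel (\<lambda>x. g (c + x))"
    by (rule integrable_distr_eq) (use assms in auto)
  show "(LINT x|lborel. g (x + c)) = (LINT x|lborel. g x)"
    and "integrable lborel (\<lambda>x. g (x + c)) \<longleftrightarrow> integrable lborel g"
    using 1 2 by (simp_all add: lborel_distr_plus add.commute)
qed

lemma integrable_compact_support:
  fixes f :: "'a::euclidean_space \<Rightarrow> real"
  assumes "continuous_on UNIV f" "\<And>x. r \<le> norm x \<Longrightarrow> f x = 0"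
  shows "integrable lborel f"
proof -
  have "integrable lborel (\<lambda>x. indicator (cball 0 r) x *\<^sub>R f x)"
    using assms(1) by (intro borel_integrable_compact) (auto intro: continuous_on_subset)
  moreover have "(\<lambda>x. indicator (cball 0 r) x *\<^sub>R f x) = f"
    using assms(2) by (auto simp: fun_eq_iff indicator_def)
  ultimately show ?thesis by simp
qed

text \<open>Difference quotients integrate to 0 by translation invariance, and the Lipschitz bound
  allows dominated convergence. Differentiability is only asked off a null set, so that the result
  applies to the gradient of a logarithm truncated at a circle, which is Lipschitz but has a kink
  there.\<close>

lemma integral_directional_derivative_eq_0:
  fixes g :: "'a::euclidean_space \<Rightarrow> real"
  assumes lip: "\<And>x y. \<bar>g x - g y\<bar> \<le> M * norm (x - y)"
    and supp: "\<And>x. r \<le> norm x \<Longrightarrow> g x = 0"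
    and N: "N \<in> null_sets lborel"
    and der: "\<And>x. x \<notin> N \<Longrightarrow> (g has_derivative D x) (at x)"
    and h: "h \<in> borel_measurable borel" "\<And>x. x \<notin> N \<Longrightarrow> h x = D x e"
  shows "integrable lborel h" "(LINT x|lborel. h x) = 0"
proof -
  define t where "t n = 1 / real (Suc n)" for n
  have t: "t n > 0" "t n \<le> 1" for n by (auto simp: t_def field_simps)
  have t0: "t \<longlonglongrightarrow> 0" unfolding t_def by (rule LIMSEQ_Suc[OF lim_1_over_n])
  have cont: "continuous_on UNIV g"
  proof (rule continuous_onI)
    fix x and \<epsilon> :: real assume "\<epsilon> > 0"
    show "\<exists>d>0. \<forall>x'\<in>UNIV. dist x' x < d \<longrightarrow> dist (g x') (g x) \<le> \<epsilon>"
    proof (intro exI[of _ "\<epsilon> / (\<bar>M\<bar> + 1)"] conjI ballI impI)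
      fix x' assume "dist x' x < \<epsilon> / (\<bar>M\<bar> + 1)"
      hence "norm (x' - x) * (\<bar>M\<bar> + 1) \<le> \<epsilon>" by (simp add: dist_norm field_simps)
      moreover have "dist (g x') (g x) \<le> M * norm (x' - x)" using lip by (simp add: dist_real_def)
      moreover have "norm (x' - x) * M \<le> norm (x' - x) * (\<bar>M\<bar> + 1)"
        by (intro mult_left_mono) auto
      hence "M * norm (x' - x) \<le> norm (x' - x) * (\<bar>M\<bar> + 1)" by (simp add: mult.commute)
      ultimately show "dist (g x') (g x) \<le> \<epsilon>" by linarith
    qed (use \<open>\<epsilon> > 0\<close> in auto)
  qed
  have gm: "g \<in> borel_measurable borel" using cont by (simp add: borel_measurable_continuous_onI)
  have gi: "integrable lborel g" by (rule integrable_compact_support[OF cont supp])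
  define s where "s n x = (g (x + t n *\<^sub>R e) - g x) / t n" for n x
  \<comment> \<open>All steps \<open>t n\<close> are at most 1, so every difference quotient
    vanishes outside the ball enlarged by \<open>norm e\<close>.\<close>
  define w where "w x = indicat_real (cball 0 (r + norm e)) x *\<^sub>R (\<bar>M\<bar> * norm e)" for x :: 'a
  have wi: "integrable lborel w"
    unfolding w_def by (intro borel_integrable_compact) auto
  have sz: "(LINT x|lborel. s n x) = 0" for n
    unfolding s_def using gi gm by (simp add: integral_lborel_translate)
  have sm: "s n \<in> borel_measurable lborel" for n
    unfolding s_def using gm by simp
  have lim: "AE x in lborel. (\<lambda>n. s n x) \<longlonglongrightarrow> h x"
  proof (rule AE_I'[OF N], safe)
    fix x assume nl: "\<not> (\<lambda>n. s n x) \<longlonglongrightarrow> h x"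
    show "x \<in> N"
    proof (rule ccontr)
      assume x: "x \<notin> N"
      have "((\<lambda>u. g (x + u *\<^sub>R e)) has_derivative (\<lambda>u. D x (u *\<^sub>R e))) (at 0)"
        by (rule has_derivative_compose[where g = g and f = "\<lambda>u. x + u *\<^sub>R e", THEN has_derivative_eq_rhs])
           (use der[OF x] in \<open>auto intro!: derivative_eq_intros\<close>)
      moreover have "(\<lambda>u. D x (u *\<^sub>R e)) = (*) (h x)"
        using linear_cmul[OF has_derivative_linear[OF der[OF x]]] h(2)[OF x] by (auto simp: fun_eq_iff)
      ultimately have "((\<lambda>u. g (x + u *\<^sub>R e)) has_field_derivative h x) (at 0)"
        by (simp add: has_field_derivative_def)
      hence "((\<lambda>u. (g (x + u *\<^sub>R e) - g x) / u) \<longlongrightarrow> h x) (at 0)"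
        by (simp add: has_field_derivative_iff)
      moreover have "filterlim t (at 0) sequentially"
        using t0 t(1) by (simp add: filterlim_at less_imp_neq[symmetric] eventually_sequentially)
      ultimately have "(\<lambda>n. s n x) \<longlonglongrightarrow> h x"
        unfolding s_def by (rule filterlim_compose)
      with nl show False by simp
    qed
  qed
  have bd: "AE x in lborel. norm (s n x) \<le> w x" for n
  proof (rule AE_I2)
    fix x
    have "norm (s n x) \<le> \<bar>M\<bar> * norm e"
    proof -
      have "\<bar>g (x + t n *\<^sub>R e) - g x\<bar> \<le> M * norm (t n *\<^sub>R e)" using lip[of "x + t n *\<^sub>R e" x] by simp
      also have "\<dots> \<le> \<bar>M\<bar> * norm (t n *\<^sub>R e)" by (intro mult_right_mono) auto
      also have "\<dots> = t n * (\<bar>M\<bar> * norm e)" using t[of n] by simp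
      finally show ?thesis using t[of n] unfolding s_def by (simp add: abs_divide field_simps)
    qed
    moreover have "s n x = 0" if "norm x > r + norm e"
    proof -
      have "norm x \<le> norm (x + t n *\<^sub>R e) + norm (t n *\<^sub>R e)"
        by (metis add_diff_cancel_right' norm_triangle_ineq4)
      also have "norm (t n *\<^sub>R e) \<le> norm e" using t[of n] by (simp add: mult_left_le_one_le)
      finally have "r \<le> norm (x + t n *\<^sub>R e)" using that by simp
      moreover have "r \<le> norm x" using that norm_ge_zero[of e] by linarith
      ultimately show ?thesis unfolding s_def by (simp add: supp)
    qed
    ultimately show "norm (s n x) \<le> w x" unfolding w_def by (auto simp: indicator_def)
  qed
  have hm: "h \<in> borel_measurable lborel" using h by simp
  show "integrable lborel h"
    by (rule integrable_dominated_convergence[OF hm sm wi lim bd])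
  have "(\<lambda>n. LINT x|lborel. s n x) \<longlonglongrightarrow> (LINT x|lborel. h x)"
    by (rule integral_dominated_convergence[OF hm sm wi lim bd])
  thus "(LINT x|lborel. h x) = 0" unfolding sz by (simp add: LIMSEQ_const_iff)
qed

section \<open>Continuous and C^1 functions with compact support in the disc\<close>

definition Cc :: "(plane \<Rightarrow> real) \<Rightarrow> bool" where
  "Cc f \<longleftrightarrow> continuous_on UNIV f \<and> (\<exists>r<1. \<forall>x. r \<le> norm x \<longrightarrow> f x = 0)"

text \<open>One continuous derivative is the natural class here: truncated logarithms belong to it
  but are not smooth. The gradient is an explicit argument, which keeps the formulas for
  \<open>logpot_grad\<close> and \<open>cutlog_grad\<close> available, and the support has a
  positive distance from the circle.\<close>

definition C1c :: "(plane \<Rightarrow> real) \<Rightarrow> (plane \<Rightarrow> plane) \<Rightarrow> bool" where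
  "C1c f G \<longleftrightarrow> (\<forall>x. (f has_derivative (\<lambda>h. G x \<bullet> h)) (at x)) \<and> continuous_on UNIV G \<and>
     (\<exists>r<1. \<forall>x. r \<le> norm x \<longrightarrow> f x = 0 \<and> G x = 0)"

lemma Cc_integrable: "Cc f \<Longrightarrow> integrable lborel f"
  unfolding Cc_def using integrable_compact_support by blast

lemma Cc_measurable: "Cc f \<Longrightarrow> f \<in> borel_measurable borel"
  unfolding Cc_def by (simp add: borel_measurable_continuous_onI)

lemma Cc_mult_left: "Cc f \<Longrightarrow> continuous_on UNIV g \<Longrightarrow> Cc (\<lambda>x. g x * f x)"
  unfolding Cc_def by (auto intro!: continuous_intros)

lemma Cc_mult_right: "Cc f \<Longrightarrow> continuous_on UNIV g \<Longrightarrow> Cc (\<lambda>x. f x * g x)"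
  unfolding Cc_def by (auto intro!: continuous_intros)

lemma Cc_mult: "Cc f \<Longrightarrow> Cc g \<Longrightarrow> Cc (\<lambda>x. f x * g x)"
  unfolding Cc_def by (auto intro!: continuous_intros)

lemma Cc_cmult: "Cc f \<Longrightarrow> Cc (\<lambda>x. c * f x)"
  by (intro Cc_mult_left continuous_intros)

lemma Cc_power2: "Cc f \<Longrightarrow> Cc (\<lambda>x. (f x)\<^sup>2)"
  unfolding power2_eq_square by (rule Cc_mult)

lemma Cc_add: assumes "Cc f" "Cc g" shows "Cc (\<lambda>x. f x + g x)"
proof -
  obtain r s where "r < 1" "s < 1" "\<forall>x. r \<le> norm x \<longrightarrow> f x = 0" "\<forall>x. s \<le> norm x \<longrightarrow> g x = 0"
    using assms unfolding Cc_def by blast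
  thus ?thesis using assms unfolding Cc_def by (auto intro!: continuous_intros exI[of _ "max r s"])
qed

lemma Cc_diff: "Cc f \<Longrightarrow> Cc g \<Longrightarrow> Cc (\<lambda>x. f x - g x)"
  using Cc_add[of f "\<lambda>x. (-1) * g x"] Cc_cmult[of g "-1"] by simp

lemma Cc_abs: "Cc f \<Longrightarrow> Cc (\<lambda>x. \<bar>f x\<bar>)"
  unfolding Cc_def by (auto intro!: continuous_intros)

lemma Cc_0: "Cc (\<lambda>x. 0)"
  unfolding Cc_def by (auto intro!: exI[of _ 0])

lemma Cc_sum: "(\<And>i. i \<in> I \<Longrightarrow> Cc (f i)) \<Longrightarrow> Cc (\<lambda>x. \<Sum>i\<in>I. f i x)"
proof (induction I rule: infinite_finite_induct)
  case (insert i I)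
  then show ?case using Cc_add[of "f i" "\<lambda>x. \<Sum>i\<in>I. f i x"] by simp
qed (simp_all add: Cc_0)

lemma continuous_on_UNIV_if_supported_in_disc:
  fixes f :: "plane \<Rightarrow> 'b::real_normed_vector"
  assumes "continuous_on disc f" "r < 1" "\<And>x. r \<le> norm x \<Longrightarrow> f x = 0"
  shows "continuous_on UNIV f"
proof -
  have "continuous_on {x::plane. r < norm x} f"
    using continuous_on_const[of _ 0] by (rule continuous_on_eq) (use assms(3) in auto)
  moreover have "open {x::plane. r < norm x}" by (intro open_Collect_less continuous_intros)
  moreover have "disc \<union> {x::plane. r < norm x} = UNIV" using assms(2) by (auto simp: not_less)
  ultimately show ?thesis using continuous_on_open_Un[of disc "{x. r < norm x}" f] assms(1) by simp
qed

text \<open>Meant for weights such as \<open>1 / (1 - (norm x)^2)^2\<close> that are singular on the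
  circle; the gap between the support and the circle makes the product continuous on the whole
  plane.\<close>

lemma Cc_mult_disc:
  assumes "Cc f" "continuous_on disc g"
  shows "Cc (\<lambda>x. f x * g x)"
proof -
  obtain r where r: "r < 1" "\<And>x. r \<le> norm x \<Longrightarrow> f x = 0" using assms unfolding Cc_def by blast
  have "continuous_on disc (\<lambda>x. f x * g x)"
    using assms unfolding Cc_def by (intro continuous_intros) (auto intro: continuous_on_subset)
  hence "continuous_on UNIV (\<lambda>x. f x * g x)"
    by (rule continuous_on_UNIV_if_supported_in_disc[OF _ r(1)]) (simp add: r)
  thus ?thesis unfolding Cc_def using r by auto
qed

lemma C1c_der: "C1c f G \<Longrightarrow> (f has_derivative (\<lambda>h. G x \<bullet> h)) (at x)"
  unfolding C1c_def by blast

lemma C1c_Cc: "C1c f G \<Longrightarrow> Cc f"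
  unfolding C1c_def Cc_def
  by (meson continuous_at_imp_continuous_on has_derivative_continuous)

lemma C1c_Cc_grad: "C1c f G \<Longrightarrow> Cc (\<lambda>x. G x \<bullet> e)"
  unfolding C1c_def Cc_def by (auto intro!: continuous_intros)

lemma C1c_Cc_component: "C1c f G \<Longrightarrow> Cc (\<lambda>x. G x $ i)"
  using C1c_Cc_grad[of f G "axis i 1"] by (simp add: inner_axis)

lemma C1c_Cc_grad_inner: "C1c f G \<Longrightarrow> continuous_on UNIV H \<Longrightarrow> Cc (\<lambda>x. G x \<bullet> H x)"
  unfolding C1c_def Cc_def by (auto intro!: continuous_intros)

lemma C1c_cont_grad: "C1c f G \<Longrightarrow> continuous_on UNIV G"
  unfolding C1c_def by blast

lemma C1c_Cc_norm: "C1c f G \<Longrightarrow> Cc (\<lambda>x. (norm (G x))\<^sup>2)"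
  unfolding power2_norm_eq_inner by (intro C1c_Cc_grad_inner C1c_cont_grad)

lemma C1c_cmult: "C1c f G \<Longrightarrow> C1c (\<lambda>x. c * f x) (\<lambda>x. c *\<^sub>R G x)"
  unfolding C1c_def by (auto intro!: derivative_eq_intros continuous_intros)

lemma C1c_add: assumes "C1c f G" "C1c g H" shows "C1c (\<lambda>x. f x + g x) (\<lambda>x. G x + H x)"
proof -
  obtain r s where "r < 1" "s < 1" "\<forall>x. r \<le> norm x \<longrightarrow> f x = 0 \<and> G x = 0" "\<forall>x. s \<le> norm x \<longrightarrow> g x = 0 \<and> H x = 0"
    using assms unfolding C1c_def by blast
  thus ?thesis using assms unfolding C1c_def 
    by (auto intro!: derivative_eq_intros continuous_intros exI[of _ "max r s"] simp: inner_add_left)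
qed

lemma C1c_diff: "C1c f G \<Longrightarrow> C1c g H \<Longrightarrow> C1c (\<lambda>x. f x - g x) (\<lambda>x. G x - H x)"
  using C1c_add[of f G "\<lambda>x. (-1) * g x" "\<lambda>x. (-1) *\<^sub>R H x"] C1c_cmult[of g H "-1"] by simp

lemma C1c_0: "C1c (\<lambda>x. 0) (\<lambda>x. 0)"
proof -
  have "(\<bullet>) (0::plane) = (\<lambda>_. 0)" by auto
  thus ?thesis unfolding C1c_def by (auto intro!: exI[of _ 0])
qed

lemma C1c_sum: "(\<And>i. i \<in> I \<Longrightarrow> C1c (f i) (G i)) \<Longrightarrow> C1c (\<lambda>x. \<Sum>i\<in>I. f i x) (\<lambda>x. \<Sum>i\<in>I. G i x)"
proof (induction I rule: infinite_finite_induct)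
  case (insert i I)
  then show ?case using C1c_add[of "f i" "G i" "\<lambda>x. \<Sum>i\<in>I. f i x"] by simp
qed (simp_all add: C1c_0)

lemma C1c_mult_disc:
  assumes f: "C1c f G" and g: "\<And>x. x \<in> disc \<Longrightarrow> (g has_derivative (\<lambda>h. H x \<bullet> h)) (at x)"
    and H: "continuous_on disc H"
  shows "C1c (\<lambda>x. f x * g x) (\<lambda>x. g x *\<^sub>R G x + f x *\<^sub>R H x)"
proof -
  obtain r where r: "r < 1" "\<And>x. r \<le> norm x \<Longrightarrow> f x = 0 \<and> G x = 0" using f unfolding C1c_def by blast
  have fc: "continuous_on UNIV f" using C1c_Cc[OF f] by (simp add: Cc_def)
  have gc: "continuous_on disc g" 
    by (meson g continuous_at_imp_continuous_on has_derivative_continuous)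
  have "continuous_on disc (\<lambda>x. g x *\<^sub>R G x + f x *\<^sub>R H x)"
    by (intro continuous_intros gc H continuous_on_subset[OF fc] continuous_on_subset[OF C1c_cont_grad[OF f]]) auto
  hence c: "continuous_on UNIV (\<lambda>x. g x *\<^sub>R G x + f x *\<^sub>R H x)"
    by (rule continuous_on_UNIV_if_supported_in_disc[OF _ r(1)]) (simp add: r)
  have "((\<lambda>x. f x * g x) has_derivative (\<lambda>h. (g x *\<^sub>R G x + f x *\<^sub>R H x) \<bullet> h)) (at x)" for x
  proof (cases "x \<in> disc")
    case True
    show ?thesis
      by (rule has_derivative_eq_rhs[OF has_derivative_mult[OF C1c_der[OF f] g[OF True]]])
         (auto simp: inner_add_left algebra_simps)
  next
    case False
    hence x: "x \<in> {x. r < norm x}" using r(1) by (auto simp: not_less)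
    have "open {x::plane. r < norm x}" by (intro open_Collect_less continuous_intros)
    hence "((\<lambda>x. f x * g x) has_derivative (\<lambda>h. 0)) (at x)"
      by (intro has_derivative_transform_within_open[OF has_derivative_const[of 0], OF _ x]) (use r in auto)
    moreover have "f x = 0" "G x = 0" using r x by auto
    ultimately show ?thesis by simp
  qed
  thus ?thesis unfolding C1c_def using c r by auto
qed

lemma C1c_mult: "C1c f G \<Longrightarrow> C1c g H \<Longrightarrow> C1c (\<lambda>x. f x * g x) (\<lambda>x. g x *\<^sub>R G x + f x *\<^sub>R H x)"
  by (rule C1c_mult_disc) (auto intro: C1c_der continuous_on_subset[OF C1c_cont_grad])

lemma C1c_bounded_grad:
  assumes "C1c f G"
  obtains M where "M \<ge> 0" "\<And>x. norm (G x) \<le> M"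
proof -
  obtain r where r: "r < 1" "\<And>x. r \<le> norm x \<Longrightarrow> G x = 0" using assms unfolding C1c_def by blast
  have "bounded (G ` cball 0 1)"
    by (intro compact_imp_bounded compact_continuous_image continuous_on_subset[OF C1c_cont_grad[OF assms]]) auto
  then obtain M where M: "\<And>x. x \<in> cball 0 1 \<Longrightarrow> norm (G x) \<le> M"
    unfolding bounded_iff by blast
  have "norm (G x) \<le> max M 0" for x
  proof (cases "norm x \<le> 1")
    case True
    hence "norm (G x) \<le> M" by (intro M) simp
    then show ?thesis by simp
  next
    case False
    then show ?thesis using r(1) r(2)[of x] by simp
  qed
  thus ?thesis using that[of "max M 0"] by auto
qed

lemma C1c_lipschitz:
  assumes "C1c f G" "\<And>x. norm (G x) \<le> M"
  shows "\<bar>f x - f y\<bar> \<le> M * norm (x - y)"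
proof -
  have "norm (f x - f y) \<le> M * norm (x - y)"
  proof (rule differentiable_bound)
    show "convex (UNIV::plane set)" by simp
    show "(f has_derivative (\<lambda>h. G z \<bullet> h)) (at z within UNIV)" for z using C1c_der[OF assms(1)] by simp
    show "onorm (\<lambda>h. G z \<bullet> h) \<le> M" for z
    proof (rule onorm_le)
      fix h
      have "\<bar>G z \<bullet> h\<bar> \<le> norm (G z) * norm h" by (rule Cauchy_Schwarz_ineq2)
      also have "\<dots> \<le> M * norm h" using assms(2) by (intro mult_right_mono) auto
      finally show "norm (G z \<bullet> h) \<le> M * norm h" by simp
    qed
  qed auto
  thus ?thesis by simp
qed

lemma C1c_integral_grad:
  assumes "C1c f G"
  shows "(LINT x|lborel. G x \<bullet> e) = 0"
proof -
  obtain M where M: "\<And>x. norm (G x) \<le> M" using C1c_bounded_grad[OF assms] by metis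
  obtain r where r: "\<And>x. r \<le> norm x \<Longrightarrow> f x = 0" using assms unfolding C1c_def by blast
  show ?thesis
    by (rule integral_directional_derivative_eq_0(2)[where g = f and r = r and M = M and N = "{}" and D = "\<lambda>x h. G x \<bullet> h" and e = e])
       (use C1c_lipschitz[OF assms M] r C1c_der[OF assms] Cc_measurable[OF C1c_Cc_grad[OF assms]] in auto)
qed

section \<open>Improved Hardy inequality\<close>

text \<open>Integrals are taken over the plane with respect to \<open>lborel\<close>; for functions
  supported in the disc this changes no value and makes translations available.\<close>

definition dirichlet :: "(plane \<Rightarrow> plane) \<Rightarrow> real" where
  "dirichlet G = (LINT x|lborel. (norm (G x))\<^sup>2)"

definition hardy :: "(plane \<Rightarrow> real) \<Rightarrow> real" where
  "hardy f = (LINT x|lborel. (f x)\<^sup>2 / (1 - (norm x)\<^sup>2)\<^sup>2)"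

lemma disc_gap: "x \<in> disc \<Longrightarrow> 1 - (norm (x::plane))\<^sup>2 > 0"
  by (simp add: abs_square_less_1 power_less_one_iff)

lemma continuous_on_gap_power: "continuous_on disc (\<lambda>x::plane. 1 / (1 - (norm x)\<^sup>2) ^ k)"
proof -
  have "(1 - (norm x)\<^sup>2) ^ k \<noteq> 0" if "x \<in> disc" for x :: plane using disc_gap[OF that] by simp
  thus ?thesis by (intro continuous_intros ballI)
qed

lemma Cc_hardy: "Cc f \<Longrightarrow> Cc (\<lambda>x. f x / (1 - (norm x)\<^sup>2)\<^sup>2)"
  using Cc_mult_disc[OF _ continuous_on_gap_power[of 2]] by simp

lemma has_derivative_norm_sq: "((\<lambda>x::plane. (norm x)\<^sup>2) has_derivative (\<lambda>h. (2 *\<^sub>R x) \<bullet> h)) (at x)"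
  unfolding power2_norm_eq_inner
  by (auto intro!: derivative_eq_intros simp: inner_commute)

lemma has_derivative_component: "((\<lambda>x::plane. x $ i) has_derivative (\<lambda>h. axis i 1 \<bullet> h)) (at x)"
proof -
  have "((\<lambda>x::plane. x $ i) has_derivative (\<lambda>h. h $ i)) (at x)" by (intro bounded_linear_imp_has_derivative bounded_linear_vec_nth)
  thus ?thesis by (simp add: inner_axis' )
qed

context
  fixes e :: plane assumes e: "norm e = 1"
begin

text \<open>The field \<open>- grad \<phi> / \<phi>\<close> of the positive supersolution \<open>\<phi>\<close> with
  \<open>\<phi>\<^sup>2 = (1 - (norm x)\<^sup>2) / norm (x - e)\<close>, whose pole \<open>e\<close> lies on the unit circle.\<close>
definition hardy_field :: "plane \<Rightarrow> plane" where
  "hardy_field x = (1 / (1 - (norm x)\<^sup>2)) *\<^sub>R x + (1 / (2 * (norm (x - e))\<^sup>2)) *\<^sub>R (x - e)"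

definition hardy_field_grad :: "2 \<Rightarrow> plane \<Rightarrow> plane" where
  "hardy_field_grad i x = (1 / (1 - (norm x)\<^sup>2)) *\<^sub>R axis i 1 + (2 * x $ i / (1 - (norm x)\<^sup>2)\<^sup>2) *\<^sub>R x
     + (1 / (2 * (norm (x - e))\<^sup>2)) *\<^sub>R axis i 1 - ((x - e) $ i / (norm (x - e))^4) *\<^sub>R (x - e)"

lemma pole_dist_pos: "x \<in> disc \<Longrightarrow> norm (x - e) > 0"
  using e by auto

lemma hardy_field_derivative:
  assumes x: "x \<in> disc"
  shows "((\<lambda>x. hardy_field x $ i) has_derivative (\<lambda>h. hardy_field_grad i x \<bullet> h)) (at x)"
proof -
  have s: "1 - (norm x)\<^sup>2 \<noteq> 0" and q: "norm (x - e) \<noteq> 0" using disc_gap[OF x] pole_dist_pos[OF x] by auto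
  have d1: "((\<lambda>x. 1 - (norm x)\<^sup>2) has_derivative (\<lambda>h. - ((2 *\<^sub>R x) \<bullet> h))) (at x)"
    by (auto intro!: derivative_eq_intros has_derivative_norm_sq)
  have d2: "((\<lambda>x. 2 * (norm (x - e))\<^sup>2) has_derivative (\<lambda>h. 2 * ((2 *\<^sub>R (x - e)) \<bullet> h))) (at x)"
    by (rule has_derivative_mult_right)
       (rule has_derivative_compose[OF _ has_derivative_norm_sq, where f = "\<lambda>x. x - e", THEN has_derivative_eq_rhs],
         auto intro!: derivative_eq_intros)
  have d3: "((\<lambda>x. (x - e) $ i) has_derivative (\<lambda>h. axis i 1 \<bullet> h)) (at x)"
    by (rule has_derivative_compose[OF _ has_derivative_component, where f = "\<lambda>x. x - e", THEN has_derivative_eq_rhs])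
       (auto intro!: derivative_eq_intros)
  have A: "((\<lambda>x. x $ i / (1 - (norm x)\<^sup>2)) has_derivative
     (\<lambda>h. ((1 / (1 - (norm x)\<^sup>2)) *\<^sub>R axis i 1 + (2 * x $ i / (1 - (norm x)\<^sup>2)\<^sup>2) *\<^sub>R x) \<bullet> h)) (at x)"
  proof (rule has_derivative_eq_rhs[OF has_derivative_divide'[OF has_derivative_component d1 s]], rule ext)
    fix h
    have "(a * s - b * (- (2 * c))) / (s * s) = (1 / s) * a + (2 * b / s\<^sup>2) * c" if "s \<noteq> 0" for a b c s :: real
      using that by (simp add: field_simps power2_eq_square)
    from this[OF s] show "(axis i 1 \<bullet> h * (1 - (norm x)\<^sup>2) - x $ i * - (2 *\<^sub>R x \<bullet> h)) / ((1 - (norm x)\<^sup>2) * (1 - (norm x)\<^sup>2))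
       = ((1 / (1 - (norm x)\<^sup>2)) *\<^sub>R axis i 1 + (2 * x $ i / (1 - (norm x)\<^sup>2)\<^sup>2) *\<^sub>R x) \<bullet> h"
      by (simp only: inner_add_left inner_scaleR_left)
  qed
  have B: "((\<lambda>x. (x - e) $ i / (2 * (norm (x - e))\<^sup>2)) has_derivative
     (\<lambda>h. ((1 / (2 * (norm (x - e))\<^sup>2)) *\<^sub>R axis i 1 - ((x - e) $ i / (norm (x - e))^4) *\<^sub>R (x - e)) \<bullet> h)) (at x)"
  proof (rule has_derivative_eq_rhs[OF has_derivative_divide'[OF d3 d2]], goal_cases)
    case 2
    show ?case
    proof
      fix h
      have "(a * (2 * n\<^sup>2) - b * (2 * (2 * c))) / (2 * n\<^sup>2 * (2 * n\<^sup>2)) = (1 / (2 * n\<^sup>2)) * a - (b / n^4) * c"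
        if "n \<noteq> 0" for a b c n :: real
        using that by (simp add: field_simps power2_eq_square power4_eq_xxxx)
      from this[OF q] show "(axis i 1 \<bullet> h * (2 * (norm (x - e))\<^sup>2) - (x - e) $ i * (2 * (2 *\<^sub>R (x - e) \<bullet> h))) /
             (2 * (norm (x - e))\<^sup>2 * (2 * (norm (x - e))\<^sup>2))
         = ((1 / (2 * (norm (x - e))\<^sup>2)) *\<^sub>R axis i 1 - ((x - e) $ i / (norm (x - e))^4) *\<^sub>R (x - e)) \<bullet> h"
        by (simp only: inner_diff_left inner_scaleR_left)
    qed
  qed (use q in simp)
  have eq: "(\<lambda>x. hardy_field x $ i) = (\<lambda>x. x $ i / (1 - (norm x)\<^sup>2) + (x - e) $ i / (2 * (norm (x - e))\<^sup>2))"
    by (simp add: hardy_field_def fun_eq_iff)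
  show ?thesis unfolding eq
    by (rule has_derivative_eq_rhs[OF has_derivative_add[OF A B]])
       (simp add: hardy_field_grad_def inner_add_left inner_diff_left fun_eq_iff)
qed

lemma continuous_on_hardy_field_grad: "continuous_on disc (hardy_field_grad i)"
proof -
  have "1 - (norm x)\<^sup>2 \<noteq> 0" "norm (x - e) \<noteq> 0" if "x \<in> disc" for x
    using disc_gap[OF that] pole_dist_pos[OF that] by auto
  thus ?thesis unfolding hardy_field_grad_def[abs_def]
    by (intro continuous_intros ballI) auto
qed

lemma continuous_on_hardy_field: "continuous_on disc hardy_field"
proof -
  have "1 - (norm x)\<^sup>2 \<noteq> 0" "norm (x - e) \<noteq> 0" if "x \<in> disc" for x
    using disc_gap[OF that] pole_dist_pos[OF that] by auto
  thus ?thesis unfolding hardy_field_def[abs_def]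
    by (intro continuous_intros ballI) auto
qed

text \<open>The left-hand side is \<open>- \<Delta> \<phi> / \<phi>\<close>. Since ln is harmonic in
  the plane, the pole contributes nothing to the divergence. The cross term is evaluated by
  \<open>2 * (x \<bullet> (x - e)) = q - s\<close>; it yields \<open>1 / (2 * q)\<close>, of which
  the square of the pole field takes back one half.\<close>

lemma hardy_weight_identity:
  assumes x: "x \<in> disc"
  shows "(\<Sum>i\<in>UNIV. hardy_field_grad i x $ i) - (norm (hardy_field x))\<^sup>2
    = 1 / (1 - (norm x)\<^sup>2)\<^sup>2 + (1 / (2 * (1 - (norm x)\<^sup>2)) + 1 / (4 * (norm (x - e))\<^sup>2))"
proof -
  define s where "s = 1 - (norm x)\<^sup>2"
  define q where "q = (norm (x - e))\<^sup>2"
  have s: "s > 0" and q: "q > 0" using disc_gap[OF x] pole_dist_pos[OF x] by (auto simp: s_def q_def)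
  have q4: "(norm (x - e))^4 = q\<^sup>2" by (simp add: q_def flip: power_mult)
  have xx: "x \<bullet> x = 1 - s" by (simp add: s_def power2_norm_eq_inner)
  have ee: "e \<bullet> e = 1" using e by (simp add: norm_eq_sqrt_inner)
  have qq: "(x - e) \<bullet> (x - e) = q" by (simp add: q_def power2_norm_eq_inner)
  hence xe: "x \<bullet> (x - e) = (q - s) / 2" using xx ee by (simp add: inner_diff_left inner_diff_right inner_commute)
  have "(\<Sum>i\<in>UNIV. hardy_field_grad i x $ i) = 2 / s + 2 * (x \<bullet> x) / s\<^sup>2 + 1 / q - ((x - e) \<bullet> (x - e)) / q\<^sup>2"
    unfolding hardy_field_grad_def q4 s_def[symmetric] q_def[symmetric]
    by (simp add: sum.distrib sum_subtractf inner_vec_def sum_divide_distrib sum_distrib_left mult_ac)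
  also have "\<dots> = 2 / s + 2 * (1 - s) / s\<^sup>2" unfolding xx qq using q by (simp add: power2_eq_square)
  finally have 1: "(\<Sum>i\<in>UNIV. hardy_field_grad i x $ i) = 2 / s + 2 * (1 - s) / s\<^sup>2" .
  have hf: "hardy_field x = (1 / s) *\<^sub>R x + (1 / (2 * q)) *\<^sub>R (x - e)"
    by (simp only: hardy_field_def s_def q_def)
  have "(norm (hardy_field x))\<^sup>2 = (x \<bullet> x) / s\<^sup>2 + (x \<bullet> (x - e)) / (s * q) + ((x - e) \<bullet> (x - e)) / (4 * q\<^sup>2)"
    unfolding hf power2_norm_eq_inner inner_add_left inner_add_right
      inner_scaleR_left inner_scaleR_right inner_commute[of "x - e" x]
    by (simp add: power2_eq_square add_divide_distrib mult_ac)
  also have "\<dots> = (1 - s) / s\<^sup>2 + (q - s) / (2 * s * q) + 1 / (4 * q)" unfolding xx qq xe using q by (simp add: power2_eq_square)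
  finally have 2: "(norm (hardy_field x))\<^sup>2 = (1 - s) / s\<^sup>2 + (q - s) / (2 * s * q) + 1 / (4 * q)" .
  show ?thesis unfolding 1 2 s_def[symmetric] q_def[symmetric] using s q
    by (simp add: field_simps power2_eq_square)
qed

text \<open>Expand the nonnegative integral of
  \<open>(norm (G x + f x *\<^sub>R hardy_field x))\<^sup>2\<close>. The divergence theorem for
  \<open>f^2\<close> times the field turns the cross term into minus the integral of
  \<open>f^2\<close> times the divergence, and the weight identity evaluates what is left.\<close>

lemma improved_hardy:
  assumes f: "C1c f G"
  shows "dirichlet G \<ge> hardy f + (LINT x|lborel. (f x)\<^sup>2 * (1 / (2 * (1 - (norm x)\<^sup>2)) + 1 / (4 * (norm (x - e))\<^sup>2)))"
proof -
  define w where "w x = 1 / (2 * (1 - (norm x)\<^sup>2)) + 1 / (4 * (norm (x - e))\<^sup>2)" for x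
  have nz: "1 - (norm x)\<^sup>2 \<noteq> 0" "norm (x - e) \<noteq> 0" if "x \<in> disc" for x
    using disc_gap[OF that] pole_dist_pos[OF that] by auto
  have wc: "continuous_on disc w" unfolding w_def[abs_def] using nz
    by (intro continuous_intros ballI) auto
  have f2: "C1c (\<lambda>x. f x * f x) (\<lambda>x. f x *\<^sub>R G x + f x *\<^sub>R G x)" by (rule C1c_mult[OF f f])
  have f2c: "Cc (\<lambda>x. (f x)\<^sup>2)" by (intro Cc_power2 C1c_Cc[OF f])
  let ?d = "\<lambda>x. \<Sum>i\<in>UNIV. hardy_field_grad i x $ i"
  have dc: "continuous_on disc ?d" by (intro continuous_intros continuous_on_hardy_field_grad)
  have nc: "continuous_on disc (\<lambda>x. (norm (hardy_field x))\<^sup>2)" by (intro continuous_intros continuous_on_hardy_field)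
  define c where "c x = 2 * (f x * (G x \<bullet> hardy_field x))" for x
  have cc: "Cc c"
  proof -
    have 1: "Cc (\<lambda>x. \<Sum>i\<in>UNIV. (f x * (G x $ i)) * hardy_field x $ i)"
    proof (rule Cc_sum, rule Cc_mult_disc)
      show "Cc (\<lambda>x. f x * G x $ i)" for i by (rule Cc_mult[OF C1c_Cc[OF f] C1c_Cc_component[OF f]])
      show "continuous_on disc (\<lambda>x. hardy_field x $ i)" for i
        by (intro continuous_intros continuous_on_hardy_field)
    qed
    have 2: "c = (\<lambda>x. 2 * (\<Sum>i\<in>UNIV. (f x * (G x $ i)) * hardy_field x $ i))"
      by (auto simp: c_def inner_vec_def sum_distrib_left mult_ac)
    show ?thesis unfolding 2 by (rule Cc_cmult[OF 1])
  qed
  have div0: "(LINT x|lborel. c x + (f x)\<^sup>2 * ?d x) = 0"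
  proof -
    let ?H = "\<lambda>i x. hardy_field x $ i *\<^sub>R (f x *\<^sub>R G x + f x *\<^sub>R G x) + (f x * f x) *\<^sub>R hardy_field_grad i x"
    have C: "C1c (\<lambda>x. f x * f x * hardy_field x $ i) (?H i)" for i
      by (rule C1c_mult_disc[OF f2 hardy_field_derivative continuous_on_hardy_field_grad])
    have "(LINT x|lborel. (\<Sum>i\<in>UNIV. ?H i x \<bullet> axis i 1)) = (\<Sum>i\<in>UNIV. LINT x|lborel. ?H i x \<bullet> axis i 1)"
      by (rule Bochner_Integration.integral_sum) (rule Cc_integrable[OF C1c_Cc_grad[OF C]])
    also have "\<dots> = 0" using C1c_integral_grad[OF C] by (intro sum.neutral) auto
    also have "(\<lambda>x. \<Sum>i\<in>UNIV. ?H i x \<bullet> axis i 1) = (\<lambda>x. c x + (f x)\<^sup>2 * ?d x)"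
    proof
      fix x
      have "?H i x \<bullet> axis i 1 = 2 * f x * (G x $ i * hardy_field x $ i) + (f x)\<^sup>2 * hardy_field_grad i x $ i" for i
        by (simp add: inner_axis power2_eq_square algebra_simps)
      thus "(\<Sum>i\<in>UNIV. ?H i x \<bullet> axis i 1) = c x + (f x)\<^sup>2 * ?d x"
        by (simp add: c_def inner_vec_def sum.distrib sum_distrib_left mult_ac)
    qed
    finally show ?thesis .
  qed
  have i1: "integrable lborel (\<lambda>x. (norm (G x))\<^sup>2)" by (intro Cc_integrable C1c_Cc_norm[OF f])
  have i2: "integrable lborel (\<lambda>x. (f x)\<^sup>2 * (norm (hardy_field x))\<^sup>2)" by (intro Cc_integrable Cc_mult_disc f2c nc)
  have i3: "integrable lborel (\<lambda>x. (f x)\<^sup>2 * ?d x)" by (intro Cc_integrable Cc_mult_disc f2c dc)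
  have i4: "integrable lborel c" by (intro Cc_integrable cc)
  have i5: "integrable lborel (\<lambda>x. (f x)\<^sup>2 / (1 - (norm x)\<^sup>2)\<^sup>2)" by (intro Cc_integrable Cc_hardy f2c)
  have i6: "integrable lborel (\<lambda>x. (f x)\<^sup>2 * w x)" by (intro Cc_integrable Cc_mult_disc f2c wc)
  have "0 \<le> (LINT x|lborel. (norm (G x + f x *\<^sub>R hardy_field x))\<^sup>2)" by simp
  also have "(\<lambda>x. (norm (G x + f x *\<^sub>R hardy_field x))\<^sup>2) = 
     (\<lambda>x. (norm (G x))\<^sup>2 + c x + (f x)\<^sup>2 * (norm (hardy_field x))\<^sup>2)"
    unfolding power2_norm_eq_inner c_def
    by (auto simp: inner_add_left inner_add_right inner_commute power2_eq_square algebra_simps)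
  also have "(LINT x|lborel. (norm (G x))\<^sup>2 + c x + (f x)\<^sup>2 * (norm (hardy_field x))\<^sup>2)
     = dirichlet G + (LINT x|lborel. c x) + (LINT x|lborel. (f x)\<^sup>2 * (norm (hardy_field x))\<^sup>2)"
    using i1 i2 i4 by (simp add: dirichlet_def)
  also have "(LINT x|lborel. c x) = - (LINT x|lborel. (f x)\<^sup>2 * ?d x)" using div0 i3 i4 by simp
  finally have "dirichlet G \<ge> (LINT x|lborel. (f x)\<^sup>2 * ?d x) - (LINT x|lborel. (f x)\<^sup>2 * (norm (hardy_field x))\<^sup>2)" by simp
  also have "(LINT x|lborel. (f x)\<^sup>2 * ?d x) - (LINT x|lborel. (f x)\<^sup>2 * (norm (hardy_field x))\<^sup>2)
    = (LINT x|lborel. (f x)\<^sup>2 * ?d x - (f x)\<^sup>2 * (norm (hardy_field x))\<^sup>2)" using i2 i3 by simp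
  also have "\<dots> = (LINT x|lborel. (f x)\<^sup>2 / (1 - (norm x)\<^sup>2)\<^sup>2 + (f x)\<^sup>2 * w x)"
  proof (intro Bochner_Integration.integral_cong refl)
    fix x
    obtain r where r: "r < 1" "\<And>x. r \<le> norm x \<Longrightarrow> f x = 0" using C1c_Cc[OF f] unfolding Cc_def by blast
    show "(f x)\<^sup>2 * ?d x - (f x)\<^sup>2 * (norm (hardy_field x))\<^sup>2 = (f x)\<^sup>2 / (1 - (norm x)\<^sup>2)\<^sup>2 + (f x)\<^sup>2 * w x"
    proof (cases "x \<in> disc")
      case True
      have "(f x)\<^sup>2 * ?d x - (f x)\<^sup>2 * (norm (hardy_field x))\<^sup>2 = (f x)\<^sup>2 * (?d x - (norm (hardy_field x))\<^sup>2)"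
        by (simp add: algebra_simps)
      thus ?thesis unfolding hardy_weight_identity[OF True] w_def by (simp add: algebra_simps)
    next
      case False
      hence "f x = 0" using r by auto
      then show ?thesis by simp
    qed
  qed
  also have "\<dots> = hardy f + (LINT x|lborel. (f x)\<^sup>2 * w x)" using i5 i6 by (simp add: hardy_def)
  finally show ?thesis unfolding w_def .
qed

end

lemma hardy_le_dirichlet:
  assumes f: "C1c f G"
  shows "hardy f \<le> dirichlet G"
proof -
  have "hardy f + (LINT x|lborel. (f x)\<^sup>2 * (1 / (2 * (1 - (norm x)\<^sup>2)) + 1 / (4 * (norm (x - axis 1 1))\<^sup>2))) \<le> dirichlet G"
    using improved_hardy[OF _ f, of "axis 1 1"] by (simp add: norm_axis_1)
  moreover have "(f x)\<^sup>2 * (1 / (2 * (1 - (norm x)\<^sup>2)) + 1 / (4 * (norm (x - axis 1 1))\<^sup>2)) \<ge> 0" for x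
  proof (cases "x \<in> disc")
    case True
    then show ?thesis using disc_gap[OF True] by simp
  next
    case False
    moreover obtain r where "r < 1" "\<And>x. r \<le> norm x \<Longrightarrow> f x = 0" using C1c_Cc[OF f] unfolding Cc_def by blast
    ultimately have "f x = 0" by auto
    then show ?thesis by simp
  qed
  hence "(LINT x|lborel. (f x)\<^sup>2 * (1 / (2 * (1 - (norm x)\<^sup>2)) + 1 / (4 * (norm (x - axis 1 1))\<^sup>2))) \<ge> 0"
    by (intro Bochner_Integration.integral_nonneg) auto
  ultimately show ?thesis by linarith
qed

lemma integrable_indicator_mult:
  fixes f :: "plane \<Rightarrow> real"
  assumes "integrable lborel f" "S \<in> sets borel"
  shows "integrable lborel (\<lambda>x. indicator S x * f x)"
  using integrable_mult_indicator[of S lborel f] assms by simp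

text \<open>Choose the pole \<open>e\<close> as the boundary point nearest to \<open>y\<close>. It
  is at distance \<open>4 * R\<close>, so on the ball the distance is at most \<open>5 * R\<close>
  and the remainder weight is at least \<open>1 / (100 * R^2)\<close>. The constant thus does not
  deteriorate as \<open>y\<close> approaches the circle.\<close>

lemma integral_ball_le:
  assumes f: "C1c f G" and y: "norm y < 1" and R: "R = (1 - norm y) / 4"
  shows "(LINT x|lborel. indicator (ball y R) x * (f x)\<^sup>2) \<le> 100 * R\<^sup>2 * (dirichlet G - hardy f)"
proof -
  define e :: plane where "e = (if y = 0 then axis 1 1 else y /\<^sub>R norm y)"
  have e: "norm e = 1" by (simp add: e_def norm_axis_1)
  have R0: "R > 0" using y R by simp
  have ye: "norm (y - e) = 4 * R"
  proof (cases "y = 0")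
    case False
    have "y - e = (norm y - 1) *\<^sub>R (y /\<^sub>R norm y)" using False by (simp add: e_def scaleR_diff_left algebra_simps)
    hence "norm (y - e) = \<bar>norm y - 1\<bar> * norm (y /\<^sub>R norm y)" by (simp only: norm_scaleR)
    thus ?thesis using False y R by simp
  qed (simp add: e_def norm_axis_1 R)
  let ?w = "\<lambda>x. 1 / (2 * (1 - (norm x)\<^sup>2)) + 1 / (4 * (norm (x - e))\<^sup>2)"
  obtain r where r: "r < 1" "\<And>x. r \<le> norm x \<Longrightarrow> f x = 0" using C1c_Cc[OF f] unfolding Cc_def by blast
  have wc: "continuous_on disc ?w"
  proof -
    have "1 - (norm x)\<^sup>2 \<noteq> 0" "norm (x - e) \<noteq> 0" if "x \<in> disc" for x
      using disc_gap[OF that] that e by auto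
    thus ?thesis by (intro continuous_intros ballI) auto
  qed
  have "(LINT x|lborel. indicator (ball y R) x * (f x)\<^sup>2) \<le> (LINT x|lborel. 100 * R\<^sup>2 * ((f x)\<^sup>2 * ?w x))"
  proof (rule integral_mono)
    show "integrable lborel (\<lambda>x. indicator (ball y R) x * (f x)\<^sup>2)"
      by (intro integrable_indicator_mult Cc_integrable Cc_power2 C1c_Cc[OF f]) auto
    show "integrable lborel (\<lambda>x. 100 * R\<^sup>2 * ((f x)\<^sup>2 * ?w x))"
      by (intro Cc_integrable Cc_cmult Cc_mult_disc[OF _ wc] Cc_power2 C1c_Cc[OF f])
    fix x
    show "indicator (ball y R) x * (f x)\<^sup>2 \<le> 100 * R\<^sup>2 * ((f x)\<^sup>2 * ?w x)"
    proof (cases "x \<in> disc")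
      case False
      hence "f x = 0" using r by auto
      then show ?thesis by simp
    next
      case x: True
      have q0: "norm (x - e) > 0" using x e by auto
      have s0: "1 - (norm x)\<^sup>2 > 0" using disc_gap[OF x] .
      show ?thesis
      proof (cases "x \<in> ball y R")
        case True
        have "norm (x - e) \<le> norm (x - y) + norm (y - e)" by (metis diff_add_cancel add_diff_eq norm_triangle_ineq)
        also have "\<dots> \<le> 5 * R" using True ye by (simp add: dist_norm norm_minus_commute)
        finally have "(norm (x - e))\<^sup>2 \<le> (5 * R)\<^sup>2" by (intro power_mono) auto
        hence "100 * R\<^sup>2 * (1 / (4 * (norm (x - e))\<^sup>2)) \<ge> 1" using q0 by (simp add: field_simps)
        moreover have "100 * R\<^sup>2 * (1 / (2 * (1 - (norm x)\<^sup>2))) \<ge> 0" using s0 by simp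
        ultimately have "100 * R\<^sup>2 * ?w x \<ge> 1" by (simp only: distrib_left)
        hence "1 * (f x)\<^sup>2 \<le> 100 * R\<^sup>2 * ?w x * (f x)\<^sup>2" by (intro mult_right_mono) auto
        thus ?thesis using True by (simp add: mult_ac)
      next
        case False
        then show ?thesis using s0 by simp
      qed
    qed
  qed
  also have "\<dots> = 100 * R\<^sup>2 * (LINT x|lborel. (f x)\<^sup>2 * ?w x)" by simp
  also have "\<dots> \<le> 100 * R\<^sup>2 * (dirichlet G - hardy f)"
    using improved_hardy[OF e f] by (intro mult_left_mono) auto
  finally show ?thesis .
qed

section \<open>Truncated logarithmic potentials\<close>

lemma lborel_ball_plane: "r \<ge> 0 \<Longrightarrow> (LINT x|lborel. indicator (ball y r) x) = pi * r\<^sup>2" for y :: plane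
  using content_ball[of r y] by (simp add: unit_ball_vol_2)

text \<open>\<open>s\<close> stands for the squared distance in units of the radius. The linear
  piece is the tangent of \<open>ln s / 2\<close> at 1, which makes the truncation C^1.\<close>

definition log_profile :: "real \<Rightarrow> real" where
  "log_profile s = (if s \<le> 1 then (s - 1) / 2 else ln s / 2)"

lemma log_profile_derivative: "(log_profile has_real_derivative 1 / (2 * max 1 s)) (at s)"
proof -
  consider "s < 1" | "s > 1" | "s = 1" by linarith
  thus ?thesis
  proof cases
    case 1
    have "((\<lambda>s. (s - 1) / 2) has_real_derivative 1/2) (at s)" by (auto intro!: derivative_eq_intros)
    hence "(log_profile has_real_derivative 1/2) (at s)"
      by (rule has_field_derivative_transform_within_open[where S = "{..<1}"]) (use 1 in \<open>auto simp: log_profile_def\<close>)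
    thus ?thesis using 1 by simp
  next
    case 2
    have "((\<lambda>s. ln s / 2) has_real_derivative 1 / (2 * s)) (at s)" using 2 by (auto intro!: derivative_eq_intros simp: field_simps)
    hence "(log_profile has_real_derivative 1 / (2 * s)) (at s)"
      by (rule has_field_derivative_transform_within_open[where S = "{1<..}"]) (use 2 in \<open>auto simp: log_profile_def\<close>)
    thus ?thesis using 2 by simp
  next
    case 3
    have "((\<lambda>s. (s - 1) / 2) has_real_derivative 1/2) (at 1 within {..1})" by (auto intro!: derivative_eq_intros)
    hence L: "(log_profile has_real_derivative 1/2) (at 1 within {..1})"
      by (rule has_field_derivative_transform_within[where d = 1]) (auto simp: log_profile_def)
    have "((\<lambda>s. ln s / 2) has_real_derivative 1/2) (at 1 within {1..})" by (auto intro!: derivative_eq_intros)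
    hence R: "(log_profile has_real_derivative 1/2) (at 1 within {1..})"
      by (rule has_field_derivative_transform_within[where d = 1]) (auto simp: log_profile_def)
    have "{..1} \<union> {1..} = (UNIV :: real set)" by auto
    moreover have "(log_profile has_real_derivative 1/2) (at 1 within {..1} \<union> {1..})"
      using L R unfolding has_field_derivative_iff by (simp add: Lim_within_Un)
    ultimately show ?thesis using 3 by simp
  qed
qed

text \<open>The logarithmic potential of the uniform distribution on the disc of radius \<open>a\<close>.\<close>
definition logpot :: "real \<Rightarrow> plane \<Rightarrow> real" where
  "logpot a x = ln a + log_profile ((norm x)\<^sup>2 / a\<^sup>2)"

definition logpot_grad :: "real \<Rightarrow> plane \<Rightarrow> plane" where
  "logpot_grad a x = (1 / max (a\<^sup>2) ((norm x)\<^sup>2)) *\<^sub>R x"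

lemma logpot_derivative:
  assumes a: "a > 0"
  shows "(logpot a has_derivative (\<lambda>h. logpot_grad a x \<bullet> h)) (at x)"
proof -
  have d: "((\<lambda>x. (norm x)\<^sup>2 / a\<^sup>2) has_derivative (\<lambda>h. ((2 *\<^sub>R x) \<bullet> h) / a\<^sup>2)) (at x)"
    by (rule bounded_linear.has_derivative[OF bounded_linear_divide has_derivative_norm_sq])
  have m: "max 1 ((norm x)\<^sup>2 / a\<^sup>2) * a\<^sup>2 = max (a\<^sup>2) ((norm x)\<^sup>2)"
    using a by (auto simp: max_def field_simps)
  have "((\<lambda>x. log_profile ((norm x)\<^sup>2 / a\<^sup>2)) has_derivative (\<lambda>h. (1 / (2 * max 1 ((norm x)\<^sup>2 / a\<^sup>2))) * (((2 *\<^sub>R x) \<bullet> h) / a\<^sup>2))) (at x)"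
    using has_derivative_compose[OF d log_profile_derivative[THEN has_field_derivative_imp_has_derivative]] .
  moreover have "(\<lambda>h. (1 / (2 * max 1 ((norm x)\<^sup>2 / a\<^sup>2))) * (((2 *\<^sub>R x) \<bullet> h) / a\<^sup>2)) = (\<lambda>h. logpot_grad a x \<bullet> h)"
    unfolding logpot_grad_def m[symmetric] by (auto simp: fun_eq_iff)
  ultimately show ?thesis unfolding logpot_def[abs_def]
    by (auto intro!: derivative_eq_intros)
qed

lemma max_sq_pos: "a > 0 \<Longrightarrow> max (a\<^sup>2) b > (0::real)"
  by (simp add: less_max_iff_disj)

lemma continuous_on_logpot_grad: "a > 0 \<Longrightarrow> continuous_on UNIV (logpot_grad a)"
  unfolding logpot_grad_def[abs_def]
  by (intro continuous_intros) (metis max_sq_pos less_irrefl)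

lemma norm_logpot_grad: "a > 0 \<Longrightarrow> norm (logpot_grad a x) \<le> 1 / a"
proof -
  assume a: "a > 0"
  have "norm x * a \<le> max (a\<^sup>2) ((norm x)\<^sup>2)"
  proof (cases "norm x \<le> a")
    case True
    have "norm x * a \<le> a * a" using True a by (intro mult_right_mono) auto
    then show ?thesis by (simp add: power2_eq_square)
  next
    case False
    have "norm x * a \<le> norm x * norm x" using False a by (intro mult_left_mono) auto
    then show ?thesis by (simp add: power2_eq_square)
  qed
  thus ?thesis using a max_sq_pos[OF a, of "(norm x)\<^sup>2"] unfolding logpot_grad_def by (simp add: field_simps)
qed

text \<open>Multiplied by \<open>a^2\<close>, the field is the identity on the disc of radius
  \<open>a\<close> and inversion in its circle outside, hence nonexpansive on each piece. It remains
  to compare a point inside with a point outside.\<close>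

lemma logpot_grad_lipschitz:
  assumes a: "a > 0"
  shows "norm (logpot_grad a x - logpot_grad a y) \<le> norm (x - y) / a\<^sup>2"
proof -
  have sq: "norm u \<le> norm v" if "u \<bullet> u \<le> v \<bullet> v" for u v :: plane
    using that by (simp add: norm_eq_sqrt_inner)
  have inside: "logpot_grad a z = (1 / a\<^sup>2) *\<^sub>R z" if "norm z \<le> a" for z
    using that a unfolding logpot_grad_def by (simp add: max_def power_mono)
  have outside: "logpot_grad a z = (1 / (norm z)\<^sup>2) *\<^sub>R z" if "norm z \<ge> a" for z
    using that a unfolding logpot_grad_def by (simp add: max_def power_mono antisym)
  have mixed: "norm (logpot_grad a x - logpot_grad a y) \<le> norm (x - y) / a\<^sup>2" if xy: "norm x \<le> a" "norm y \<ge> a" for x y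
  proof -
    define t where "t = (norm y)\<^sup>2 / a\<^sup>2"
    have t: "t \<ge> 1" using xy a by (simp add: t_def field_simps power_mono)
    have ny: "(norm y)\<^sup>2 = t * a\<^sup>2" using a by (simp add: t_def)
    have "x \<bullet> y \<le> norm x * norm y" by (rule norm_cauchy_schwarz)
    also have "\<dots> \<le> a * norm y" using xy by (intro mult_right_mono) auto
    also have "2 * (a * norm y) \<le> a\<^sup>2 + (norm y)\<^sup>2" using sum_squares_bound[of a "norm y"] by simp
    finally have xy2: "2 * (x \<bullet> y) \<le> (1 + t) * a\<^sup>2" using ny by (simp add: algebra_simps)
    \<comment> \<open>The image of an outer point \<open>y\<close> under inversion is
      \<open>y / t\<close>; replacing \<open>y\<close> by it does not increase the distance to a
      point of the disc.\<close>
    have "(x - (1/t) *\<^sub>R y) \<bullet> (x - (1/t) *\<^sub>R y) \<le> (x - y) \<bullet> (x - y)"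
    proof -
      have "(x - y) \<bullet> (x - y) - (x - (1/t) *\<^sub>R y) \<bullet> (x - (1/t) *\<^sub>R y) = (y \<bullet> y) * (1 - 1/t^2) - 2 * (x \<bullet> y) * (1 - 1/t)"
        by (simp add: inner_diff_left inner_diff_right inner_commute power2_eq_square algebra_simps)
      moreover have "(y \<bullet> y) * (1 - 1/t^2) = (1 + t) * a\<^sup>2 * (1 - 1/t)"
        using ny t by (simp add: power2_norm_eq_inner[symmetric] field_simps power2_eq_square)
      moreover have "2 * (x \<bullet> y) * (1 - 1/t) \<le> (1 + t) * a\<^sup>2 * (1 - 1/t)" using xy2 t by (intro mult_right_mono) auto
      ultimately show ?thesis by simp
    qed
    hence le: "norm (x - (1/t) *\<^sub>R y) \<le> norm (x - y)" by (rule sq)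
    have "logpot_grad a x - logpot_grad a y = (1 / a\<^sup>2) *\<^sub>R (x - (1/t) *\<^sub>R y)"
      using inside[OF xy(1)] outside[OF xy(2)] a t by (simp add: ny scaleR_diff_right mult.commute)
    thus ?thesis using le by (simp add: divide_right_mono)
  qed
  consider "norm x \<le> a" "norm y \<le> a" | "norm x \<le> a" "norm y \<ge> a" | "norm x \<ge> a" "norm y \<le> a" | "norm x \<ge> a" "norm y \<ge> a"
    by linarith
  thus ?thesis
  proof cases
    case 1
    then show ?thesis by (simp add: inside flip: scaleR_diff_right)
  next
    case 2
    then show ?thesis by (rule mixed)
  next
    case 3
    then show ?thesis using mixed[of y x] by (simp add: norm_minus_commute)
  next
    case 4
    hence x0: "norm x > 0" "norm y > 0" using a by auto
    define p where "p = (norm x)\<^sup>2" define q where "q = (norm y)\<^sup>2"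
    have p0: "p > 0" "q > 0" using x0 by (auto simp: p_def q_def)
    have "((1/p) *\<^sub>R x - (1/q) *\<^sub>R y) \<bullet> ((1/p) *\<^sub>R x - (1/q) *\<^sub>R y) = (x - y) \<bullet> (x - y) / (p * q)"
    proof -
      have "x \<bullet> x = p" "y \<bullet> y = q" by (auto simp: p_def q_def power2_norm_eq_inner)
      thus ?thesis using p0 by (simp add: inner_diff_left inner_diff_right inner_commute field_simps)
    qed
    also have "\<dots> \<le> (x - y) \<bullet> (x - y) / (a\<^sup>2 * a\<^sup>2)"
      using 4 a p0 by (intro divide_left_mono mult_mono) (auto simp: p_def q_def power_mono)
    also have "\<dots> = ((1/a\<^sup>2) *\<^sub>R (x - y)) \<bullet> ((1/a\<^sup>2) *\<^sub>R (x - y))" by simp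
    finally have "norm ((1/p) *\<^sub>R x - (1/q) *\<^sub>R y) \<le> norm ((1/a\<^sup>2) *\<^sub>R (x - y))" by (rule sq)
    thus ?thesis using outside[OF 4(1)] outside[OF 4(2)] by (simp add: p_def q_def)
  qed
qed

lemma null_sphere: "sphere (y::plane) a \<in> null_sets lborel"
proof -
  have "sphere y a \<in> null_sets lebesgue" using negligible_sphere negligible_iff_null_sets by blast
  moreover have "sphere y a \<in> sets lborel" by simp
  ultimately show ?thesis by (simp add: null_sets_completion_iff)
qed

lemma Cc_bounded:
  assumes "Cc f" obtains F where "F \<ge> 0" "\<And>x. \<bar>f x\<bar> \<le> F"
proof -
  obtain r where r: "r < 1" "\<And>x. r \<le> norm x \<Longrightarrow> f x = 0" using assms unfolding Cc_def by blast
  have "bounded (f ` cball 0 1)"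
    using assms unfolding Cc_def
    by (intro compact_imp_bounded compact_continuous_image) (auto intro: continuous_on_subset)
  then obtain M where M: "\<And>x. x \<in> cball 0 1 \<Longrightarrow> \<bar>f x\<bar> \<le> M"
    unfolding bounded_iff real_norm_def by blast
  have "\<bar>f x\<bar> \<le> max M 0" for x
  proof (cases "norm x \<le> 1")
    case True
    hence "\<bar>f x\<bar> \<le> M" by (intro M) simp
    then show ?thesis by simp
  next
    case False
    then show ?thesis using r(1) r(2)[of x] by simp
  qed
  thus ?thesis using that[of "max M 0"] by auto
qed

text \<open>The Laplacian of \<^term>\<open>logpot a\<close> is \<open>2 / a\<^sup>2\<close> inside the ball of radius \<open>a\<close> and vanishes outside.\<close>
lemma integral_grad_logpot:
  assumes f: "C1c f G" and a: "a > 0"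
  shows "(LINT x|lborel. G x \<bullet> logpot_grad a (x - y)) = - (2 / a\<^sup>2) * (LINT x|lborel. indicator (ball y a) x * f x)"
proof -
  obtain M where M: "M \<ge> 0" "\<And>x. norm (G x) \<le> M" using C1c_bounded_grad[OF f] by metis
  obtain F where F: "F \<ge> 0" "\<And>x. \<bar>f x\<bar> \<le> F" using Cc_bounded[OF C1c_Cc[OF f]] by metis
  obtain r where r: "\<And>x. r \<le> norm x \<Longrightarrow> f x = 0" using f unfolding C1c_def by blast
  define k where "k x = logpot_grad a (x - y)" for x
  have kc: "continuous_on UNIV k" unfolding k_def[abs_def]
    by (intro continuous_on_compose2[OF continuous_on_logpot_grad[OF a]] continuous_intros) auto
  have kb: "\<bar>k x $ i\<bar> \<le> 1 / a" for x i
    using norm_logpot_grad[OF a, of "x - y"] component_le_norm_cart[of "k x" i] unfolding k_def by linarith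
  have kl: "\<bar>k x $ i - k z $ i\<bar> \<le> norm (x - z) / a\<^sup>2" for x z i
    using logpot_grad_lipschitz[OF a, of "x - y" "z - y"] component_le_norm_cart[of "k x - k z" i] unfolding k_def by simp
  \<comment> \<open>The derivative of the i-th component in direction i. Outside the disc the two
    values sum to 0, which is harmonicity of the logarithm; inside they sum to
    \<open>2 / a^2\<close>.\<close>
  define dk where "dk i z = (if norm z < a then 1 / a\<^sup>2 else 1 / (norm z)\<^sup>2 - 2 * (z $ i)\<^sup>2 / (norm z)^4)" for i and z :: plane
  define h where "h i x = G x $ i * k x $ i + f x * dk i (x - y)" for i x
  have fm: "f \<in> borel_measurable borel" by (intro Cc_measurable C1c_Cc[OF f])
  have Gi: "Cc (\<lambda>x. G x $ i)" for i by (rule C1c_Cc_component[OF f])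
  have km: "(\<lambda>x. k x $ i) \<in> borel_measurable borel" for i
    using kc by (intro borel_measurable_continuous_onI continuous_intros)
  have hm: "h i \<in> borel_measurable borel" for i
  proof -
    have "(\<lambda>x. norm (x - y)) \<in> borel_measurable borel" "(\<lambda>x. (x - y) $ i) \<in> borel_measurable borel"
      by (intro borel_measurable_continuous_onI continuous_intros)+
    thus ?thesis unfolding h_def dk_def using fm km Cc_measurable[OF Gi] by measurable
  qed
  have main: "integrable lborel (h i)" "(LINT x|lborel. h i x) = 0" for i
  proof -
    let ?g = "\<lambda>x. f x * k x $ i"
    have lip: "\<bar>?g x - ?g z\<bar> \<le> (F / a\<^sup>2 + M / a) * norm (x - z)" for x z
    proof -
      have "?g x - ?g z = f x * (k x $ i - k z $ i) + (f x - f z) * k z $ i" by (simp add: algebra_simps)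
      hence "\<bar>?g x - ?g z\<bar> \<le> \<bar>f x\<bar> * \<bar>k x $ i - k z $ i\<bar> + \<bar>f x - f z\<bar> * \<bar>k z $ i\<bar>"
        by (metis abs_mult abs_triangle_ineq)
      also have "\<dots> \<le> F * (norm (x - z) / a\<^sup>2) + (M * norm (x - z)) * (1 / a)"
        using F M(1) kl kb C1c_lipschitz[OF f M(2)] by (intro add_mono mult_mono) auto
      finally show ?thesis by (simp add: algebra_simps)
    qed
    \<comment> \<open>The full derivative is written as its diagonal part \<open>dk\<close> plus a
      remainder that vanishes at \<open>v = axis i 1\<close>, the only direction in which it is
      evaluated later.\<close>
    have der: "(?g has_derivative (\<lambda>v. f x * (dk i (x - y) * v $ i + (if norm (x - y) < a then 0 else 
         2 * ((x - y) $ i)\<^sup>2 / (norm (x - y))^4 * v $ i - 2 * (x - y) $ i * ((x - y) \<bullet> v) / (norm (x - y))^4)) + (G x \<bullet> v) * k x $ i)) (at x)"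
      if x: "x \<notin> sphere y a" for x
    proof (cases "norm (x - y) < a")
      case True
      have "((\<lambda>x. (x - y) $ i / a\<^sup>2) has_derivative (\<lambda>v. v $ i / a\<^sup>2)) (at x)"
        by (rule bounded_linear.has_derivative[OF bounded_linear_divide])
           (rule bounded_linear.has_derivative[OF bounded_linear_vec_nth], auto intro!: derivative_eq_intros)
      hence "((\<lambda>x. k x $ i) has_derivative (\<lambda>v. v $ i / a\<^sup>2)) (at x)"
      proof (rule has_derivative_transform_within_open[where s = "ball y a"])
        show "(z - y) $ i / a\<^sup>2 = k z $ i" if "z \<in> ball y a" for z
          using that a unfolding k_def logpot_grad_def
          by (simp add: max_def dist_norm norm_minus_commute power_mono less_imp_le)
      qed (use True in \<open>auto simp: dist_norm norm_minus_commute\<close>)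
      from has_derivative_mult[OF C1c_der[OF f] this] show ?thesis
        using True by (simp add: dk_def algebra_simps)
    next
      case False
      hence out: "norm (x - y) > a" using x by (auto simp: dist_norm norm_minus_commute)
      have nz: "norm (x - y) \<noteq> 0" using out a by auto
      have d2: "((\<lambda>x. (norm (x - y))\<^sup>2) has_derivative (\<lambda>h. (2 *\<^sub>R (x - y)) \<bullet> h)) (at x)"
        by (rule has_derivative_compose[OF _ has_derivative_norm_sq, where f = "\<lambda>x. x - y", THEN has_derivative_eq_rhs])
           (auto intro!: derivative_eq_intros)
      have d3: "((\<lambda>x. (x - y) $ i) has_derivative (\<lambda>h. h $ i)) (at x)"
        by (rule bounded_linear.has_derivative[OF bounded_linear_vec_nth, THEN has_derivative_eq_rhs])
           (auto intro!: derivative_eq_intros)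
      have "((\<lambda>x. (x - y) $ i / (norm (x - y))\<^sup>2) has_derivative
           (\<lambda>v. (v $ i * (norm (x - y))\<^sup>2 - (x - y) $ i * ((2 *\<^sub>R (x - y)) \<bullet> v)) / ((norm (x - y))\<^sup>2 * (norm (x - y))\<^sup>2))) (at x)"
        using nz by (intro has_derivative_divide'[OF d3 d2]) simp
      hence "((\<lambda>x. k x $ i) has_derivative
           (\<lambda>v. (v $ i * (norm (x - y))\<^sup>2 - (x - y) $ i * ((2 *\<^sub>R (x - y)) \<bullet> v)) / ((norm (x - y))\<^sup>2 * (norm (x - y))\<^sup>2))) (at x)"
      proof (rule has_derivative_transform_within_open[where s = "- cball y a"])
        show "(z - y) $ i / (norm (z - y))\<^sup>2 = k z $ i" if "z \<in> - cball y a" for z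
          using that a unfolding k_def logpot_grad_def
          by (simp add: max_def dist_norm norm_minus_commute power_mono less_imp_le not_le antisym)
      qed (use out in \<open>auto simp: dist_norm norm_minus_commute\<close>)
      from has_derivative_mult[OF C1c_der[OF f] this] show ?thesis
      proof (rule has_derivative_eq_rhs, intro ext)
        fix v
        have alg: "f x * ((c * n\<^sup>2 - b * (2 * d)) / (n\<^sup>2 * n\<^sup>2)) + g = f x * ((1 / n\<^sup>2 - 2 * b\<^sup>2 / n^4) * c + (2 * b\<^sup>2 / n^4 * c - 2 * b * d / n^4)) + g"
          if "n \<noteq> 0" for b c d g n :: real
          using that by (simp add: field_simps power2_eq_square power4_eq_xxxx)
        from alg[OF nz, of "v $ i" "(x - y) $ i" "(x - y) \<bullet> v" "(G x \<bullet> v) * k x $ i"]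
        show "f x * ((v $ i * (norm (x - y))\<^sup>2 - (x - y) $ i * (2 *\<^sub>R (x - y) \<bullet> v)) / ((norm (x - y))\<^sup>2 * (norm (x - y))\<^sup>2)) + (G x \<bullet> v) * k x $ i
          = f x * (dk i (x - y) * v $ i + (if norm (x - y) < a then 0 else 
         2 * ((x - y) $ i)\<^sup>2 / (norm (x - y))^4 * v $ i - 2 * (x - y) $ i * ((x - y) \<bullet> v) / (norm (x - y))^4)) + (G x \<bullet> v) * k x $ i"
          using False unfolding dk_def by (simp only: inner_scaleR_left if_False)
      qed
    qed
    note zero = integral_directional_derivative_eq_0[where e = "axis i 1", OF lip _ null_sphere der hm]
    show "integrable lborel (h i)"
      by (rule zero(1)[of r]) (auto simp: r h_def inner_axis power2_eq_square)
    show "(LINT x|lborel. h i x) = 0"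
      by (rule zero(2)[of r]) (auto simp: r h_def inner_axis power2_eq_square)
  qed
  have hsum: "(\<Sum>i\<in>UNIV. h i x) = G x \<bullet> k x + (2 / a\<^sup>2) * (indicator (ball y a) x * f x)" for x
  proof -
    have "(\<Sum>i\<in>UNIV. dk i z) = (if norm z < a then 2 / a\<^sup>2 else 0)" for z
    proof (cases "norm z < a")
      case False
      hence n: "norm z \<noteq> 0" using a by auto
      have "(\<Sum>i\<in>UNIV. (z $ i)\<^sup>2) = (norm z)\<^sup>2" unfolding power2_norm_eq_inner inner_vec_def by (simp add: power2_eq_square)
      hence "(\<Sum>i\<in>UNIV. 2 * (z $ i)\<^sup>2 / (norm z)^4) = 2 / (norm z)\<^sup>2"
        using n by (simp add: power2_eq_square power4_eq_xxxx flip: sum_divide_distrib sum_distrib_left)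
      thus ?thesis using False by (simp add: dk_def sum_subtractf)
    qed (simp add: dk_def)
    from this[of "x - y"] have "(\<Sum>i\<in>UNIV. dk i (x - y)) = 2 / a\<^sup>2 * indicator (ball y a) x"
      by (simp add: indicator_def dist_norm norm_minus_commute)
    thus ?thesis unfolding h_def by (simp add: sum.distrib inner_vec_def flip: sum_distrib_left)
  qed
  have i1: "integrable lborel (\<lambda>x. G x \<bullet> k x)" by (intro Cc_integrable C1c_Cc_grad_inner[OF f kc])
  have i2: "integrable lborel (\<lambda>x. indicator (ball y a) x * f x)"
    by (intro integrable_indicator_mult Cc_integrable C1c_Cc[OF f]) auto
  have "0 = (LINT x|lborel. (\<Sum>i\<in>UNIV. h i x))" using main by (simp add: Bochner_Integration.integral_sum)
  also have "\<dots> = (LINT x|lborel. G x \<bullet> k x) + (2 / a\<^sup>2) * (LINT x|lborel. indicator (ball y a) x * f x)"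
    unfolding hsum using i1 i2 by simp
  finally show ?thesis unfolding k_def by simp
qed

section \<open>Averages over discs\<close>

definition ball_avg :: "real \<Rightarrow> plane \<Rightarrow> (plane \<Rightarrow> real) \<Rightarrow> real" where
  "ball_avg a y f = (LINT x|lborel. indicator (ball y a) x * f x) / (pi * a\<^sup>2)"

lemma integrable_indicator_ball: "integrable lborel (indicator (ball (y::plane) a) :: plane \<Rightarrow> real)"
  using emeasure_bounded_finite[OF bounded_ball, of y a] by (intro integrable_real_indicator) auto

lemma ball_avg_le_const:
  assumes "Cc f" "a > 0" "\<And>x. x \<in> ball y a \<Longrightarrow> f x \<le> c"
  shows "ball_avg a y f \<le> c"
proof -
  have "(LINT x|lborel. indicator (ball y a) x * f x) \<le> (LINT x|lborel. indicator (ball y a) x * c)"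
  proof (rule integral_mono)
    show "indicator (ball y a) x * f x \<le> indicator (ball y a) x * c" for x
      using assms(3)[of x] by (simp add: indicator_def)
    show "integrable lborel (\<lambda>x. indicator (ball y a) x * f x)"
      by (intro integrable_indicator_mult Cc_integrable assms) auto
    show "integrable lborel (\<lambda>x. indicator (ball y a) x * c)"
      using integrable_indicator_ball by (intro integrable_mult_left) auto
  qed
  also have "\<dots> = (pi * a\<^sup>2) * c" using assms(2) lborel_ball_plane[of a y] by simp
  finally show ?thesis unfolding ball_avg_def using assms(2) by (simp add: field_simps)
qed

lemma ball_avg_cmult: "ball_avg a y (\<lambda>x. c * f x) = c * ball_avg a y f"
proof -
  have "(\<lambda>x. indicator (ball y a) x * (c * f x)) = (\<lambda>x. c * (indicator (ball y a) x * f x))" by (auto simp: mult_ac)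
  thus ?thesis unfolding ball_avg_def by simp
qed

lemma ball_avg_ge_const:
  assumes "Cc f" "a > 0" "\<And>x. x \<in> ball y a \<Longrightarrow> f x \<ge> c"
  shows "ball_avg a y f \<ge> c"
  using ball_avg_le_const[OF Cc_cmult[OF assms(1), of "-1"] assms(2), of y "-c"] assms(3) ball_avg_cmult[of a y "-1" f]
  by simp

lemma ball_avg_diff:
  assumes "Cc f" "Cc g"
  shows "ball_avg a y (\<lambda>x. f x - g x) = ball_avg a y f - ball_avg a y g"
proof -
  have "(LINT x|lborel. indicator (ball y a) x * (f x - g x)) = (LINT x|lborel. indicator (ball y a) x * f x - indicator (ball y a) x * g x)"
    by (simp add: algebra_simps)
  also have "\<dots> = (LINT x|lborel. indicator (ball y a) x * f x) - (LINT x|lborel. indicator (ball y a) x * g x)"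
    using assms by (intro Bochner_Integration.integral_diff integrable_indicator_mult Cc_integrable) auto
  finally show ?thesis unfolding ball_avg_def by (simp add: diff_divide_distrib)
qed

lemma ball_avg_sum:
  assumes "\<And>i. i \<in> I \<Longrightarrow> Cc (f i)"
  shows "ball_avg a y (\<lambda>x. \<Sum>i\<in>I. f i x) = (\<Sum>i\<in>I. ball_avg a y (f i))"
proof -
  have "(LINT x|lborel. indicator (ball y a) x * (\<Sum>i\<in>I. f i x)) = (LINT x|lborel. (\<Sum>i\<in>I. indicator (ball y a) x * f i x))"
    by (simp add: sum_distrib_left)
  also have "\<dots> = (\<Sum>i\<in>I. LINT x|lborel. indicator (ball y a) x * f i x)"
    using assms by (intro Bochner_Integration.integral_sum integrable_indicator_mult Cc_integrable) auto
  finally show ?thesis unfolding ball_avg_def by (simp add: sum_divide_distrib)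
qed

text \<open>Integration by parts against the radial field \<open>x - y\<close>, whose divergence is 2.\<close>
lemma integral_radial_derivative:
  assumes f: "C1c f G"
  shows "2 * (LINT x|lborel. f x) = - (LINT x|lborel. G x \<bullet> (x - y))"
proof -
  have d: "((\<lambda>x. (x - y) $ i) has_derivative (\<lambda>h. axis i 1 \<bullet> h)) (at x)" for i x
    by (rule has_derivative_compose[OF _ has_derivative_component, where f = "\<lambda>x. x - y", THEN has_derivative_eq_rhs])
       (auto intro!: derivative_eq_intros)
  let ?H = "\<lambda>i x. (x - y) $ i *\<^sub>R G x + f x *\<^sub>R axis i 1"
  have C: "C1c (\<lambda>x. f x * (x - y) $ i) (?H i)" for i
    by (rule C1c_mult_disc[OF f d]) auto
  have "(LINT x|lborel. (\<Sum>i\<in>UNIV. ?H i x \<bullet> axis i 1)) = (\<Sum>i\<in>UNIV. LINT x|lborel. ?H i x \<bullet> axis i 1)"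
    by (rule Bochner_Integration.integral_sum) (rule Cc_integrable[OF C1c_Cc_grad[OF C]])
  also have "\<dots> = 0" using C1c_integral_grad[OF C] by (intro sum.neutral) auto
  also have "(\<lambda>x. \<Sum>i\<in>UNIV. ?H i x \<bullet> axis i 1) = (\<lambda>x. G x \<bullet> (x - y) + 2 * f x)"
  proof
    fix x
    have "?H i x \<bullet> axis i 1 = G x $ i * (x - y) $ i + f x" for i
      by (simp add: inner_axis)
    thus "(\<Sum>i\<in>UNIV. ?H i x \<bullet> axis i 1) = G x \<bullet> (x - y) + 2 * f x"
      by (simp add: inner_vec_def sum.distrib)
  qed
  finally have "(LINT x|lborel. G x \<bullet> (x - y) + 2 * f x) = 0" .
  moreover have "integrable lborel (\<lambda>x. G x \<bullet> (x - y))"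
    by (intro Cc_integrable C1c_Cc_grad_inner[OF f] continuous_intros)
  moreover have "integrable lborel (\<lambda>x. 2 * f x)"
    by (intro Cc_integrable Cc_cmult C1c_Cc[OF f])
  ultimately show ?thesis by simp
qed

text \<open>Solves \<open>- \<Delta> w = \<mu>\<^sub>\<epsilon> - \<mu>\<^sub>R\<close> for the uniform distributions on two concentric discs; by the shell
  theorem it vanishes outside the larger one.\<close>
definition cutlog :: "plane \<Rightarrow> real \<Rightarrow> real \<Rightarrow> plane \<Rightarrow> real" where
  "cutlog y R \<epsilon> x = (logpot R (x - y) - logpot \<epsilon> (x - y)) / (2 * pi)"

definition cutlog_grad :: "plane \<Rightarrow> real \<Rightarrow> real \<Rightarrow> plane \<Rightarrow> plane" where
  "cutlog_grad y R \<epsilon> x = (1 / (2 * pi)) *\<^sub>R (logpot_grad R (x - y) - logpot_grad \<epsilon> (x - y))"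

lemma logpot_outside: "a > 0 \<Longrightarrow> norm x \<ge> a \<Longrightarrow> logpot a x = ln (norm x)"
proof -
  assume a: "a > 0" and x: "norm x \<ge> a"
  have x0: "norm x > 0" using a x by linarith
  have "(norm x)\<^sup>2 / a\<^sup>2 \<ge> 1" using a x by (simp add: field_simps power_mono)
  hence "log_profile ((norm x)\<^sup>2 / a\<^sup>2) = ln ((norm x)\<^sup>2 / a\<^sup>2) / 2"
    by (cases "(norm x)\<^sup>2 / a\<^sup>2 = 1") (auto simp: log_profile_def)
  also have "ln ((norm x)\<^sup>2 / a\<^sup>2) = 2 * ln (norm x) - 2 * ln a" using a x0 by (simp add: ln_div ln_realpow)
  finally show ?thesis by (simp add: logpot_def)
qed

lemma logpot_inside: "a > 0 \<Longrightarrow> norm x \<le> a \<Longrightarrow> logpot a x = ln a + ((norm x)\<^sup>2 / a\<^sup>2 - 1) / 2"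
proof -
  assume a: "a > 0" and x: "norm x \<le> a"
  have "(norm x)\<^sup>2 / a\<^sup>2 \<le> 1" using a x by (simp add: field_simps power_mono)
  thus ?thesis by (simp add: logpot_def log_profile_def)
qed

lemma logpot_grad_outside: "a > 0 \<Longrightarrow> norm z \<ge> a \<Longrightarrow> logpot_grad a z = (1 / (norm z)\<^sup>2) *\<^sub>R z"
  unfolding logpot_grad_def by (simp add: max_def power_mono antisym)

lemma logpot_ge:
  assumes "a > 0" shows "logpot a x \<ge> ln (max a (norm x)) - 1/2"
proof (cases "norm x \<le> a")
  case True
  have "(norm x)\<^sup>2 / a\<^sup>2 \<ge> 0" by simp
  then show ?thesis using True assms by (simp add: logpot_inside max_def)
next
  case False
  then show ?thesis using assms by (simp add: logpot_outside max_def)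
qed

text \<open>Spreading the mass over a larger disc raises the potential. Where one of the two is
  logarithmic and the other quadratic, this is \<open>ln t \<le> t - 1\<close>; where both are
  quadratic, the comparison is reduced to the circle of radius \<epsilon>.\<close>

lemma logpot_mono_radius:
  assumes "0 < \<epsilon>" "\<epsilon> \<le> R"
  shows "logpot \<epsilon> x \<le> logpot R x"
proof -
  define n where "n = norm x"
  have R: "R > 0" using assms by linarith
  consider "n \<ge> R" | "\<epsilon> \<le> n" "n < R" | "n < \<epsilon>" by linarith
  thus ?thesis
  proof cases
    case 1
    then show ?thesis using assms R by (simp add: logpot_outside n_def)
  next
    case 2
    have n0: "n > 0" using 2 assms by linarith
    have "ln ((n / R)\<^sup>2) \<le> (n/R)\<^sup>2 - 1" using n0 R by (intro ln_le_minus_one) simp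
    also have "ln ((n / R)\<^sup>2) = 2 * ln n - 2 * ln R" using n0 R by (simp add: ln_realpow ln_div power_divide)
    finally have "2 * ln n - 2 * ln R \<le> (n/R)\<^sup>2 - 1" .
    moreover have "p \<le> q + t / 2" if "2 * p - 2 * q \<le> t" for p q t :: real using that by linarith
    ultimately have "ln n \<le> ln R + ((n/R)\<^sup>2 - 1) / 2" by blast
    hence "ln n \<le> ln R + (n\<^sup>2 / R\<^sup>2 - 1) / 2" by (simp add: power_divide)
    moreover have "logpot \<epsilon> x = ln n" "logpot R x = ln R + (n\<^sup>2 / R\<^sup>2 - 1) / 2"
      unfolding n_def using 2 assms R by (auto simp: logpot_outside logpot_inside n_def)
    ultimately show ?thesis by simp
  next
    case 3
    have "ln ((\<epsilon> / R)\<^sup>2) \<le> (\<epsilon>/R)\<^sup>2 - 1" using assms R by (intro ln_le_minus_one) simp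
    hence 1: "ln \<epsilon> - ln R \<le> (\<epsilon>\<^sup>2 / R\<^sup>2 - 1) / 2" using assms R by (simp add: ln_realpow ln_div power_divide)
    have "n\<^sup>2 \<le> \<epsilon>\<^sup>2" using 3 by (simp add: n_def power_mono)
    hence "(\<epsilon>\<^sup>2 - n\<^sup>2) * (1 / \<epsilon>\<^sup>2 - 1 / R\<^sup>2) \<ge> 0"
      using assms R by (intro mult_nonneg_nonneg) (auto simp: field_simps power_mono)
    hence "\<epsilon>\<^sup>2 / R\<^sup>2 - 1 \<le> n\<^sup>2 / R\<^sup>2 - n\<^sup>2 / \<epsilon>\<^sup>2" using assms by (simp add: algebra_simps)
    moreover have "p + (s - 1) / 2 \<le> q + (t - 1) / 2" if "p - q \<le> (r - 1) / 2" "r - 1 \<le> t - s" for p q r s t :: real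
      using that by argo
    ultimately have "ln \<epsilon> + (n\<^sup>2 / \<epsilon>\<^sup>2 - 1) / 2 \<le> ln R + (n\<^sup>2 / R\<^sup>2 - 1) / 2" using 1 by blast
    then show ?thesis using 3 assms R by (simp add: logpot_inside n_def)
  qed
qed

context
  fixes y :: plane and R \<epsilon> :: real
  assumes eps: "0 < \<epsilon>" "\<epsilon> \<le> R" and yR: "norm y + R < 1"
begin

lemma outer_radius_pos: "R > 0" using eps by linarith

lemma cutlog_outside: "norm (x - y) \<ge> R \<Longrightarrow> cutlog y R \<epsilon> x = 0"
  using eps outer_radius_pos by (simp add: cutlog_def logpot_outside)

lemma cutlog_grad_outside: "norm (x - y) \<ge> R \<Longrightarrow> cutlog_grad y R \<epsilon> x = 0"
  using eps outer_radius_pos by (simp add: cutlog_grad_def logpot_grad_outside)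

lemma cutlog_C1c: "C1c (cutlog y R \<epsilon>) (cutlog_grad y R \<epsilon>)"
proof -
  have d: "((\<lambda>x. logpot a (x - y)) has_derivative (\<lambda>h. logpot_grad a (x - y) \<bullet> h)) (at x)" if "a > 0" for a x
    by (rule has_derivative_compose[OF _ logpot_derivative[OF that], where f = "\<lambda>x. x - y", THEN has_derivative_eq_rhs])
       (auto intro!: derivative_eq_intros)
  have "(cutlog y R \<epsilon> has_derivative (\<lambda>h. cutlog_grad y R \<epsilon> x \<bullet> h)) (at x)" for x
    unfolding cutlog_def[abs_def] cutlog_grad_def
    by (rule bounded_linear.has_derivative[OF bounded_linear_divide has_derivative_diff[OF d d], THEN has_derivative_eq_rhs])
       (use eps outer_radius_pos in \<open>auto simp: inner_diff_left diff_divide_distrib\<close>)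
  moreover have "continuous_on UNIV (cutlog_grad y R \<epsilon>)"
    unfolding cutlog_grad_def[abs_def]
    using eps outer_radius_pos by (intro continuous_intros continuous_on_compose2[OF continuous_on_logpot_grad]) auto
  moreover have "norm (x - y) \<ge> R" if "norm y + R \<le> norm x" for x
    using that norm_triangle_ineq2[of x y] by linarith
  ultimately show ?thesis unfolding C1c_def using yR cutlog_outside cutlog_grad_outside by blast
qed

lemma cutlog_nonneg: "cutlog y R \<epsilon> x \<ge> 0"
  using logpot_mono_radius[OF eps] by (simp add: cutlog_def)

lemma cutlog_le:
  assumes "norm (x - y) \<le> R"
  shows "2 * pi * cutlog y R \<epsilon> x \<le> 1/2 + ln (R / max \<epsilon> (norm (x - y)))"
proof -
  have "(norm (x - y))\<^sup>2 / R\<^sup>2 \<le> 1" using assms outer_radius_pos by (simp add: power_mono)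
  hence "logpot R (x - y) \<le> ln R" using assms outer_radius_pos by (simp add: logpot_inside)
  moreover have "logpot \<epsilon> (x - y) \<ge> ln (max \<epsilon> (norm (x - y))) - 1/2" by (rule logpot_ge[OF eps(1)])
  moreover have "max \<epsilon> (norm (x - y)) > 0" using eps by (simp add: less_max_iff_disj)
  hence "ln (R / max \<epsilon> (norm (x - y))) = ln R - ln (max \<epsilon> (norm (x - y)))"
    using outer_radius_pos by (intro ln_divide_pos)
  ultimately show ?thesis by (simp add: cutlog_def)
qed

lemma integral_grad_cutlog:
  assumes f: "C1c f G"
  shows "(LINT x|lborel. G x \<bullet> cutlog_grad y R \<epsilon> x) = ball_avg \<epsilon> y f - ball_avg R y f"
proof -
  have c: "continuous_on UNIV (\<lambda>x. logpot_grad a (x - y))" if "a > 0" for a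
    using that by (intro continuous_on_compose2[OF continuous_on_logpot_grad] continuous_intros) auto
  have i: "integrable lborel (\<lambda>x. G x \<bullet> logpot_grad a (x - y))" if "a > 0" for a
    by (intro Cc_integrable C1c_Cc_grad_inner[OF f] c that)
  have "(LINT x|lborel. G x \<bullet> cutlog_grad y R \<epsilon> x)
     = (LINT x|lborel. (1 / (2 * pi)) * (G x \<bullet> logpot_grad R (x - y) - G x \<bullet> logpot_grad \<epsilon> (x - y)))"
    by (simp add: cutlog_grad_def inner_diff_right)
  also have "\<dots> = (1 / (2 * pi)) * ((LINT x|lborel. G x \<bullet> logpot_grad R (x - y)) - (LINT x|lborel. G x \<bullet> logpot_grad \<epsilon> (x - y)))"
    using i eps outer_radius_pos by simp
  also have "\<dots> = ball_avg \<epsilon> y f - ball_avg R y f"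
    unfolding integral_grad_logpot[OF f outer_radius_pos] integral_grad_logpot[OF f eps(1)] ball_avg_def
    by (simp add: field_simps)
  finally show ?thesis .
qed

text \<open>The peak of the function grows like \<open>ln (R / \<epsilon>)\<close>, but its radial
  derivative is bounded independently of \<epsilon>. With the radial integration by parts this gives
  integral bounds that are uniform in \<epsilon>.\<close>

lemma cutlog_radial:
  "- (cutlog_grad y R \<epsilon> x \<bullet> (x - y)) \<le> indicator (ball y R) x / (2 * pi)"
proof (cases "norm (x - y) < R")
  case True
  define n where "n = (norm (x - y))\<^sup>2"
  have e: "logpot_grad a (x - y) \<bullet> (x - y) = n / max (a\<^sup>2) n" for a
    by (simp add: logpot_grad_def n_def power2_norm_eq_inner)
  have "n / max (R\<^sup>2) n \<ge> 0" by (intro divide_nonneg_nonneg) (auto simp: n_def le_max_iff_disj)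
  moreover have "n / max (\<epsilon>\<^sup>2) n \<le> 1" using max_sq_pos[OF eps(1), of n] by simp
  ultimately have "- (n / max (R\<^sup>2) n - n / max (\<epsilon>\<^sup>2) n) \<le> 1" by linarith
  hence "(1 / (2 * pi)) * (- (n / max (R\<^sup>2) n - n / max (\<epsilon>\<^sup>2) n)) \<le> (1 / (2 * pi)) * 1"
    by (intro mult_left_mono) auto
  moreover have "indicator (ball y R) x = (1::real)" using True by (simp add: dist_norm norm_minus_commute)
  moreover have "cutlog_grad y R \<epsilon> x \<bullet> (x - y) = (1 / (2 * pi)) * (n / max (R\<^sup>2) n - n / max (\<epsilon>\<^sup>2) n)"
    by (simp add: cutlog_grad_def inner_diff_left e)
  ultimately show ?thesis by (simp only: mult_minus_right mult_1_right)
next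
  case False
  then show ?thesis by (simp add: cutlog_grad_outside)
qed

lemma integral_cutlog_le: "(LINT x|lborel. cutlog y R \<epsilon> x) \<le> R\<^sup>2 / 4"
proof -
  have i: "integrable lborel (\<lambda>x. cutlog_grad y R \<epsilon> x \<bullet> (x - y))"
    by (intro Cc_integrable C1c_Cc_grad_inner[OF cutlog_C1c] continuous_intros)
  have "2 * (LINT x|lborel. cutlog y R \<epsilon> x) = (LINT x|lborel. - (cutlog_grad y R \<epsilon> x \<bullet> (x - y)))"
    using integral_radial_derivative[OF cutlog_C1c, of y] i by simp
  also have "\<dots> \<le> (LINT x|lborel. indicator (ball y R) x / (2 * pi))"
    by (intro integral_mono cutlog_radial integrable_minus[OF i] integrable_divide integrable_indicator_ball)
  also have "\<dots> = R\<^sup>2 / 2" using lborel_ball_plane[of R y] outer_radius_pos by simp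
  finally show ?thesis by simp
qed

text \<open>The radial identity applied to the square reproduces the function times its radial
  derivative; the bound on the latter reduces the claim to the integral of the function
  itself.\<close>

lemma integral_cutlog_sq_le: "(LINT x|lborel. (cutlog y R \<epsilon> x)\<^sup>2) \<le> R\<^sup>2 / (8 * pi)"
proof -
  let ?W = "cutlog y R \<epsilon>" and ?G = "cutlog_grad y R \<epsilon>"
  have W2: "C1c (\<lambda>x. ?W x * ?W x) (\<lambda>x. ?W x *\<^sub>R ?G x + ?W x *\<^sub>R ?G x)"
    by (rule C1c_mult[OF cutlog_C1c cutlog_C1c])
  have i: "integrable lborel (\<lambda>x. (?W x *\<^sub>R ?G x + ?W x *\<^sub>R ?G x) \<bullet> (x - y))"
    by (intro Cc_integrable C1c_Cc_grad_inner[OF W2] continuous_intros)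
  have "2 * (LINT x|lborel. ?W x * ?W x) = (LINT x|lborel. - ((?W x *\<^sub>R ?G x + ?W x *\<^sub>R ?G x) \<bullet> (x - y)))"
    using integral_radial_derivative[OF W2, of y] i by simp
  also have "\<dots> \<le> (LINT x|lborel. ?W x / pi)"
  proof (intro integral_mono integrable_minus[OF i] integrable_divide Cc_integrable C1c_Cc[OF cutlog_C1c])
    fix x
    have "- (?G x \<bullet> (x - y)) \<le> 1 / (2 * pi)"
      using cutlog_radial[of x] by (rule order_trans) (auto simp: indicator_def)
    hence "2 * ?W x * (- (?G x \<bullet> (x - y))) \<le> 2 * ?W x * (1 / (2 * pi))"
      using cutlog_nonneg by (intro mult_left_mono) auto
    thus "- ((?W x *\<^sub>R ?G x + ?W x *\<^sub>R ?G x) \<bullet> (x - y)) \<le> ?W x / pi"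
      by (simp only: inner_add_left inner_scaleR_left) simp
  qed
  also have "\<dots> = (LINT x|lborel. ?W x) / pi" by simp
  also have "\<dots> \<le> (R\<^sup>2 / 4) / pi" using integral_cutlog_le by (intro divide_right_mono) auto
  finally show ?thesis by (simp add: power2_eq_square)
qed

end

text \<open>Testing one truncated logarithm against the other turns the energy into a difference of
  disc averages, and the subtracted one is nonnegative. On the small disc around \<open>y\<close>
  the distance to \<open>y'\<close>, cut off at \<epsilon>, is at least half of that between the
  centres, so the logarithm changes by at most \<open>ln 2\<close>.\<close>

lemma cutlog_pair_energy:
  assumes "0 < \<epsilon>" "\<epsilon> \<le> R" "norm y + R < 1" "\<epsilon> \<le> R'" "norm y' + R' < 1"
  shows "(LINT x|lborel. cutlog_grad y R \<epsilon> x \<bullet> cutlog_grad y' R' \<epsilon> x)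
     \<le> (1 / (2 * pi)) * (3/2 + ln (1 / max \<epsilon> (norm (y - y'))))"
proof -
  let ?W = "cutlog y' R' \<epsilon>"
  have W: "C1c ?W (cutlog_grad y' R' \<epsilon>)" using assms by (intro cutlog_C1c) auto
  have R: "R > 0" "R' > 0" "R' \<le> 1" using assms norm_ge_zero[of y'] by linarith+
  define m where "m = max \<epsilon> (norm (y - y'))"
  have m0: "m > 0" using assms by (simp add: m_def less_max_iff_disj)
  have "norm (y - y') \<le> 2" using assms norm_triangle_ineq4[of y y'] R by linarith
  moreover have "\<epsilon> \<le> 2" using assms R by linarith
  ultimately have m2: "m \<le> 2" by (simp add: m_def)
  have ln2: "ln 2 \<le> (25/36::real)" by (rule ln2_le_25_over_36)
  \<comment> \<open>Keeps the claimed bound nonnegative, as required at points where the second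
    logarithm has already been cut off to 0.\<close>
  have lnm: "ln (1 / m) \<ge> - ln 2" using m0 m2 by (simp add: ln_div)
  have "(LINT x|lborel. cutlog_grad y R \<epsilon> x \<bullet> cutlog_grad y' R' \<epsilon> x) = ball_avg \<epsilon> y ?W - ball_avg R y ?W"
    using integral_grad_cutlog[OF assms(1,2,3) W] by (simp add: inner_commute)
  moreover have "ball_avg R y ?W \<ge> 0"
    using cutlog_nonneg[of \<epsilon> R' y'] assms by (intro ball_avg_ge_const C1c_Cc[OF W] R) auto
  moreover have "ball_avg \<epsilon> y ?W \<le> (1 / (2 * pi)) * (3/2 + ln (1 / m))"
  proof (intro ball_avg_le_const C1c_Cc[OF W] assms)
    fix x assume x: "x \<in> ball y \<epsilon>"
    have "2 * pi * ?W x \<le> 3/2 + ln (1 / m)"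
    proof (cases "norm (x - y') \<le> R'")
      case True
      define k where "k = max \<epsilon> (norm (x - y'))"
      have k0: "k > 0" using assms by (simp add: k_def less_max_iff_disj)
      have "norm (y - y') \<le> norm (y - x) + norm (x - y')"
        by (metis diff_add_cancel add_diff_eq norm_triangle_ineq)
      hence mk: "m \<le> 2 * k" using x assms(1) by (auto simp: m_def k_def dist_norm)
      have "2 * pi * ?W x \<le> 1/2 + ln (R' / k)"
        unfolding k_def using assms True by (intro cutlog_le) auto
      also have "ln (R' / k) \<le> ln (2 / m)"
      proof (intro ln_mono)
        have "R' / k \<le> 1 / k" using R k0 by (intro divide_right_mono) auto
        also have "1 / k \<le> 2 / m" using mk m0 k0 by (simp add: field_simps)
        finally show "R' / k \<le> 2 / m" .
      qed (use R k0 m0 in auto)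
      also have "ln (2 / m) = ln 2 + ln (1 / m)" using m0 by (simp add: ln_div)
      finally show ?thesis using ln2 by simp
    next
      case False
      hence "?W x = 0" using assms by (intro cutlog_outside) auto
      then show ?thesis using lnm ln2 by simp
    qed
    thus "?W x \<le> (1 / (2 * pi)) * (3/2 + ln (1 / m))" by (simp add: field_simps)
  qed
  ultimately show ?thesis unfolding m_def by linarith
qed

section \<open>The inequality for continuously differentiable functions\<close>

definition sing_pot :: "real \<Rightarrow> plane \<Rightarrow> real" where
  "sing_pot \<alpha> x = 1 / (1 - (norm x)\<^sup>2)\<^sup>2 + \<alpha>"

lemma continuous_on_sing_pot: "continuous_on disc (sing_pot \<alpha>)"
  unfolding sing_pot_def[abs_def] by (intro continuous_intros continuous_on_gap_power)

lemma Cc_sing_pot: "Cc f \<Longrightarrow> Cc (\<lambda>x. f x * sing_pot \<alpha> x)"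
  by (rule Cc_mult_disc[OF _ continuous_on_sing_pot])

lemma sing_pot_nonneg: "\<alpha> \<ge> 0 \<Longrightarrow> sing_pot \<alpha> x \<ge> 0"
  by (simp add: sing_pot_def)

lemma hardy_sing_pot: "Cc f \<Longrightarrow> hardy f + \<alpha> * (LINT x|lborel. (f x)\<^sup>2) = (LINT x|lborel. (f x)\<^sup>2 * sing_pot \<alpha> x)"
proof -
  assume f: "Cc f"
  have "(LINT x|lborel. (f x)\<^sup>2 * sing_pot \<alpha> x) = (LINT x|lborel. (f x)\<^sup>2 / (1 - (norm x)\<^sup>2)\<^sup>2 + \<alpha> * (f x)\<^sup>2)"
    by (simp add: sing_pot_def algebra_simps)
  also have "\<dots> = hardy f + \<alpha> * (LINT x|lborel. (f x)\<^sup>2)"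
    unfolding hardy_def using f
    by (subst Bochner_Integration.integral_add) (auto intro!: Cc_integrable Cc_hardy Cc_power2 Cc_cmult)
  finally show ?thesis by simp
qed

text \<open>A quarter of the gap as radius keeps the ball at distance at least \<open>3 * R\<close>
  from the circle, so the potential has the size \<open>1 / R^2\<close> dictated by scaling;
  \<alpha> is absorbed because \<open>R\<close> is at most 1.\<close>

lemma sing_pot_le:
  assumes y: "norm y < 1" and R: "R = (1 - norm y) / 4" and x: "x \<in> ball y R" and a: "\<alpha> \<ge> 0"
  shows "sing_pot \<alpha> x \<le> (1 + \<alpha>) / R\<^sup>2"
proof -
  have R0: "R > 0" "R \<le> 1/4" using y R norm_ge_zero[of y] by auto
  have "norm x \<le> norm y + norm (x - y)" using norm_triangle_sub by blast
  hence nx: "norm x \<le> 1 - 3 * R" using x R by (simp add: dist_norm norm_minus_commute)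
  have "(norm x)\<^sup>2 \<le> norm x * 1" unfolding power2_eq_square using nx R0 by (intro mult_left_mono) auto
  hence "1 - (norm x)\<^sup>2 \<ge> R" using nx R0 by simp
  hence "1 / (1 - (norm x)\<^sup>2)\<^sup>2 \<le> 1 / R\<^sup>2" using R0 by (intro divide_left_mono power_mono) auto
  moreover have "\<alpha> * 1 \<le> \<alpha> * (1 / R\<^sup>2)"
  proof (rule mult_left_mono[OF _ a])
    have "R\<^sup>2 \<le> 1" using R0 by (simp add: power_le_one)
    thus "1 \<le> 1 / R\<^sup>2" using R0 by (simp add: field_simps)
  qed
  ultimately show ?thesis by (simp add: sing_pot_def add_divide_distrib)
qed

section \<open>Estimates on discs comparable with the distance to the boundary\<close>

definition inradius :: "plane \<Rightarrow> real" where
  "inradius y = (1 - norm y) / 4"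

text \<open>Only comparable balls overlap, because the radii are 1/4-Lipschitz in the centre.\<close>
lemma ball_avg_cutlog_le:
  assumes y: "norm y < 1" "norm y' < 1" and e: "0 < \<epsilon>" "\<epsilon> \<le> inradius y'"
  shows "ball_avg (inradius y) y (cutlog y' (inradius y') \<epsilon>) \<le> 1"
proof -
  let ?R = "inradius y" and ?R' = "inradius y'"
  let ?W = "cutlog y' ?R' \<epsilon>"
  have R: "?R > 0" "?R' > 0" using y by (auto simp: inradius_def)
  have yR: "norm y' + ?R' < 1" using y by (simp add: inradius_def field_simps)
  have W: "C1c ?W (cutlog_grad y' ?R' \<epsilon>)" by (rule cutlog_C1c[OF e yR])
  show ?thesis
  proof (cases "norm (y - y') < ?R + ?R'")
    case True
    have "\<bar>norm y - norm y'\<bar> \<le> norm (y - y')" by (rule norm_triangle_ineq3)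
    moreover have "4 * ?R = 1 - norm y" "4 * ?R' = 1 - norm y'" by (auto simp: inradius_def)
    \<comment> \<open>Overlap gives \<open>4 * (R' - R) \<le> R + R'\<close>. The mass
      \<open>R'^2 / 4\<close> of the logarithm is then at most \<open>25/36 * R^2\<close>, less than
      the area of the averaging disc.\<close>
    ultimately have R': "?R' \<le> 5/3 * ?R" using True by linarith
    have "(LINT x|lborel. indicator (ball y ?R) x * ?W x) \<le> (LINT x|lborel. ?W x)"
      by (intro integral_mono integrable_indicator_mult Cc_integrable C1c_Cc[OF W])
         (auto simp: indicator_def cutlog_nonneg[OF e yR])
    also have "\<dots> \<le> ?R'\<^sup>2 / 4" by (rule integral_cutlog_le[OF e yR])
    also have "\<dots> \<le> (5/3 * ?R)\<^sup>2 / 4" using R R' by (intro divide_right_mono power_mono) auto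
    also have "\<dots> \<le> pi * ?R\<^sup>2"
    proof -
      have "25/36 * ?R\<^sup>2 \<le> pi * ?R\<^sup>2" using pi_gt3 by (intro mult_right_mono) auto
      thus ?thesis by (simp add: power_mult_distrib power2_eq_square)
    qed
    finally show ?thesis unfolding ball_avg_def using R by (simp add: field_simps)
  next
    case False
    show ?thesis
    proof (rule ball_avg_le_const[OF C1c_Cc[OF W] R(1)])
      fix x assume "x \<in> ball y ?R"
      moreover have "norm (y - y') \<le> norm (y - x) + norm (x - y')"
        by (metis diff_add_cancel add_diff_eq norm_triangle_ineq)
      ultimately have "norm (x - y') \<ge> ?R'" using False by (simp add: dist_norm)
      thus "?W x \<le> 1" using cutlog_outside[OF e yR] by simp
    qed
  qed
qed

text \<open>Pointwise \<open>z \<le> k/2 * z^2 + 1/(2*k)\<close>; the local Hardy bound for the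
  square carries the factor \<open>R^2\<close>, which the area of the disc cancels. Optimizing over
  \<open>k\<close> would give a square root of the energy; the free parameter is kept so that it can
  be adapted to the coercivity constant.\<close>

lemma ball_avg_le_energy:
  assumes z: "C1c z Z" and y: "norm y < 1" and k: "k > 0"
  shows "ball_avg (inradius y) y z \<le> 50 * k * (dirichlet Z - hardy z) + 1 / k"
proof -
  let ?R = "inradius y" and ?A = "dirichlet Z - hardy z"
  have R: "?R > 0" using y by (auto simp: inradius_def)
  have A: "?A \<ge> 0" using hardy_le_dirichlet[OF z] by simp
  have zc: "Cc z" by (rule C1c_Cc[OF z])
  have i: "integrable lborel (\<lambda>x. indicator (ball y ?R) x * (k / 2 * (z x)\<^sup>2))"
    by (intro integrable_indicator_mult Cc_integrable Cc_cmult Cc_power2 zc) auto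
  have j: "integrable lborel (\<lambda>x. indicator (ball y ?R) x * (1 / (2 * k)))"
    using integrable_indicator_ball by (intro integrable_mult_left) auto
  have "(LINT x|lborel. indicator (ball y ?R) x * z x) \<le>
     (LINT x|lborel. indicator (ball y ?R) x * (k / 2 * (z x)\<^sup>2) + indicator (ball y ?R) x * (1 / (2 * k)))"
  proof (rule integral_mono)
    show "integrable lborel (\<lambda>x. indicator (ball y ?R) x * z x)"
      by (intro integrable_indicator_mult Cc_integrable zc) auto
    show "integrable lborel (\<lambda>x. indicator (ball y ?R) x * (k / 2 * (z x)\<^sup>2) + indicator (ball y ?R) x * (1 / (2 * k)))"
      by (intro Bochner_Integration.integrable_add i j)
    fix x
    have "0 \<le> (k * z x - 1)\<^sup>2 / (2 * k)" using k by simp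
    also have "\<dots> = k / 2 * (z x)\<^sup>2 + 1 / (2 * k) - z x" using k by (simp add: power2_eq_square field_simps)
    finally have "z x \<le> k / 2 * (z x)\<^sup>2 + 1 / (2 * k)" by linarith
    thus "indicator (ball y ?R) x * z x \<le> indicator (ball y ?R) x * (k / 2 * (z x)\<^sup>2) + indicator (ball y ?R) x * (1 / (2 * k))"
      by (simp add: indicator_def)
  qed
  also have "\<dots> = k / 2 * (LINT x|lborel. indicator (ball y ?R) x * (z x)\<^sup>2) + pi * ?R\<^sup>2 * (1 / (2 * k))"
  proof -
    have eq: "(\<lambda>x. indicator (ball y ?R) x * (k / 2 * (z x)\<^sup>2)) = (\<lambda>x. k / 2 * (indicator (ball y ?R) x * (z x)\<^sup>2))"
      by (simp only: mult.left_commute)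
    have "(LINT x|lborel. indicator (ball y ?R) x * (k / 2 * (z x)\<^sup>2)) = k / 2 * (LINT x|lborel. indicator (ball y ?R) x * (z x)\<^sup>2)"
      unfolding eq by (rule integral_mult_right_zero)
    moreover have "(LINT x|lborel. indicator (ball y ?R) x * (1 / (2 * k))) = pi * ?R\<^sup>2 * (1 / (2 * k))"
      using lborel_ball_plane[of ?R y] R by (subst integral_mult_left_zero) (simp only:)
    ultimately show ?thesis using i j by (subst Bochner_Integration.integral_add) (simp_all only:)
  qed
  also have "\<dots> \<le> k / 2 * (100 * ?R\<^sup>2 * ?A) + pi * ?R\<^sup>2 * (1 / (2 * k))"
    using k integral_ball_le[OF z y, of ?R] by (intro add_right_mono mult_left_mono) (auto simp: inradius_def)
  finally have "ball_avg ?R y z \<le> (k / 2 * (100 * ?R\<^sup>2 * ?A) + pi * ?R\<^sup>2 * (1 / (2 * k))) / (pi * ?R\<^sup>2)"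
    unfolding ball_avg_def using R by (intro divide_right_mono) auto
  also have "\<dots> = 50 * k * ?A / pi + 1 / (2 * k)" using R k by (simp add: field_simps)
  also have "\<dots> \<le> 50 * k * ?A + 1 / k"
  proof (rule add_mono)
    have "50 * k * ?A / pi \<le> 50 * k * ?A / 1" using A k pi_gt3 by (intro divide_left_mono) auto
    thus "50 * k * ?A / pi \<le> 50 * k * ?A" by simp
    show "1 / (2 * k) \<le> 1 / k" using k by (simp add: field_simps)
  qed
  finally show ?thesis .
qed

context
  fixes y :: plane and \<epsilon> \<alpha> :: real
  assumes y: "norm y < 1" and eps: "0 < \<epsilon>" "\<epsilon> \<le> inradius y" and alpha: "\<alpha> \<ge> 0"
begin

lemma inradius_pos: "inradius y > 0"
  using y by (simp add: inradius_def)

lemma y_inradius: "norm y + inradius y < 1"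
  using y by (simp add: inradius_def field_simps)

lemma cutlog_supp: "x \<notin> ball y (inradius y) \<Longrightarrow> cutlog y (inradius y) \<epsilon> x = 0"
  by (intro cutlog_outside[OF eps y_inradius]) (simp add: dist_norm norm_minus_commute)

text \<open>The factor \<open>R^2\<close> in the integral of the squared logarithm compensates the
  bound \<open>1 / R^2\<close> of the potential on its support.\<close>

lemma integral_cutlog_sq_pot_le:
  "(LINT x|lborel. (cutlog y (inradius y) \<epsilon> x)\<^sup>2 * sing_pot \<alpha> x) \<le> (1 + \<alpha>) / (8 * pi)"
proof -
  let ?R = "inradius y"
  let ?W = "cutlog y ?R \<epsilon>"
  have W: "Cc ?W" by (rule C1c_Cc[OF cutlog_C1c[OF eps y_inradius]])
  have "(LINT x|lborel. (?W x)\<^sup>2 * sing_pot \<alpha> x) \<le> (LINT x|lborel. (1 + \<alpha>) / ?R\<^sup>2 * (?W x)\<^sup>2)"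
  proof (intro integral_mono Cc_integrable Cc_sing_pot Cc_cmult Cc_power2 W)
    fix x
    show "(?W x)\<^sup>2 * sing_pot \<alpha> x \<le> (1 + \<alpha>) / ?R\<^sup>2 * (?W x)\<^sup>2"
    proof (cases "x \<in> ball y ?R")
      case True
      have "(?W x)\<^sup>2 * sing_pot \<alpha> x \<le> (?W x)\<^sup>2 * ((1 + \<alpha>) / ?R\<^sup>2)"
        by (intro mult_left_mono sing_pot_le[OF y inradius_def True alpha]) auto
      thus ?thesis by (simp add: mult.commute)
    qed (simp add: cutlog_supp)
  qed
  also have "\<dots> = (1 + \<alpha>) / ?R\<^sup>2 * (LINT x|lborel. (?W x)\<^sup>2)" by simp
  also have "\<dots> \<le> (1 + \<alpha>) / ?R\<^sup>2 * (?R\<^sup>2 / (8 * pi))"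
    using alpha by (intro mult_left_mono integral_cutlog_sq_le[OF eps y_inradius]) auto
  also have "\<dots> = (1 + \<alpha>) / (8 * pi)" using inradius_pos by simp
  finally show ?thesis .
qed

text \<open>Young's inequality with weight \<open>k\<close> separates \<open>z\<close> from the
  logarithm. Both squares integrate to order \<open>R^2\<close> over the disc, again balanced by the
  potential, so the bound is uniform in \<open>y\<close> and \<epsilon>.\<close>

lemma integral_mult_cutlog_pot_le:
  assumes z: "C1c z Z" and k: "k > 0"
  shows "(LINT x|lborel. z x * cutlog y (inradius y) \<epsilon> x * sing_pot \<alpha> x) \<le> (1 + \<alpha>) * (50 * k * (dirichlet Z - hardy z) + 1 / k)"
proof -
  let ?R = "inradius y"
  let ?W = "cutlog y ?R \<epsilon>"
  have W: "Cc ?W" by (rule C1c_Cc[OF cutlog_C1c[OF eps y_inradius]])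
  have zc: "Cc z" by (rule C1c_Cc[OF z])
  have i: "integrable lborel (\<lambda>x. indicator (ball y ?R) x * (z x)\<^sup>2)"
    by (intro integrable_indicator_mult Cc_integrable Cc_power2 zc) auto
  have j: "integrable lborel (\<lambda>x. (?W x)\<^sup>2)" by (intro Cc_integrable Cc_power2 W)
  let ?c = "(1 + \<alpha>) / ?R\<^sup>2"
  have "(LINT x|lborel. z x * ?W x * sing_pot \<alpha> x) \<le>
     (LINT x|lborel. ?c * (k / 2 * (indicator (ball y ?R) x * (z x)\<^sup>2) + 1 / (2 * k) * (?W x)\<^sup>2))"
  proof (rule integral_mono)
    show "integrable lborel (\<lambda>x. z x * ?W x * sing_pot \<alpha> x)"
      by (intro Cc_integrable Cc_sing_pot Cc_mult zc W)
    show "integrable lborel (\<lambda>x. ?c * (k / 2 * (indicator (ball y ?R) x * (z x)\<^sup>2) + 1 / (2 * k) * (?W x)\<^sup>2))"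
      by (intro integrable_mult_right Bochner_Integration.integrable_add i j)
    fix x
    show "z x * ?W x * sing_pot \<alpha> x \<le> ?c * (k / 2 * (indicator (ball y ?R) x * (z x)\<^sup>2) + 1 / (2 * k) * (?W x)\<^sup>2)"
    proof (cases "x \<in> ball y ?R")
      case True
      have "0 \<le> (k * z x - ?W x)\<^sup>2 / (2 * k)" using k by simp
      also have "\<dots> = k / 2 * (z x)\<^sup>2 + 1 / (2 * k) * (?W x)\<^sup>2 - z x * ?W x" using k by (simp add: power2_eq_square field_simps)
      finally have 1: "z x * ?W x \<le> k / 2 * (z x)\<^sup>2 + 1 / (2 * k) * (?W x)\<^sup>2" by linarith
      have "z x * ?W x * sing_pot \<alpha> x \<le> (k / 2 * (z x)\<^sup>2 + 1 / (2 * k) * (?W x)\<^sup>2) * sing_pot \<alpha> x"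
        by (intro mult_right_mono 1 sing_pot_nonneg[OF alpha])
      also have "\<dots> \<le> (k / 2 * (z x)\<^sup>2 + 1 / (2 * k) * (?W x)\<^sup>2) * ?c"
        using k by (intro mult_left_mono sing_pot_le[OF y inradius_def True alpha]) auto
      finally show ?thesis using True by (simp add: mult.commute)
    next
      case False
      then show ?thesis by (simp add: cutlog_supp)
    qed
  qed
  also have "\<dots> = ?c * (k / 2 * (LINT x|lborel. indicator (ball y ?R) x * (z x)\<^sup>2) + 1 / (2 * k) * (LINT x|lborel. (?W x)\<^sup>2))"
    using i j by simp
  also have "\<dots> \<le> ?c * (k / 2 * (100 * ?R\<^sup>2 * (dirichlet Z - hardy z)) + 1 / (2 * k) * (?R\<^sup>2 / (8 * pi)))"
    using k alpha integral_ball_le[OF z y inradius_def] integral_cutlog_sq_le[OF eps y_inradius]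
    by (intro mult_left_mono add_mono) auto
  also have "\<dots> = (1 + \<alpha>) * (50 * k * (dirichlet Z - hardy z) + 1 / (16 * pi * k))"
  proof -
    have "1 / ?R\<^sup>2 * (k / 2 * (100 * ?R\<^sup>2 * B)) = 50 * k * B" "1 / ?R\<^sup>2 * (1 / (2 * k) * (?R\<^sup>2 / (8 * pi))) = 1 / (16 * pi * k)" for B
      using inradius_pos k by (simp_all add: field_simps)
    hence "1 / ?R\<^sup>2 * (k / 2 * (100 * ?R\<^sup>2 * B) + 1 / (2 * k) * (?R\<^sup>2 / (8 * pi))) = 50 * k * B + 1 / (16 * pi * k)" for B
      by (simp only: distrib_left)
    hence "(1 + \<alpha>) * (1 / ?R\<^sup>2 * (k / 2 * (100 * ?R\<^sup>2 * B) + 1 / (2 * k) * (?R\<^sup>2 / (8 * pi)))) = (1 + \<alpha>) * (50 * k * B + 1 / (16 * pi * k))" for B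
      by (simp only:)
    moreover have "?c * X = (1 + \<alpha>) * (1 / ?R\<^sup>2 * X)" for X by simp
    ultimately show ?thesis by (simp only:)
  qed
  also have "\<dots> \<le> (1 + \<alpha>) * (50 * k * (dirichlet Z - hardy z) + 1 / k)"
  proof (intro mult_left_mono add_left_mono)
    have "1 * k \<le> 16 * pi * k" using k pi_gt3 by (intro mult_right_mono) auto
    thus "1 / (16 * pi * k) \<le> 1 / k" using k by (intro divide_left_mono) auto
  qed (use alpha in auto)
  finally show ?thesis .
qed

end

text \<open>Completing the square with the parametrix \<open>w\<close> of the point masses \<open>q\<close>: only the
  energy of \<open>z = u - w\<close> enters the lower order terms, and it is absorbed by coercivity.\<close>
lemma point_mass_energy_bound:
  fixes q :: "'i \<Rightarrow> real" and p :: "'i \<Rightarrow> plane"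
  assumes alpha: "\<alpha> \<ge> 0" and delta: "\<delta> > 0"
    and coercive: "\<And>f F. C1c f F \<Longrightarrow> dirichlet F - hardy f - \<alpha> * (LINT x|lborel. (f x)\<^sup>2) \<ge> \<delta> * (dirichlet F - hardy f)"
    and u: "C1c u U" and fin: "finite I" and q0: "\<And>i. i \<in> I \<Longrightarrow> q i \<ge> 0" and q1: "(\<Sum>i\<in>I. q i) = 1"
    and p: "\<And>i. i \<in> I \<Longrightarrow> norm (p i) < 1" and eps: "\<epsilon> > 0" "\<And>i. i \<in> I \<Longrightarrow> \<epsilon> \<le> inradius (p i)"
  shows "dirichlet U - hardy u - \<alpha> * (LINT x|lborel. (u x)\<^sup>2) \<ge>
     16 * pi * (\<Sum>i\<in>I. q i * ball_avg \<epsilon> (p i) u)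
     - 32 * pi * (\<Sum>i\<in>I. \<Sum>j\<in>I. q i * q j * (3/2 + ln (1 / max \<epsilon> (norm (p i - p j)))))
     - (12800 * pi\<^sup>2 * (2 + \<alpha>)\<^sup>2 / \<delta> + 128 * pi\<^sup>2 + 8 * pi * (1 + \<alpha>))"
proof -
  define W where "W i = cutlog (p i) (inradius (p i)) \<epsilon>" for i
  define GW where "GW i = cutlog_grad (p i) (inradius (p i)) \<epsilon>" for i
  have pr: "norm (p i) + inradius (p i) < 1" if "i \<in> I" for i using p[OF that] by (simp add: inradius_def field_simps)
  have W: "C1c (W i) (GW i)" if "i \<in> I" for i
    unfolding W_def GW_def by (rule cutlog_C1c[OF eps(1) eps(2)[OF that] pr[OF that]])
  have Wc: "Cc (W i)" if "i \<in> I" for i using C1c_Cc[OF W[OF that]] .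
  \<comment> \<open>The factor 8 pi is the one for which twice the cross term with \<open>u\<close>
    gives averages of \<open>u\<close> with coefficient 16 pi.\<close>
  define w where "w x = (\<Sum>i\<in>I. (8 * pi * q i) * W i x)" for x
  define Gw where "Gw x = (\<Sum>i\<in>I. (8 * pi * q i) *\<^sub>R GW i x)" for x
  have w: "C1c w Gw" unfolding w_def[abs_def] Gw_def[abs_def] by (intro C1c_sum C1c_cmult W)
  define z where "z x = u x - w x" for x
  define Z where "Z x = U x - Gw x" for x
  have z: "C1c z Z" unfolding z_def[abs_def] Z_def[abs_def] by (rule C1c_diff[OF u w])
  have uc: "Cc u" and wc: "Cc w" and zc: "Cc z" using u w z by (auto intro: C1c_Cc)
  define A where "A = dirichlet Z - hardy z"
  let ?s = "sing_pot \<alpha>"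
  have Aq: "dirichlet Z - (LINT x|lborel. (z x)\<^sup>2 * ?s x) \<ge> \<delta> * A"
    using coercive[OF z] hardy_sing_pot[OF zc, of \<alpha>] unfolding A_def by linarith
  \<comment> \<open>Solves \<open>16 * pi * (2 + \<alpha>) * 50 * k = \<delta>\<close>. The error
    \<open>E\<close> occurs with factor \<open>1 + \<alpha>\<close> from the mixed potential term
    and with factor 1 from the averages over the large discs; together they use up the coercive term
    exactly.\<close>
  define k where "k = \<delta> / (800 * pi * (2 + \<alpha>))"
  have k: "k > 0" using delta alpha by (simp add: k_def)
  define E where "E = 50 * k * A + 1 / k"
  have cross_int: "(LINT x|lborel. U x \<bullet> Gw x) = (\<Sum>i\<in>I. 8 * pi * q i * (ball_avg \<epsilon> (p i) u - ball_avg (inradius (p i)) (p i) u))"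
  proof -
    have "(LINT x|lborel. U x \<bullet> Gw x) = (LINT x|lborel. (\<Sum>i\<in>I. (8 * pi * q i) * (U x \<bullet> GW i x)))"
      by (simp add: Gw_def inner_sum_right)
    also have "\<dots> = (\<Sum>i\<in>I. LINT x|lborel. (8 * pi * q i) * (U x \<bullet> GW i x))"
      by (intro Bochner_Integration.integral_sum Cc_integrable Cc_cmult C1c_Cc_grad_inner[OF u] C1c_cont_grad[OF W])
    also have "\<dots> = (\<Sum>i\<in>I. 8 * pi * q i * (ball_avg \<epsilon> (p i) u - ball_avg (inradius (p i)) (p i) u))"
      by (intro sum.cong refl) (simp add: GW_def integral_grad_cutlog[OF eps(1) eps(2) pr u])
    finally show ?thesis .
  qed
  \<comment> \<open>The cross term is kept with \<open>U\<close> rather than \<open>Z\<close>,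
    because testing \<open>u\<close> itself produces its averages around the point masses.\<close>
  have D: "dirichlet U = dirichlet Z + 2 * (LINT x|lborel. U x \<bullet> Gw x) - dirichlet Gw"
  proof -
    have i: "integrable lborel (\<lambda>x. (norm (Z x))\<^sup>2)" "integrable lborel (\<lambda>x. 2 * (U x \<bullet> Gw x))" "integrable lborel (\<lambda>x. (norm (Gw x))\<^sup>2)"
      by (intro Cc_integrable C1c_Cc_norm[OF z] C1c_Cc_norm[OF w] Cc_cmult C1c_Cc_grad_inner[OF u] C1c_cont_grad[OF w])+
    have "(\<lambda>x. (norm (U x))\<^sup>2) = (\<lambda>x. (norm (Z x))\<^sup>2 + 2 * (U x \<bullet> Gw x) - (norm (Gw x))\<^sup>2)"
      unfolding power2_norm_eq_inner Z_def
      by (auto simp: inner_diff_left inner_diff_right inner_commute)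
    thus ?thesis unfolding dirichlet_def using i by simp
  qed
  have P: "(LINT x|lborel. (u x)\<^sup>2 * ?s x) = (LINT x|lborel. (z x)\<^sup>2 * ?s x) + 2 * (LINT x|lborel. z x * w x * ?s x) + (LINT x|lborel. (w x)\<^sup>2 * ?s x)"
  proof -
    have i: "integrable lborel (\<lambda>x. (z x)\<^sup>2 * ?s x)" "integrable lborel (\<lambda>x. 2 * (z x * w x * ?s x))" "integrable lborel (\<lambda>x. (w x)\<^sup>2 * ?s x)"
      by (intro Cc_integrable Cc_cmult Cc_sing_pot Cc_mult Cc_power2 zc wc)+
    have "(\<lambda>x. (u x)\<^sup>2 * ?s x) = (\<lambda>x. (z x)\<^sup>2 * ?s x + 2 * (z x * w x * ?s x) + (w x)\<^sup>2 * ?s x)"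
      unfolding z_def by (auto simp: power2_eq_square algebra_simps)
    thus ?thesis using i by simp
  qed
  \<comment> \<open>Convexity of the square with the probability weights \<open>q\<close> reduces to
    a single logarithm, however many supports overlap.\<close>
  have wsq: "(LINT x|lborel. (w x)\<^sup>2 * ?s x) \<le> 8 * pi * (1 + \<alpha>)"
  proof -
    have "(w x)\<^sup>2 \<le> (\<Sum>i\<in>I. 64 * pi\<^sup>2 * q i * (W i x)\<^sup>2)" for x
    proof -
      define m where "m = (\<Sum>i\<in>I. q i * W i x)"
      have "0 \<le> (\<Sum>i\<in>I. q i * (W i x - m)\<^sup>2)" by (intro sum_nonneg mult_nonneg_nonneg q0) auto
      also have "\<dots> = (\<Sum>i\<in>I. q i * (W i x)\<^sup>2) - 2 * m * (\<Sum>i\<in>I. q i * W i x) + m\<^sup>2 * (\<Sum>i\<in>I. q i)"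
        by (simp add: power2_eq_square algebra_simps sum.distrib sum_subtractf sum_distrib_left)
      also have "\<dots> = (\<Sum>i\<in>I. q i * (W i x)\<^sup>2) - m\<^sup>2" using q1 by (simp add: m_def[symmetric] power2_eq_square)
      finally have "64 * pi\<^sup>2 * m\<^sup>2 \<le> 64 * pi\<^sup>2 * (\<Sum>i\<in>I. q i * (W i x)\<^sup>2)" by (intro mult_left_mono) auto
      moreover have "w x = 8 * pi * m" by (simp add: w_def m_def sum_distrib_left mult_ac)
      ultimately show ?thesis by (simp add: power_mult_distrib sum_distrib_left mult_ac)
    qed
    hence "(LINT x|lborel. (w x)\<^sup>2 * ?s x) \<le> (LINT x|lborel. (\<Sum>i\<in>I. 64 * pi\<^sup>2 * q i * (W i x)\<^sup>2) * ?s x)"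
      by (intro integral_mono Cc_integrable Cc_sing_pot Cc_power2 wc Cc_sum Cc_cmult Wc mult_right_mono sing_pot_nonneg alpha)
    also have "\<dots> = (LINT x|lborel. (\<Sum>i\<in>I. 64 * pi\<^sup>2 * q i * ((W i x)\<^sup>2 * ?s x)))"
      by (simp only: sum_distrib_right mult.assoc)
    also have "\<dots> = (\<Sum>i\<in>I. LINT x|lborel. 64 * pi\<^sup>2 * q i * ((W i x)\<^sup>2 * ?s x))"
      by (intro Bochner_Integration.integral_sum Cc_integrable Cc_cmult Cc_sing_pot Cc_power2 Wc)
    also have "\<dots> = (\<Sum>i\<in>I. 64 * pi\<^sup>2 * q i * (LINT x|lborel. (W i x)\<^sup>2 * ?s x))" by simp
    also have "\<dots> \<le> (\<Sum>i\<in>I. 64 * pi\<^sup>2 * q i * ((1 + \<alpha>) / (8 * pi)))"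
      unfolding W_def using q0 by (intro sum_mono mult_left_mono integral_cutlog_sq_pot_le p eps alpha) auto
    also have "\<dots> = 64 * pi\<^sup>2 * ((1 + \<alpha>) / (8 * pi)) * (\<Sum>i\<in>I. q i)"
      unfolding sum_distrib_left by (intro sum.cong refl) (simp only: mult_ac mult_1_right)
    also have "\<dots> = 8 * pi * (1 + \<alpha>)" using q1 by (simp add: power2_eq_square)
    finally show ?thesis .
  qed
  have zw: "2 * (LINT x|lborel. z x * w x * ?s x) \<le> 16 * pi * ((1 + \<alpha>) * E)"
  proof -
    have "(LINT x|lborel. z x * w x * ?s x) = (LINT x|lborel. (\<Sum>i\<in>I. 8 * pi * q i * (z x * W i x * ?s x)))"
      unfolding w_def sum_distrib_left sum_distrib_right
      by (intro Bochner_Integration.integral_cong refl sum.cong) (simp only: mult_ac)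
    also have "\<dots> = (\<Sum>i\<in>I. LINT x|lborel. 8 * pi * q i * (z x * W i x * ?s x))"
      by (intro Bochner_Integration.integral_sum Cc_integrable Cc_cmult Cc_sing_pot Cc_mult zc Wc)
    also have "\<dots> = (\<Sum>i\<in>I. 8 * pi * q i * (LINT x|lborel. z x * W i x * ?s x))" by simp
    also have "\<dots> \<le> (\<Sum>i\<in>I. 8 * pi * q i * ((1 + \<alpha>) * E))"
      unfolding W_def E_def A_def using q0 
      by (intro sum_mono mult_left_mono integral_mult_cutlog_pot_le[OF _ _ _ _ z] p eps alpha k) auto
    also have "\<dots> = 8 * pi * ((1 + \<alpha>) * E) * (\<Sum>i\<in>I. q i)"
      unfolding sum_distrib_left by (intro sum.cong refl) (simp only: mult_ac mult_1_right)
    finally have "(LINT x|lborel. z x * w x * ?s x) \<le> 8 * pi * ((1 + \<alpha>) * E)" unfolding q1 by simp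
    moreover have "2 * a \<le> 16 * pi * c" if "a \<le> 8 * pi * c" for a c using that by simp
    ultimately show ?thesis by blast
  qed
  \<comment> \<open>The averages over the large discs are the price of the truncation. They are
    subtracted, so an upper bound suffices; it is obtained separately for \<open>z\<close> and for
    \<open>w\<close>.\<close>
  have avg: "ball_avg (inradius (p i)) (p i) u \<le> E + 8 * pi" if i: "i \<in> I" for i
  proof -
    have "ball_avg (inradius (p i)) (p i) w = (\<Sum>j\<in>I. ball_avg (inradius (p i)) (p i) (\<lambda>x. 8 * pi * q j * W j x))"
      unfolding w_def[abs_def] by (intro ball_avg_sum Cc_cmult Wc)
    also have "\<dots> = (\<Sum>j\<in>I. 8 * pi * q j * ball_avg (inradius (p i)) (p i) (W j))" by (simp only: ball_avg_cmult)
    also have "\<dots> \<le> (\<Sum>j\<in>I. 8 * pi * q j * 1)"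
      unfolding W_def using q0 by (intro sum_mono mult_left_mono ball_avg_cutlog_le p eps i) auto
    also have "\<dots> = 8 * pi * (\<Sum>j\<in>I. q j)"
      unfolding sum_distrib_left by (intro sum.cong refl) (simp only: mult_ac mult_1_right)
    finally have 1: "ball_avg (inradius (p i)) (p i) w \<le> 8 * pi" using q1 by simp
    have 2: "ball_avg (inradius (p i)) (p i) z \<le> E"
      unfolding E_def A_def by (rule ball_avg_le_energy[OF z p[OF i] k])
    have "ball_avg (inradius (p i)) (p i) z = ball_avg (inradius (p i)) (p i) u - ball_avg (inradius (p i)) (p i) w"
      unfolding z_def[abs_def] by (rule ball_avg_diff[OF uc wc])
    with 1 2 show ?thesis by linarith
  qed
  have cross: "2 * (LINT x|lborel. U x \<bullet> Gw x) \<ge> 16 * pi * (\<Sum>i\<in>I. q i * ball_avg \<epsilon> (p i) u) - 16 * pi * (E + 8 * pi)"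
  proof -
    have "(\<Sum>i\<in>I. q i * ball_avg (inradius (p i)) (p i) u) \<le> (\<Sum>i\<in>I. q i * (E + 8 * pi))"
      by (intro sum_mono mult_left_mono avg q0)
    also have "\<dots> = E + 8 * pi" using q1 by (simp flip: sum_distrib_right)
    finally have "16 * pi * (\<Sum>i\<in>I. q i * ball_avg (inradius (p i)) (p i) u) \<le> 16 * pi * (E + 8 * pi)"
      by (intro mult_left_mono) auto
    moreover have "2 * (LINT x|lborel. U x \<bullet> Gw x) = 16 * pi * (\<Sum>i\<in>I. q i * ball_avg \<epsilon> (p i) u)
       - 16 * pi * (\<Sum>i\<in>I. q i * ball_avg (inradius (p i)) (p i) u)"
      unfolding cross_int by (simp add: sum_distrib_left sum_subtractf right_diff_distrib mult_ac)
    ultimately show ?thesis by linarith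
  qed
  have Dw: "dirichlet Gw \<le> 32 * pi * (\<Sum>i\<in>I. \<Sum>j\<in>I. q i * q j * (3/2 + ln (1 / max \<epsilon> (norm (p i - p j)))))"
  proof -
    have "dirichlet Gw = (LINT x|lborel. (\<Sum>i\<in>I. \<Sum>j\<in>I. 64 * pi\<^sup>2 * (q i * q j) * (GW i x \<bullet> GW j x)))"
      unfolding dirichlet_def power2_norm_eq_inner Gw_def inner_sum_left inner_sum_right
      by (simp add: sum_distrib_left power2_eq_square mult_ac inner_commute)
    also have "\<dots> = (\<Sum>i\<in>I. \<Sum>j\<in>I. LINT x|lborel. 64 * pi\<^sup>2 * (q i * q j) * (GW i x \<bullet> GW j x))"
      by (subst Bochner_Integration.integral_sum;
          (intro sum.cong refl Bochner_Integration.integral_sum)?;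
          intro Cc_integrable Cc_sum Cc_cmult C1c_Cc_grad_inner[OF W] C1c_cont_grad[OF W])
    also have "\<dots> = (\<Sum>i\<in>I. \<Sum>j\<in>I. 64 * pi\<^sup>2 * (q i * q j) * (LINT x|lborel. GW i x \<bullet> GW j x))" by simp
    also have "\<dots> \<le> (\<Sum>i\<in>I. \<Sum>j\<in>I. 64 * pi\<^sup>2 * (q i * q j) * ((1 / (2 * pi)) * (3/2 + ln (1 / max \<epsilon> (norm (p i - p j))))))"
      unfolding GW_def using q0 by (intro sum_mono mult_left_mono cutlog_pair_energy eps pr) auto
    also have "\<dots> = 32 * pi * (\<Sum>i\<in>I. \<Sum>j\<in>I. q i * q j * (3/2 + ln (1 / max \<epsilon> (norm (p i - p j)))))"
    proof -
      have "64 * pi\<^sup>2 * a * ((1 / (2 * pi)) * b) = 32 * pi * (a * b)" for a b by (simp add: power2_eq_square)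
      thus ?thesis unfolding sum_distrib_left by (intro sum.cong refl)
    qed
    finally show ?thesis .
  qed
  have kk: "16 * pi * ((1 + \<alpha>) * E) + 16 * pi * E = \<delta> * A + 12800 * pi\<^sup>2 * (2 + \<alpha>)\<^sup>2 / \<delta>"
  proof -
    have "16 * pi * ((1 + \<alpha>) * E) + 16 * pi * E = 16 * pi * (2 + \<alpha>) * E" by (simp add: algebra_simps)
    also have "\<dots> = (800 * pi * (2 + \<alpha>) * k) * A + 16 * pi * (2 + \<alpha>) * (1 / k)" unfolding E_def by (simp add: algebra_simps)
    also have "800 * pi * (2 + \<alpha>) * k = \<delta>" unfolding k_def using alpha by simp
    also have "16 * pi * (2 + \<alpha>) * (1 / k) = 12800 * pi\<^sup>2 * (2 + \<alpha>)\<^sup>2 / \<delta>" unfolding k_def by (simp add: power2_eq_square)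
    finally show ?thesis .
  qed
  have "dirichlet U - hardy u - \<alpha> * (LINT x|lborel. (u x)\<^sup>2) = dirichlet U - (LINT x|lborel. (u x)\<^sup>2 * ?s x)"
    using hardy_sing_pot[OF uc, of \<alpha>] by linarith
  moreover have "16 * pi * (E + 8 * pi) = 16 * pi * E + 128 * pi\<^sup>2" by (simp add: algebra_simps power2_eq_square)
  ultimately show ?thesis using D P Aq wsq zw cross Dw kk by linarith
qed

section \<open>Discretization of the exponential integral\<close>

lemma gibbs_sum:
  fixes v :: "'i \<Rightarrow> real"
  assumes "finite I" "I \<noteq> {}"
  defines "S \<equiv> \<Sum>i\<in>I. exp (v i)"
  shows "(\<Sum>i\<in>I. exp (v i) / S) = 1"
    and "(\<Sum>i\<in>I. exp (v i) / S * ln (exp (v i) / S)) = (\<Sum>i\<in>I. exp (v i) / S * v i) - ln S"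
proof -
  have S: "S > 0" unfolding S_def using assms by (intro sum_pos) auto
  show 1: "(\<Sum>i\<in>I. exp (v i) / S) = 1" using S by (simp add: S_def flip: sum_divide_distrib)
  have "exp (v i) / S * ln (exp (v i) / S) = exp (v i) / S * v i - exp (v i) / S * ln S" for i
    using S by (simp add: ln_divide_pos right_diff_distrib)
  hence "(\<Sum>i\<in>I. exp (v i) / S * ln (exp (v i) / S)) = (\<Sum>i\<in>I. exp (v i) / S * v i) - (\<Sum>i\<in>I. exp (v i) / S) * ln S"
    by (simp only: sum_subtractf sum_distrib_right)
  thus "(\<Sum>i\<in>I. exp (v i) / S * ln (exp (v i) / S)) = (\<Sum>i\<in>I. exp (v i) / S * v i) - ln S"
    unfolding 1 by simp
qed

lemma integrable_exp_Cc:
  assumes u: "Cc u"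
  shows "integrable lborel (\<lambda>x. indicator disc x * exp (u x))"
proof -
  obtain F where F: "\<And>x. \<bar>u x\<bar> \<le> F" using Cc_bounded[OF u] by metis
  show ?thesis
  proof (rule Bochner_Integration.integrable_bound[where f = "\<lambda>x. exp F * indicator disc x"])
    show "integrable lborel (\<lambda>x::plane. exp F * indicator disc x)"
      by (intro integrable_mult_right integrable_indicator_ball)
    have "(\<lambda>x. exp (u x)) \<in> borel_measurable borel" using Cc_measurable[OF u] by measurable
    thus "(\<lambda>x. indicator disc x * exp (u x)) \<in> borel_measurable lborel"
      by (intro borel_measurable_times borel_measurable_indicator) auto
    show "AE x in lborel. norm (indicator disc x * exp (u x)) \<le> norm (exp F * indicator disc x)"
      using F by (intro AE_I2) (auto simp: indicator_def abs_le_iff)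
  qed
qed

text \<open>Natural indices, starting at the corner (-1, -1) of the square around the disc, feed
  directly into the dyadic inequality.\<close>

definition grid_point :: "real \<Rightarrow> nat \<times> nat \<Rightarrow> plane" where
  "grid_point \<epsilon> X = (\<chi> i. - 1 + \<epsilon> * real (if i = 1 then fst X else snd X))"

text \<open>Each coordinate difference is at most the Euclidean norm, hence the factor 1/2 for their
  sum; the cutoffs \<open>max \<epsilon>\<close> and \<open>max 1\<close> correspond to each other
  on the diagonal.\<close>

lemma grid_point_dist:
  assumes "\<epsilon> > 0"
  shows "\<epsilon> / 2 * max 1 (\<bar>real (fst X) - real (fst Y)\<bar> + \<bar>real (snd X) - real (snd Y)\<bar>)
     \<le> max \<epsilon> (norm (grid_point \<epsilon> X - grid_point \<epsilon> Y))"
proof -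
  let ?d = "grid_point \<epsilon> X - grid_point \<epsilon> Y"
  have 1: "\<epsilon> * \<bar>real (fst X) - real (fst Y)\<bar> \<le> norm ?d"
  proof -
    have "?d $ 1 = \<epsilon> * (real (fst X) - real (fst Y))" by (simp add: grid_point_def algebra_simps)
    thus ?thesis using component_le_norm_cart[of ?d 1] assms by (simp add: abs_mult)
  qed
  have 2: "\<epsilon> * \<bar>real (snd X) - real (snd Y)\<bar> \<le> norm ?d"
  proof -
    have "?d $ 2 = \<epsilon> * (real (snd X) - real (snd Y))" by (simp add: grid_point_def algebra_simps)
    thus ?thesis using component_le_norm_cart[of ?d 2] assms by (simp add: abs_mult)
  qed
  have "\<epsilon> / 2 * (\<bar>real (fst X) - real (fst Y)\<bar> + \<bar>real (snd X) - real (snd Y)\<bar>) \<le> norm ?d"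
    using 1 2 by (simp add: distrib_left)
  moreover have "\<epsilon> / 2 * 1 \<le> \<epsilon>" using assms by simp
  ultimately show ?thesis by (auto simp: le_max_iff_disj max_def)
qed

lemma grid_point_near:
  assumes e: "\<epsilon> > 0" "2 = \<epsilon> * real N" and x: "norm (x::plane) < 1"
  obtains X where "X \<in> {..<N} \<times> {..<N}" "norm (x - grid_point \<epsilon> X) < 2 * \<epsilon>"
proof -
  define c where "c i = nat \<lfloor>(x $ i + 1) / \<epsilon>\<rfloor>" for i
  have xi: "- 1 < x $ i" "x $ i < 1" for i using component_le_norm_cart[of x i] x by linarith+
  have fl: "real (c i) \<le> (x $ i + 1) / \<epsilon>" "(x $ i + 1) / \<epsilon> < real (c i) + 1" for i
  proof -
    have "(x $ i + 1) / \<epsilon> \<ge> 0" using xi[of i] e by simp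
    thus "real (c i) \<le> (x $ i + 1) / \<epsilon>" "(x $ i + 1) / \<epsilon> < real (c i) + 1" unfolding c_def by linarith+
  qed
  have cN: "c i < N" for i
  proof -
    have "(x $ i + 1) / \<epsilon> < 2 / \<epsilon>" using xi[of i] e by (intro divide_strict_right_mono) auto
    also have "2 / \<epsilon> = real N" using e by (simp add: field_simps)
    finally show ?thesis using fl(1)[of i] by linarith
  qed
  have near: "\<bar>x $ i + 1 - \<epsilon> * real (c i)\<bar> < \<epsilon>" for i
    using fl[of i] e by (simp add: field_simps abs_less_iff)
  have "norm (x - grid_point \<epsilon> (c 1, c 2)) \<le> (\<Sum>i\<in>UNIV. \<bar>(x - grid_point \<epsilon> (c 1, c 2)) $ i\<bar>)"
    by (rule norm_le_l1_cart)
  also have "\<dots> = \<bar>x $ 1 + 1 - \<epsilon> * real (c 1)\<bar> + \<bar>x $ 2 + 1 - \<epsilon> * real (c 2)\<bar>"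
    by (simp add: sum_2 grid_point_def algebra_simps)
  also have "\<dots> < 2 * \<epsilon>" using near[of 1] near[of 2] by linarith
  finally show ?thesis using that[of "(c 1, c 2)"] cN by auto
qed

text \<open>The mesh may depend on \<open>u\<close> because none of the constants depends on it. It
  is taken so fine that \<open>u\<close> varies by at most 1 over two mesh widths; then a sum over
  grid points controls the integral of \<open>exp u\<close>, and averages of \<open>u\<close> over
  mesh-sized discs are close to its values.\<close>

lemma moser_onofri_C1c:
  assumes alpha: "\<alpha> \<ge> 0" and delta: "\<delta> > 0"
    and coercive: "\<And>f F. C1c f F \<Longrightarrow> dirichlet F - hardy f - \<alpha> * (LINT x|lborel. (f x)\<^sup>2) \<ge> \<delta> * (dirichlet F - hardy f)"
  shows "\<exists>C. \<forall>u U. C1c u U \<longrightarrow>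
     dirichlet U - hardy u - \<alpha> * (LINT x|lborel. (u x)\<^sup>2) - 16 * pi * ln (LINT x|lborel. indicator disc x * exp (u x)) \<ge> - C"
proof (intro exI allI impI)
  define C1 where "C1 = 12800 * pi\<^sup>2 * (2 + \<alpha>)\<^sup>2 / \<delta> + 128 * pi\<^sup>2 + 8 * pi * (1 + \<alpha>)"
  define K where "K = pi + 4 * pi * exp 1"
  have K: "K \<ge> 1" unfolding K_def using pi_gt3 by (intro add_increasing2) auto
  have C1: "C1 \<ge> 0" unfolding C1_def using alpha delta by (intro add_nonneg_nonneg) auto
  fix u U assume u: "C1c u U"
  let ?Q = "dirichlet U - hardy u - \<alpha> * (LINT x|lborel. (u x)\<^sup>2)"
  let ?Z = "LINT x|lborel. indicator disc x * exp (u x)"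
  have uc: "Cc u" by (rule C1c_Cc[OF u])
  have Q0: "?Q \<ge> 0"
  proof -
    have "\<delta> * (dirichlet U - hardy u) \<ge> 0"
      using hardy_le_dirichlet[OF u] delta by (intro mult_nonneg_nonneg) auto
    thus ?thesis using coercive[OF u] by linarith
  qed
  obtain r where r: "r < 1" "\<And>x. r \<le> norm x \<Longrightarrow> u x = 0" using uc unfolding Cc_def by blast
  obtain M where M: "M \<ge> 0" "\<And>x. norm (U x) \<le> M" using C1c_bounded_grad[OF u] by metis
  have lip: "\<bar>u x - u y\<bar> \<le> M * norm (x - y)" for x y by (rule C1c_lipschitz[OF u M(2)])
  \<comment> \<open>The first bound controls the oscillation of \<open>u\<close>. The second makes
    every grid point within two mesh widths of the support of \<open>u\<close> satisfy
    \<open>norm \<le> 1 - 4 * \<epsilon>\<close>, which says that \<epsilon> is at most its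
    \<open>inradius\<close>.\<close>
  define \<eta> where "\<eta> = min (1 / (2 * (M + 1))) ((1 - r) / 6)"
  have "\<eta> > 0" using M r by (simp add: \<eta>_def)
  then obtain n where n: "(1/2)^n < \<eta>" using real_arch_pow_inv[of \<eta> "1/2"] by auto
  define \<epsilon> :: real where "\<epsilon> = (1/2)^n"
  have e: "\<epsilon> > 0" by (simp add: \<epsilon>_def)
  have e6: "r + 6 * \<epsilon> \<le> 1" using n by (simp add: \<epsilon>_def \<eta>_def)
  have eM: "M * (2 * \<epsilon>) \<le> 1"
  proof -
    have "\<epsilon> \<le> 1 / (2 * (M + 1))" using n by (simp add: \<epsilon>_def \<eta>_def)
    hence "2 * \<epsilon> * (M + 1) \<le> 1" using M by (simp add: field_simps)
    thus ?thesis using e by (simp add: algebra_simps)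
  qed
  define N where "N = (2::nat)^(Suc n)"
  have eN: "2 = \<epsilon> * real N" by (simp add: \<epsilon>_def N_def power_one_over)
  define y where "y = grid_point \<epsilon>"
  define I where "I = {X \<in> {..<N} \<times> {..<N}. norm (y X) \<le> 1 - 4 * \<epsilon>}"
  have fin: "finite I" by (simp add: I_def)
  have yI: "norm (y X) < 1" "\<epsilon> \<le> inradius (y X)" if "X \<in> I" for X
    using that e by (auto simp: I_def inradius_def)
  define S where "S = (\<Sum>X\<in>I. exp (u (y X)))"
  \<comment> \<open>A Riemann sum for the integral of \<open>exp u\<close>.\<close>
  define T where "T = S * \<epsilon>\<^sup>2"
  have S0: "S \<ge> 0" unfolding S_def by (intro sum_nonneg) auto
  have mass: "?Z \<le> pi + 4 * pi * exp 1 * T" and Zpos: "?Z > 0"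
  proof -
    let ?B = "\<lambda>X. indicator (ball (y X) (2 * \<epsilon>)) :: plane \<Rightarrow> real"
    have iZ: "integrable lborel (\<lambda>x. indicator disc x * exp (u x))" by (rule integrable_exp_Cc[OF uc])
    \<comment> \<open>Where \<open>u\<close> vanishes the integrand is 1 and the indicator of the
      disc suffices. Elsewhere some grid point is closer than \<open>2 * \<epsilon>\<close>, and the
      oscillation bound costs a factor e.\<close>
    have "?Z \<le> (LINT x|lborel. indicator disc x + (\<Sum>X\<in>I. exp (u (y X) + 1) * ?B X x))"
    proof (rule integral_mono[OF iZ])
      show "integrable lborel (\<lambda>x. indicator disc x + (\<Sum>X\<in>I. exp (u (y X) + 1) * ?B X x))"
        by (intro Bochner_Integration.integrable_add Bochner_Integration.integrable_sum integrable_mult_right integrable_indicator_ball)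
      fix x
      show "indicator disc x * exp (u x) \<le> indicator disc x + (\<Sum>X\<in>I. exp (u (y X) + 1) * ?B X x)"
      proof (cases "x \<in> disc \<and> norm x < r")
        case False
        have "indicator disc x * exp (u x) \<le> indicator disc x" using False r(2)[of x] by (auto simp: indicator_def)
        moreover have "(\<Sum>X\<in>I. exp (u (y X) + 1) * ?B X x) \<ge> 0" by (intro sum_nonneg) auto
        ultimately show ?thesis by linarith
      next
        case True
        then obtain X where X: "X \<in> {..<N} \<times> {..<N}" "norm (x - y X) < 2 * \<epsilon>"
          using grid_point_near[OF e eN, of x] unfolding y_def by auto
        have "norm (y X) \<le> norm x + norm (x - y X)" using norm_triangle_sub[of "y X" x] by (simp add: norm_minus_commute)
        hence XI: "X \<in> I" using X True e6 by (simp add: I_def)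
        have "u x \<le> u (y X) + 1"
        proof -
          have "M * norm (x - y X) \<le> M * (2 * \<epsilon>)" using X M by (intro mult_left_mono) auto
          thus ?thesis using lip[of x "y X"] eM by linarith
        qed
        hence "exp (u x) \<le> exp (u (y X) + 1) * ?B X x"
          using X by (simp add: dist_norm norm_minus_commute)
        also have "\<dots> \<le> (\<Sum>X\<in>I. exp (u (y X) + 1) * ?B X x)"
          using XI fin by (intro member_le_sum) auto
        finally show ?thesis using True by (simp add: indicator_def)
      qed
    qed
    also have "\<dots> = (LINT x|lborel. indicator disc x) + (\<Sum>X\<in>I. LINT x|lborel. exp (u (y X) + 1) * ?B X x)"
      by (subst Bochner_Integration.integral_add; (subst Bochner_Integration.integral_sum)?;
          intro refl Bochner_Integration.integrable_sum integrable_mult_right integrable_indicator_ball)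
    also have "\<dots> = pi + (\<Sum>X\<in>I. exp (u (y X) + 1) * (pi * (2 * \<epsilon>)\<^sup>2))"
      using lborel_ball_plane[of 1 0] lborel_ball_plane[of "2 * \<epsilon>"] e by simp
    also have "(\<Sum>X\<in>I. exp (u (y X) + 1) * (pi * (2 * \<epsilon>)\<^sup>2)) = 4 * pi * exp 1 * T"
      unfolding T_def S_def sum_distrib_left sum_distrib_right
      by (intro sum.cong refl) (simp add: exp_add power2_eq_square)
    finally show "?Z \<le> pi + 4 * pi * exp 1 * T" .
    have "?Z \<noteq> 0"
    proof
      assume "?Z = 0"
      hence "AE x in lborel. indicator disc x * exp (u x) = 0"
        using integral_nonneg_eq_0_iff_AE[OF iZ] by auto
      hence "AE x in lborel. indicator disc x = (0::real)" by (rule AE_mp) (auto intro!: AE_I2)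
      hence "(LINT x|lborel. indicator disc x) = (0::real)" by (rule integral_eq_zero_AE)
      thus False using lborel_ball_plane[of 1 0] by simp
    qed
    moreover have "?Z \<ge> 0" by (intro Bochner_Integration.integral_nonneg) auto
    ultimately show "?Z > 0" by linarith
  qed
  show "?Q - 16 * pi * ln ?Z \<ge> - (C1 + 16 * pi * ln K + 16 * pi * 41)"
  \<comment> \<open>If the Riemann sum is small, the integral is bounded and nonnegativity of the
    quadratic form is enough. Otherwise the contribution pi of the region without grid points is at
    most \<open>pi * T\<close>, so that \<open>?Z \<le> K * T\<close>.\<close>
  proof (cases "T \<ge> 1")
    case False
    have "4 * pi * exp 1 * T \<le> 4 * pi * exp 1 * 1" using False by (intro mult_left_mono) auto
    hence "?Z \<le> K" using mass unfolding K_def mult_1_right by linarith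
    hence "ln ?Z \<le> ln K" using Zpos by (intro ln_mono)
    hence "16 * pi * ln ?Z \<le> 16 * pi * ln K" by (intro mult_left_mono) auto
    thus ?thesis using Q0 C1 pi_gt_zero by linarith
  next
    case True
    hence I: "I \<noteq> {}" by (auto simp: T_def S_def)
    have T0: "T > 0" using True by linarith
    have S1: "S > 0" using T0 S0 by (auto simp: T_def zero_less_mult_iff)
    define q where "q X = exp (u (y X)) / S" for X
    have q0: "q X \<ge> 0" for X using S1 by (simp add: q_def)
    have q1: "(\<Sum>X\<in>I. q X) = 1" unfolding q_def S_def by (rule gibbs_sum(1)[OF fin I])
    have ent: "(\<Sum>X\<in>I. q X * ln (q X)) = (\<Sum>X\<in>I. q X * u (y X)) - ln S"
      unfolding q_def S_def by (rule gibbs_sum(2)[OF fin I])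
    define D where "D X Y = max 1 (\<bar>real (fst X) - real (fst Y)\<bar> + \<bar>real (snd X) - real (snd Y)\<bar>)" for X Y :: "nat \<times> nat"
    have hls: "(\<Sum>X\<in>I. \<Sum>Y\<in>I. q X * q Y * (2 * ln (2^Suc n / D X Y))) \<le> (\<Sum>X\<in>I. q X * ln (q X)) + real (Suc n) * ln 4 + 35"
      unfolding D_def by (rule discrete_log_HLS[OF fin q0 q1]) (auto simp: I_def N_def inj_on_def)
    have pair: "32 * pi * (\<Sum>X\<in>I. \<Sum>Y\<in>I. q X * q Y * (3/2 + ln (1 / max \<epsilon> (norm (y X - y Y)))))
        \<le> 48 * pi + 16 * pi * (\<Sum>X\<in>I. \<Sum>Y\<in>I. q X * q Y * (2 * ln (2^Suc n / D X Y)))"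
    proof -
      have "q X * q Y * (3/2 + ln (1 / max \<epsilon> (norm (y X - y Y)))) \<le> 3/2 * (q X * q Y) + 1/2 * (q X * q Y * (2 * ln (2^Suc n / D X Y)))" for X Y
      proof -
        have m: "\<epsilon> / 2 * D X Y \<le> max \<epsilon> (norm (y X - y Y))"
          unfolding D_def y_def by (rule grid_point_dist[OF e])
        have D: "D X Y \<ge> 1" by (simp add: D_def)
        have d0: "\<epsilon> / 2 * D X Y > 0" using e D by (intro mult_pos_pos) auto
        have "1 / max \<epsilon> (norm (y X - y Y)) \<le> 1 / (\<epsilon> / 2 * D X Y)" by (rule frac_le[OF zero_le_one order_refl d0 m])
        also have "\<dots> = 2^Suc n / D X Y" using D by (simp add: \<epsilon>_def power_one_over field_simps)
        finally have "ln (1 / max \<epsilon> (norm (y X - y Y))) \<le> ln (2^Suc n / D X Y)" 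
          using order_less_le_trans[OF d0 m] by (intro ln_mono) (simp_all only: zero_less_divide_1_iff)
        hence "q X * q Y * (3/2 + ln (1 / max \<epsilon> (norm (y X - y Y)))) \<le> q X * q Y * (3/2 + ln (2^Suc n / D X Y))"
          using q0 by (intro mult_left_mono add_left_mono mult_nonneg_nonneg)
        also have "\<dots> = 3/2 * (q X * q Y) + 1/2 * (q X * q Y * (2 * ln (2^Suc n / D X Y)))" by (simp add: distrib_left)
        finally show ?thesis .
      qed
      hence "(\<Sum>X\<in>I. \<Sum>Y\<in>I. q X * q Y * (3/2 + ln (1 / max \<epsilon> (norm (y X - y Y))))) \<le>
         (\<Sum>X\<in>I. \<Sum>Y\<in>I. 3/2 * (q X * q Y) + 1/2 * (q X * q Y * (2 * ln (2^Suc n / D X Y))))"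
        by (intro sum_mono)
      also have "\<dots> = 3/2 * ((\<Sum>X\<in>I. q X) * (\<Sum>Y\<in>I. q Y)) + 1/2 * (\<Sum>X\<in>I. \<Sum>Y\<in>I. q X * q Y * (2 * ln (2^Suc n / D X Y)))"
        unfolding sum_product by (simp only: sum.distrib sum_distrib_left)
      finally have "(\<Sum>X\<in>I. \<Sum>Y\<in>I. q X * q Y * (3/2 + ln (1 / max \<epsilon> (norm (y X - y Y))))) \<le>
         3/2 + 1/2 * (\<Sum>X\<in>I. \<Sum>Y\<in>I. q X * q Y * (2 * ln (2^Suc n / D X Y)))" unfolding q1 by simp
      hence "32 * pi * (\<Sum>X\<in>I. \<Sum>Y\<in>I. q X * q Y * (3/2 + ln (1 / max \<epsilon> (norm (y X - y Y))))) \<le>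
         32 * pi * (3/2 + 1/2 * (\<Sum>X\<in>I. \<Sum>Y\<in>I. q X * q Y * (2 * ln (2^Suc n / D X Y))))"
        by (intro mult_left_mono) auto
      also have "32 * pi * (3/2 + 1/2 * a) = 48 * pi + 16 * pi * a" for a by (simp add: algebra_simps)
      finally show ?thesis .
    qed
    have avg: "(\<Sum>X\<in>I. q X * ball_avg \<epsilon> (y X) u) \<ge> (\<Sum>X\<in>I. q X * u (y X)) - 1"
    proof -
      have "ball_avg \<epsilon> (y X) u \<ge> u (y X) - 1" for X
      proof (rule ball_avg_ge_const[OF uc e])
        fix x assume "x \<in> ball (y X) \<epsilon>"
        hence "M * norm (x - y X) \<le> M * (2 * \<epsilon>)" using M e by (intro mult_left_mono) (auto simp: dist_norm norm_minus_commute)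
        thus "u (y X) - 1 \<le> u x" using lip[of x "y X"] eM by linarith
      qed
      hence "(\<Sum>X\<in>I. q X * (u (y X) - 1)) \<le> (\<Sum>X\<in>I. q X * ball_avg \<epsilon> (y X) u)"
        using q0 by (intro sum_mono mult_left_mono)
      moreover have "(\<Sum>X\<in>I. q X * (u (y X) - 1)) = (\<Sum>X\<in>I. q X * u (y X)) - 1"
        using q1 by (simp add: right_diff_distrib sum_subtractf)
      ultimately show ?thesis by simp
    qed
    define s where "s = (\<Sum>X\<in>I. q X * u (y X))"
    have Q1: "?Q \<ge> 16 * pi * (\<Sum>X\<in>I. q X * ball_avg \<epsilon> (y X) u)
       - 32 * pi * (\<Sum>X\<in>I. \<Sum>Y\<in>I. q X * q Y * (3/2 + ln (1 / max \<epsilon> (norm (y X - y Y))))) - C1"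
      unfolding C1_def
      by (rule point_mass_energy_bound[OF alpha delta coercive u fin q0 q1 yI(1) e yI(2)])
    have "16 * pi * (\<Sum>X\<in>I. q X * ball_avg \<epsilon> (y X) u) \<ge> 16 * pi * (s - 1)"
      using avg unfolding s_def by (intro mult_left_mono) auto
    moreover have "16 * pi * (\<Sum>X\<in>I. \<Sum>Y\<in>I. q X * q Y * (2 * ln (2^Suc n / D X Y))) \<le> 16 * pi * (s - ln S + real (Suc n) * ln 4 + 35)"
      using hls unfolding ent s_def by (intro mult_left_mono) auto
    ultimately have "?Q \<ge> 16 * pi * (s - 1) - (48 * pi + 16 * pi * (s - ln S + real (Suc n) * ln 4 + 35)) - C1"
      using Q1 pair by linarith
    also have "16 * pi * (s - 1) - (48 * pi + 16 * pi * (s - ln S + real (Suc n) * ln 4 + 35)) - C1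
       = 16 * pi * (ln S - real n * ln 4) - 16 * pi * (39 + ln 4) - C1"
      by (simp add: algebra_simps)
    \<comment> \<open>The \<open>n * ln 4\<close> from the levels of the tree is exactly the
      logarithm of the inverse cell area; this makes the constant independent of the mesh.\<close>
    also have "ln S - real n * ln 4 = ln T"
    proof -
      have "\<epsilon>\<^sup>2 = ((1/2)\<^sup>2)^n" unfolding \<epsilon>_def by (simp only: power_mult[symmetric] mult.commute)
      hence "\<epsilon>\<^sup>2 = 1 / 4^n" by (simp add: power2_eq_square power_one_over)
      hence "T = S / 4^n" by (simp add: T_def)
      thus ?thesis using S1 by (simp add: ln_divide_pos ln_realpow)
    qed
    finally have Q2: "?Q \<ge> 16 * pi * ln T - 16 * pi * (39 + ln 4) - C1" .
    have "?Z \<le> K * T"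
    proof -
      have "pi * 1 \<le> pi * T" using True by (intro mult_left_mono) auto
      thus ?thesis using mass unfolding K_def distrib_right mult_1_right by linarith
    qed
    hence "ln ?Z \<le> ln (K * T)" using Zpos by (intro ln_mono)
    also have "\<dots> = ln K + ln T" using K T0 by (intro ln_mult_pos) auto
    finally have "16 * pi * ln ?Z \<le> 16 * pi * (ln K + ln T)" by (intro mult_left_mono) auto
    \<comment> \<open>39 collects 35 from the kernel inequality, 3 from the pair energies and 1 from
      replacing averages by values; \<open>ln 4\<close> is the level by which the side 2 of the
      square exceeds 1.\<close>
    moreover have "16 * pi * (39 + ln 4) \<le> 16 * pi * 41"
    proof (intro mult_left_mono)
      have "ln (4::real) = 2 * ln 2" using ln_realpow[of 2 2] by simp
      thus "39 + ln 4 \<le> (41::real)" using ln2_le_25_over_36 by simp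
    qed auto
    ultimately show ?thesis using Q2 by (simp only: distrib_left)
  qed
qed

section \<open>Test functions and the first eigenvalue\<close>

lemma smooth_differentiable: "smooth f \<Longrightarrow> f differentiable (at x)"
  unfolding smooth_def by (metis foldr_Nil id_apply)

lemma smooth_partial: "smooth f \<Longrightarrow> smooth (partial i f)"
proof -
  assume f: "smooth f"
  have "foldr partial ks (partial i f) = foldr partial (ks @ [i]) f" for ks by simp
  thus ?thesis using f unfolding smooth_def by metis
qed

text \<open>Smoothness is defined through iterated partial derivatives, so exhibiting a class of
  differentiable functions stable under \<open>partial\<close> replaces any computation of higher
  derivatives.\<close>

lemma smooth_coinduct:
  assumes "f \<in> S" "\<And>g x. g \<in> S \<Longrightarrow> g differentiable (at x)" "\<And>g i. g \<in> S \<Longrightarrow> partial i g \<in> S"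
  shows "smooth f"
proof -
  have "foldr partial ks f \<in> S" for ks by (induction ks) (auto simp: assms)
  thus ?thesis unfolding smooth_def using assms(2) by blast
qed

lemma partial_eq:
  assumes "(f has_derivative (\<lambda>h. G \<bullet> h)) (at x)"
  shows "partial i f x = G $ i"
  using frechet_derivative_at[OF assms, symmetric] by (simp add: partial_def inner_axis)

lemma grad_eq:
  assumes "(f has_derivative (\<lambda>h. G \<bullet> h)) (at x)"
  shows "grad f x = G"
  by (simp add: grad_def partial_eq[OF assms] vec_eq_iff)

lemma C1c_grad_eq: "C1c f G \<Longrightarrow> grad f = G"
  using grad_eq[OF C1c_der] by (intro ext)

lemma has_derivative_grad:
  assumes "f differentiable (at x)"
  shows "(f has_derivative (\<lambda>h. grad f x \<bullet> h)) (at x)"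
proof -
  have d: "(f has_derivative frechet_derivative f (at x)) (at x)"
    using assms frechet_derivative_works by blast
  have lin: "linear (frechet_derivative f (at x))" using d by (rule has_derivative_linear)
  have "frechet_derivative f (at x) = (\<lambda>h. grad f x \<bullet> h)"
  proof
    fix h
    have "frechet_derivative f (at x) h = frechet_derivative f (at x) (\<Sum>i\<in>UNIV. h $ i *\<^sub>R axis i 1)"
      using basis_expansion[of h] by (simp add: scalar_mult_eq_scaleR)
    also have "\<dots> = (\<Sum>i\<in>UNIV. h $ i * frechet_derivative f (at x) (axis i 1))"
      using lin by (simp add: linear_sum linear_scale)
    finally show "frechet_derivative f (at x) h = grad f x \<bullet> h" by (simp add: inner_vec_def grad_def partial_def mult.commute)
  qed
  thus ?thesis using d by simp
qed

lemma smooth_continuous: "smooth f \<Longrightarrow> continuous_on UNIV f"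
  by (intro continuous_at_imp_continuous_on ballI differentiable_imp_continuous_within smooth_differentiable)

lemma smooth_continuous_grad: "smooth f \<Longrightarrow> continuous_on UNIV (grad f)"
  unfolding grad_def[abs_def] by (intro continuous_on_vec_lambda smooth_continuous smooth_partial)

lemma C1c_if_smooth:
  assumes "smooth f" "r < 1" "\<And>x. norm x > r \<Longrightarrow> f x = 0"
  shows "C1c f (grad f)"
proof -
  \<comment> \<open>The gradient is seen to vanish on the open set where \<open>norm x > r\<close>;
    a slightly larger radius gives the closed condition of \<open>C1c\<close>.\<close>
  obtain s where s: "r < s" "s < 1" using dense[OF assms(2)] by blast
  have "grad f x = 0" if "norm x \<ge> s" for x
  proof (rule grad_eq)
    have "open {x::plane. r < norm x}" by (intro open_Collect_less continuous_intros)
    hence "(f has_derivative (\<lambda>h. 0)) (at x)"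
      by (rule has_derivative_transform_within_open[OF has_derivative_const[of 0]]) (use that s assms(3) in auto)
    thus "(f has_derivative (\<lambda>h. 0 \<bullet> h)) (at x)" by simp
  qed
  thus ?thesis unfolding C1c_def using s assms(3)
    by (auto intro!: has_derivative_grad smooth_differentiable smooth_continuous_grad assms(1) exI[of _ s])
qed

text \<open>Compactness of the support turns its inclusion in the open disc into a positive distance
  from the circle.\<close>

lemma test_function_support:
  assumes "f \<in> test_functions"
  obtains r where "r < 1" "\<And>x. norm x > r \<Longrightarrow> f x = 0"
proof -
  let ?S = "closure {x. f x \<noteq> 0}"
  have sub: "?S \<subseteq> disc" using assms by (simp add: test_functions_def)
  hence "bounded ?S" using bounded_ball bounded_subset by blast
  hence comp: "compact ?S" by (simp add: compact_eq_bounded_closed)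
  show ?thesis
  proof (cases "?S = {}")
    case True
    hence "{x. f x \<noteq> 0} = {}" using closure_subset[of "{x. f x \<noteq> 0}"] by blast
    thus ?thesis using that[of 0] by auto
  next
    case False
    have "continuous_on ?S norm" by (intro continuous_intros)
    from continuous_attains_sup[OF comp False this] obtain m where m: "m \<in> ?S" "\<And>x. x \<in> ?S \<Longrightarrow> norm x \<le> norm m" by blast
    show ?thesis
    proof (rule that[of "norm m"])
      show "norm m < 1" using m(1) sub by auto
      show "f x = 0" if "norm x > norm m" for x
        using m(2)[of x] that closure_subset[of "{x. f x \<noteq> 0}"] by fastforce
    qed
  qed
qed

lemma test_function_C1c:
  assumes "f \<in> test_functions"
  shows "C1c f (grad f)"
proof -
  obtain r where "r < 1" "\<And>x. norm x > r \<Longrightarrow> f x = 0" using test_function_support[OF assms] by metis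
  thus ?thesis using assms by (intro C1c_if_smooth) (auto simp: test_functions_def)
qed

lemma test_functionI:
  assumes "smooth f" "r < 1" "\<And>x. norm x > r \<Longrightarrow> f x = 0"
  shows "f \<in> test_functions"
proof -
  have "\<not> r < norm x" if "f x \<noteq> 0" for x using assms(3) that by blast
  hence "closure {x. f x \<noteq> 0} \<subseteq> cball 0 r" by (intro closure_minimal) (auto simp: not_less)
  also have "\<dots> \<subseteq> disc" using assms(2) by auto
  finally show ?thesis using assms(1) by (simp add: test_functions_def)
qed

lemma partial_test_function:
  assumes "f \<in> test_functions"
  shows "partial i f \<in> test_functions"
proof -
  obtain r where r: "r < 1" "\<And>x. r \<le> norm x \<Longrightarrow> grad f x = 0"
    using test_function_C1c[OF assms] unfolding C1c_def by blast
  have "partial i f x = grad f x $ i" for x by (simp add: grad_def)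
  hence "partial i f x = 0" if "norm x > r" for x using r(2)[of x] that by simp
  thus ?thesis using assms r(1) by (intro test_functionI smooth_partial) (auto simp: test_functions_def)
qed

lemma partial_diff:
  assumes "f differentiable (at x)" "g differentiable (at x)"
  shows "partial i (\<lambda>x. f x - g x) x = partial i f x - partial i g x"
proof -
  have "((\<lambda>x. f x - g x) has_derivative (\<lambda>h. (grad f x - grad g x) \<bullet> h)) (at x)"
    using has_derivative_diff[OF has_derivative_grad[OF assms(1)] has_derivative_grad[OF assms(2)]]
    by (simp add: inner_diff_left)
  from partial_eq[OF this] show ?thesis by (simp add: grad_def)
qed

lemma smooth_diff: "smooth f \<Longrightarrow> smooth g \<Longrightarrow> smooth (\<lambda>x. f x - g x)"
proof -
  assume fg: "smooth f" "smooth g"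
  show ?thesis
  proof (rule smooth_coinduct[where S = "{\<lambda>x. f x - g x | f g. smooth f \<and> smooth g}"])
    show "(\<lambda>x. f x - g x) \<in> {\<lambda>x. f x - g x | f g. smooth f \<and> smooth g}" using fg by blast
    show "h differentiable (at x)" if "h \<in> {\<lambda>x. f x - g x | f g. smooth f \<and> smooth g}" for h x
    proof -
      obtain f g where h: "h = (\<lambda>x. f x - g x)" "smooth f" "smooth g" using \<open>h \<in> _\<close> by blast
      thus ?thesis unfolding h(1) by (intro differentiable_diff smooth_differentiable)
    qed
    show "partial i h \<in> {\<lambda>x. f x - g x | f g. smooth f \<and> smooth g}"
      if "h \<in> {\<lambda>x. f x - g x | f g. smooth f \<and> smooth g}" for h i
    proof -
      obtain f g where h: "h = (\<lambda>x. f x - g x)" "smooth f" "smooth g" using \<open>h \<in> _\<close> by blast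
      have "partial i h = (\<lambda>x. partial i f x - partial i g x)"
        unfolding h(1) by (intro ext partial_diff smooth_differentiable h)
      thus ?thesis using smooth_partial h by blast
    qed
  qed
qed

lemma test_function_diff:
  assumes "f \<in> test_functions" "g \<in> test_functions"
  shows "(\<lambda>x. f x - g x) \<in> test_functions"
proof -
  obtain r where r: "r < 1" "\<And>x. norm x > r \<Longrightarrow> f x = 0" using test_function_support[OF assms(1)] by metis
  obtain s where s: "s < 1" "\<And>x. norm x > s \<Longrightarrow> g x = 0" using test_function_support[OF assms(2)] by metis
  show ?thesis
    by (rule test_functionI[of _ "max r s"]) (use r s assms in \<open>auto simp: test_functions_def intro: smooth_diff\<close>)
qed

text \<open>Bridge between the completed measure restricted to the disc, in which the spaces are
  defined, and \<open>lborel\<close>, where translation invariance is used. Borel measurability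
  makes the completion harmless.\<close>

lemma disc_measure_integral:
  fixes f :: "plane \<Rightarrow> real"
  assumes "f \<in> borel_measurable borel"
  shows "(LINT x|disc_measure. f x) = (LINT x|lborel. indicator disc x * f x)"
    and "integrable disc_measure f \<longleftrightarrow> integrable lborel (\<lambda>x. indicator disc x * f x)"
proof -
  have m: "(\<lambda>x. indicator disc x * f x) \<in> borel_measurable lborel"
    using assms by (intro borel_measurable_times borel_measurable_indicator) auto
  have "(LINT x|disc_measure. f x) = (LINT x|lebesgue. indicator disc x *\<^sub>R f x)"
    by (rule integral_restrict_space) auto
  also have "\<dots> = (LINT x|lborel. indicator disc x * f x)"
    using integral_completion[OF m] by simp
  finally show "(LINT x|disc_measure. f x) = (LINT x|lborel. indicator disc x * f x)" .
  have "integrable disc_measure f \<longleftrightarrow> integrable lebesgue (\<lambda>x. indicator disc x *\<^sub>R f x)"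
    by (rule integrable_restrict_space) auto
  also have "\<dots> \<longleftrightarrow> integrable lborel (\<lambda>x. indicator disc x * f x)"
    using integrable_completion[OF m] by simp
  finally show "integrable disc_measure f \<longleftrightarrow> integrable lborel (\<lambda>x. indicator disc x * f x)" .
qed

lemma Cc_indicator_disc: "Cc f \<Longrightarrow> indicator disc x * f x = f x"
  unfolding Cc_def by (auto simp: indicator_def)

lemma Cc_disc_integral: "Cc f \<Longrightarrow> (LINT x|disc_measure. f x) = (LINT x|lborel. f x)"
  and Cc_disc_integrable: "Cc f \<Longrightarrow> integrable disc_measure f"
  using disc_measure_integral[OF Cc_measurable, of f] Cc_indicator_disc[of f] Cc_integrable[of f] by auto

lemma test_norm_eq:
  assumes "f \<in> test_functions"
  shows "test_norm f = sqrt (dirichlet (grad f) - hardy f)"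
proof -
  have f: "C1c f (grad f)" by (rule test_function_C1c[OF assms])
  show ?thesis unfolding test_norm_def dirichlet_def hardy_def
    Cc_disc_integral[OF C1c_Cc_norm[OF f]] Cc_disc_integral[OF Cc_hardy[OF Cc_power2[OF C1c_Cc[OF f]]]] ..
qed

lemma test_norm_sq:
  assumes "f \<in> test_functions"
  shows "(test_norm f)\<^sup>2 = dirichlet (grad f) - hardy f"
  unfolding test_norm_eq[OF assms] using hardy_le_dirichlet[OF test_function_C1c[OF assms]] by simp

lemma Lp_norm_2_sq:
  assumes "Cc f"
  shows "(Lp_norm 2 f)\<^sup>2 = (LINT x|lborel. (f x)\<^sup>2)"
proof -
  have e: "\<bar>f x\<bar> powr 2 = (f x)\<^sup>2" for x by (simp add: powr_numeral)
  have "Lp_norm 2 f = sqrt (LINT x|lborel. (f x)\<^sup>2)"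
    unfolding Lp_norm_def e Cc_disc_integral[OF Cc_power2[OF assms]] by (simp add: powr_half_sqrt)
  thus ?thesis by simp
qed

section \<open>Closability of the Hardy form\<close>

definition hardy_form :: "(plane \<Rightarrow> real) \<Rightarrow> (plane \<Rightarrow> plane) \<Rightarrow> (plane \<Rightarrow> real) \<Rightarrow> (plane \<Rightarrow> plane) \<Rightarrow> real" where
  "hardy_form f F g G = (LINT x|lborel. F x \<bullet> G x) - (LINT x|lborel. f x * g x / (1 - (norm x)\<^sup>2)\<^sup>2)"

lemma hardy_form_add:
  assumes f: "C1c f F" and g: "C1c g G"
  shows "dirichlet (\<lambda>x. F x + G x) - hardy (\<lambda>x. f x + g x) =
     (dirichlet F - hardy f) + 2 * hardy_form f F g G + (dirichlet G - hardy g)"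
proof -
  have i: "integrable lborel (\<lambda>x. (norm (F x))\<^sup>2)" "integrable lborel (\<lambda>x. 2 * (F x \<bullet> G x))" "integrable lborel (\<lambda>x. (norm (G x))\<^sup>2)"
    by (intro Cc_integrable C1c_Cc_norm[OF f] C1c_Cc_norm[OF g] Cc_cmult C1c_Cc_grad_inner[OF f] C1c_cont_grad[OF g])+
  have "(\<lambda>x. (norm (F x + G x))\<^sup>2) = (\<lambda>x. (norm (F x))\<^sup>2 + 2 * (F x \<bullet> G x) + (norm (G x))\<^sup>2)"
    unfolding power2_norm_eq_inner by (auto simp: inner_add_left inner_add_right inner_commute)
  hence D: "dirichlet (\<lambda>x. F x + G x) = dirichlet F + 2 * (LINT x|lborel. F x \<bullet> G x) + dirichlet G"
    unfolding dirichlet_def using i by simp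
  have j: "integrable lborel (\<lambda>x. (f x)\<^sup>2 / (1 - (norm x)\<^sup>2)\<^sup>2)" "integrable lborel (\<lambda>x. 2 * (f x * g x / (1 - (norm x)\<^sup>2)\<^sup>2))"
     "integrable lborel (\<lambda>x. (g x)\<^sup>2 / (1 - (norm x)\<^sup>2)\<^sup>2)"
    by (intro Cc_integrable Cc_cmult Cc_hardy Cc_power2 Cc_mult C1c_Cc[OF f] C1c_Cc[OF g])+
  have "(\<lambda>x. (f x + g x)\<^sup>2 / (1 - (norm x)\<^sup>2)\<^sup>2) = (\<lambda>x. (f x)\<^sup>2 / (1 - (norm x)\<^sup>2)\<^sup>2 + 2 * (f x * g x / (1 - (norm x)\<^sup>2)\<^sup>2) + (g x)\<^sup>2 / (1 - (norm x)\<^sup>2)\<^sup>2)"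
    by (simp add: power2_sum add_divide_distrib algebra_simps)
  hence H: "hardy (\<lambda>x. f x + g x) = hardy f + 2 * (LINT x|lborel. f x * g x / (1 - (norm x)\<^sup>2)\<^sup>2) + hardy g"
    unfolding hardy_def
    by (simp only: Bochner_Integration.integral_add[OF Bochner_Integration.integrable_add[OF j(1) j(2)] j(3)]
         Bochner_Integration.integral_add[OF j(1) j(2)] integral_mult_right_zero)
  show ?thesis unfolding D H hardy_form_def by simp
qed

lemma hardy_form_minus_right: "hardy_form f F (\<lambda>x. - g x) (\<lambda>x. - G x) = - hardy_form f F g G"
  unfolding hardy_form_def by simp

lemma energy_minus: "dirichlet (\<lambda>x. - G x) - hardy (\<lambda>x. - g x) = dirichlet G - hardy g"
  unfolding dirichlet_def hardy_def by simp

text \<open>Integration by parts moves all derivatives to the test function: \<open>h\<close> is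
  minus its Laplacian minus the Hardy potential times it. Against a fixed test function the form is
  therefore continuous in L^2.\<close>

lemma hardy_form_weak:
  assumes \<eta>: "\<eta> \<in> test_functions"
  obtains h where "Cc h" "\<And>f F. C1c f F \<Longrightarrow> hardy_form f F \<eta> (grad \<eta>) = (LINT x|lborel. f x * h x)"
proof -
  define h where "h x = - (\<Sum>i\<in>UNIV. partial i (partial i \<eta>) x) - \<eta> x / (1 - (norm x)\<^sup>2)\<^sup>2" for x
  have e: "C1c \<eta> (grad \<eta>)" by (rule test_function_C1c[OF \<eta>])
  have p: "C1c (partial i \<eta>) (grad (partial i \<eta>))" "Cc (partial i (partial i \<eta>))" for i
    using \<eta> by (auto intro: test_function_C1c partial_test_function C1c_Cc)
  have hc: "Cc h" unfolding h_def[abs_def]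
    using Cc_cmult[OF Cc_sum[OF p(2)], of "-1"] by (intro Cc_diff Cc_hardy C1c_Cc[OF e]) simp
  show ?thesis
  proof (rule that[OF hc])
    fix f F assume f: "C1c f F"
    have fc: "Cc f" by (rule C1c_Cc[OF f])
    have Fi: "Cc (\<lambda>x. F x $ i)" for i by (rule C1c_Cc_component[OF f])
    have ibp: "(LINT x|lborel. F x $ i * partial i \<eta> x) = - (LINT x|lborel. f x * partial i (partial i \<eta>) x)" for i
    proof -
      have "(LINT x|lborel. (partial i \<eta> x *\<^sub>R F x + f x *\<^sub>R grad (partial i \<eta>) x) \<bullet> axis i 1) = 0"
        by (rule C1c_integral_grad[OF C1c_mult[OF f p(1)]])
      also have "(\<lambda>x. (partial i \<eta> x *\<^sub>R F x + f x *\<^sub>R grad (partial i \<eta>) x) \<bullet> axis i 1)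
         = (\<lambda>x. F x $ i * partial i \<eta> x + f x * partial i (partial i \<eta>) x)"
        by (auto simp: inner_axis grad_def)
      also have "(LINT x|lborel. F x $ i * partial i \<eta> x + f x * partial i (partial i \<eta>) x)
        = (LINT x|lborel. F x $ i * partial i \<eta> x) + (LINT x|lborel. f x * partial i (partial i \<eta>) x)"
        by (intro Bochner_Integration.integral_add Cc_integrable Cc_mult Fi C1c_Cc[OF p(1)] fc p(2))
      finally show ?thesis by simp
    qed
    have "(LINT x|lborel. F x \<bullet> grad \<eta> x) = (LINT x|lborel. (\<Sum>i\<in>UNIV. F x $ i * partial i \<eta> x))"
      by (simp add: inner_vec_def grad_def)
    also have "\<dots> = (\<Sum>i\<in>UNIV. LINT x|lborel. F x $ i * partial i \<eta> x)"
      by (intro Bochner_Integration.integral_sum Cc_integrable Cc_mult Fi C1c_Cc[OF p(1)])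
    also have "\<dots> = - (\<Sum>i\<in>UNIV. LINT x|lborel. f x * partial i (partial i \<eta>) x)" by (simp add: ibp sum_negf)
    also have "(\<Sum>i\<in>UNIV. LINT x|lborel. f x * partial i (partial i \<eta>) x) = (LINT x|lborel. (\<Sum>i\<in>UNIV. f x * partial i (partial i \<eta>) x))"
      by (intro Bochner_Integration.integral_sum[symmetric] Cc_integrable Cc_mult fc p(2))
    finally have 1: "(LINT x|lborel. F x \<bullet> grad \<eta> x) = - (LINT x|lborel. f x * (\<Sum>i\<in>UNIV. partial i (partial i \<eta>) x))"
      by (simp add: sum_distrib_left)
    have i: "integrable lborel (\<lambda>x. f x * (\<Sum>i\<in>UNIV. partial i (partial i \<eta>) x))" "integrable lborel (\<lambda>x. f x * \<eta> x / (1 - (norm x)\<^sup>2)\<^sup>2)"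
      by (intro Cc_integrable Cc_mult Cc_hardy Cc_sum fc p(2) C1c_Cc[OF e])+
    have "(\<lambda>x. f x * h x) = (\<lambda>x. - (f x * (\<Sum>i\<in>UNIV. partial i (partial i \<eta>) x)) - f x * \<eta> x / (1 - (norm x)\<^sup>2)\<^sup>2)"
      by (simp add: h_def algebra_simps)
    thus "hardy_form f F \<eta> (grad \<eta>) = (LINT x|lborel. f x * h x)"
      unfolding hardy_form_def 1 using i by simp
  qed
qed

text \<open>Cauchy-Schwarz in the form of Young's inequality with a weight \<open>t\<close> small
  enough that the fixed factor \<open>h\<close> contributes at most half of the tolerance.\<close>

lemma integral_mult_tendsto_0:
  fixes f :: "nat \<Rightarrow> plane \<Rightarrow> real"
  assumes f: "\<And>n. Cc (f n)" and h: "Cc h" and lim: "(\<lambda>n. LINT x|lborel. (f n x)\<^sup>2) \<longlonglongrightarrow> 0"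
  shows "(\<lambda>n. LINT x|lborel. f n x * h x) \<longlonglongrightarrow> 0"
proof (rule LIMSEQ_I)
  fix e :: real assume e: "e > 0"
  define H where "H = (LINT x|lborel. (h x)\<^sup>2)"
  have H: "H \<ge> 0" by (simp add: H_def)
  define t where "t = e / (H + 1)"
  have t: "t > 0" "t * H \<le> e" using e H by (auto simp: t_def field_simps)
  obtain N where N: "\<And>n. n \<ge> N \<Longrightarrow> norm ((LINT x|lborel. (f n x)\<^sup>2) - 0) < e * t"
    using LIMSEQ_D[OF lim, of "e * t"] e t by auto
  have "norm ((LINT x|lborel. f n x * h x) - 0) < e" if "n \<ge> N" for n
  proof -
    have i: "integrable lborel (\<lambda>x. t / 2 * (h x)\<^sup>2)" "integrable lborel (\<lambda>x. 1 / (2 * t) * (f n x)\<^sup>2)"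
      by (intro Cc_integrable Cc_cmult Cc_power2 h f)+
    have "\<bar>LINT x|lborel. f n x * h x\<bar> \<le> (LINT x|lborel. \<bar>f n x * h x\<bar>)" by (rule integral_abs_bound)
    also have "\<dots> \<le> (LINT x|lborel. t / 2 * (h x)\<^sup>2 + 1 / (2 * t) * (f n x)\<^sup>2)"
    proof (intro integral_mono Bochner_Integration.integrable_add i)
      show "integrable lborel (\<lambda>x. \<bar>f n x * h x\<bar>)" by (intro Cc_integrable Cc_abs Cc_mult f h)
      fix x
      have "0 \<le> (t * \<bar>h x\<bar> - \<bar>f n x\<bar>)\<^sup>2 / (2 * t)" using t by simp
      also have "\<dots> = t / 2 * (h x)\<^sup>2 + 1 / (2 * t) * (f n x)\<^sup>2 - \<bar>f n x\<bar> * \<bar>h x\<bar>"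
        using t by (simp add: power2_diff power_mult_distrib field_simps) (simp add: power2_eq_square)
      finally show "\<bar>f n x * h x\<bar> \<le> t / 2 * (h x)\<^sup>2 + 1 / (2 * t) * (f n x)\<^sup>2" by (simp add: abs_mult)
    qed
    also have "\<dots> = t / 2 * H + 1 / (2 * t) * (LINT x|lborel. (f n x)\<^sup>2)" unfolding H_def using i by simp
    also have "\<dots> < e"
    proof -
      have "1 / (2 * t) * (LINT x|lborel. (f n x)\<^sup>2) < 1 / (2 * t) * (e * t)" using N[OF that] t by (intro mult_strict_left_mono) auto
      also have "\<dots> = e / 2" using t by simp
      finally show ?thesis using t(2) by simp
    qed
    finally show ?thesis by simp
  qed
  thus "\<exists>N. \<forall>n\<ge>N. norm ((LINT x|lborel. f n x * h x) - 0) < e" by blast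
qed

text \<open>The form is closable because its generator maps test functions to bounded functions.\<close>
lemma hardy_form_closable:
  fixes \<psi> :: "nat \<Rightarrow> plane \<Rightarrow> real"
  assumes test: "\<And>n. \<psi> n \<in> test_functions"
    and lim: "(\<lambda>n. LINT x|lborel. (\<psi> n x)\<^sup>2) \<longlonglongrightarrow> 0"
    and cauchy: "\<And>e. e > 0 \<Longrightarrow> \<exists>N. \<forall>m\<ge>N. \<forall>n\<ge>N. test_norm (\<lambda>x. \<psi> m x - \<psi> n x) < e"
  shows "(\<lambda>n. dirichlet (grad (\<psi> n)) - hardy (\<psi> n)) \<longlonglongrightarrow> 0"
    and "\<eta> \<in> test_functions \<Longrightarrow> (\<lambda>n. hardy_form (\<psi> n) (grad (\<psi> n)) \<eta> (grad \<eta>)) \<longlonglongrightarrow> 0"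
proof -
  have C: "C1c (\<psi> n) (grad (\<psi> n))" for n by (rule test_function_C1c[OF test])
  show weak: "(\<lambda>n. hardy_form (\<psi> n) (grad (\<psi> n)) \<eta> (grad \<eta>)) \<longlonglongrightarrow> 0" if \<eta>: "\<eta> \<in> test_functions" for \<eta>
  proof -
    obtain h where h: "Cc h" "\<And>f F. C1c f F \<Longrightarrow> hardy_form f F \<eta> (grad \<eta>) = (LINT x|lborel. f x * h x)"
      using hardy_form_weak[OF \<eta>] by metis
    show ?thesis unfolding h(2)[OF C] by (rule integral_mult_tendsto_0[OF C1c_Cc[OF C] h(1) lim])
  qed
  let ?A = "\<lambda>n. dirichlet (grad (\<psi> n)) - hardy (\<psi> n)"
  show "?A \<longlonglongrightarrow> 0"
  proof (rule LIMSEQ_I)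
    fix e :: real assume e: "e > 0"
    define c where "c = sqrt (e / 2)"
    have c: "c > 0" "c\<^sup>2 = e / 2" using e by (auto simp: c_def)
    obtain N where N: "\<And>m n. m \<ge> N \<Longrightarrow> n \<ge> N \<Longrightarrow> test_norm (\<lambda>x. \<psi> m x - \<psi> n x) < c" using cauchy[OF c(1)] by blast
    obtain N' where N': "\<And>n. n \<ge> N' \<Longrightarrow> norm (hardy_form (\<psi> n) (grad (\<psi> n)) (\<psi> N) (grad (\<psi> N)) - 0) < e / 4"
      using LIMSEQ_D[OF weak[OF test[of N]], of "e / 4"] e by auto
    have "norm (?A n - 0) < e" if n: "n \<ge> max N N'" for n
    proof -
      have CN: "C1c (\<lambda>x. - \<psi> N x) (\<lambda>x. - grad (\<psi> N) x)" using C1c_cmult[OF C[of N], of "-1"] by simp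
      have d: "C1c (\<lambda>x. \<psi> n x - \<psi> N x) (\<lambda>x. grad (\<psi> n) x - grad (\<psi> N) x)" by (rule C1c_diff[OF C C])
      \<comment> \<open>Expanding the norm of \<open>\<psi> n - \<psi> N\<close> for fixed
        \<open>N\<close>: it is small by the Cauchy property, the mixed term is small by weak
        convergence, and the energy of \<open>\<psi> N\<close> is nonnegative, so the energy of
        \<open>\<psi> n\<close> is small.\<close>
      have "dirichlet (\<lambda>x. grad (\<psi> n) x - grad (\<psi> N) x) - hardy (\<lambda>x. \<psi> n x - \<psi> N x)
         = ?A n - 2 * hardy_form (\<psi> n) (grad (\<psi> n)) (\<psi> N) (grad (\<psi> N)) + ?A N"
        using hardy_form_add[OF C[of n] CN] unfolding hardy_form_minus_right energy_minus by simp
      moreover have "(test_norm (\<lambda>x. \<psi> n x - \<psi> N x))\<^sup>2 = dirichlet (\<lambda>x. grad (\<psi> n) x - grad (\<psi> N) x) - hardy (\<lambda>x. \<psi> n x - \<psi> N x)"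
        using test_norm_sq[OF test_function_diff[OF test[of n] test[of N]]] C1c_grad_eq[OF d] by simp
      moreover have "(test_norm (\<lambda>x. \<psi> n x - \<psi> N x))\<^sup>2 < c\<^sup>2"
      proof (rule power_strict_mono)
        show "test_norm (\<lambda>x. \<psi> n x - \<psi> N x) < c" using N[of n N] n by simp
        show "0 \<le> test_norm (\<lambda>x. \<psi> n x - \<psi> N x)"
          using test_norm_eq[OF test_function_diff[OF test[of n] test[of N]]]
            hardy_le_dirichlet[OF test_function_C1c[OF test_function_diff[OF test[of n] test[of N]]]] by simp
      qed auto
      moreover have "?A N \<ge> 0" "?A n \<ge> 0" using hardy_le_dirichlet[OF C] by auto
      moreover have "\<bar>hardy_form (\<psi> n) (grad (\<psi> n)) (\<psi> N) (grad (\<psi> N))\<bar> < e / 4" using N'[of n] n by simp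
      ultimately show ?thesis using c(2) unfolding real_norm_def by linarith
    qed
    thus "\<exists>no. \<forall>n\<ge>no. norm (?A n - 0) < e" by blast
  qed
qed

lemma test_function_represents:
  assumes f: "f \<in> test_functions"
  shows "represents (\<lambda>n. f) f"
proof -
  have C: "C1c f (grad f)" by (rule test_function_C1c[OF f])
  have z: "test_norm (\<lambda>x. f x - f x) = 0"
  proof -
    have "(\<lambda>x. f x - f x) = (\<lambda>x. 0)" by simp
    moreover have "grad (\<lambda>x. 0) = (\<lambda>x. 0)" using C1c_grad_eq[OF C1c_0] .
    ultimately show ?thesis unfolding test_norm_def by simp
  qed
  have "f \<in> Lp_space p" if p: "p > 1" for p
  proof -
    have "Cc (\<lambda>x. \<bar>f x\<bar> powr p)"
    proof -
      have "continuous_on UNIV (\<lambda>x. \<bar>f x\<bar> powr p)"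
        using C1c_Cc[OF C] p unfolding Cc_def by (intro continuous_on_powr' continuous_intros) auto
      thus ?thesis using C1c_Cc[OF C] unfolding Cc_def by auto
    qed
    moreover have "f \<in> borel_measurable disc_measure"
      using Cc_disc_integrable[OF C1c_Cc[OF C]] by auto
    ultimately show ?thesis unfolding Lp_space_def using Cc_disc_integrable by auto
  qed
  moreover have "(\<lambda>n::nat. Lp_norm p (\<lambda>x. f x - f x)) \<longlonglongrightarrow> 0" for p
    by (simp add: Lp_norm_def)
  ultimately show ?thesis unfolding represents_def using f z by auto
qed

text \<open>The definite description is meaningful only if all representing sequences have the same
  limit of norms. Two of them are compared through the constant sequence: the difference is Cauchy
  and tends to 0 in L^2, so closability removes its energy and its mixed term with
  \<open>f\<close>.\<close>

lemma H_norm_test_function: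
  assumes f: "f \<in> test_functions"
  shows "H_norm f = test_norm f"
  unfolding H_norm_def
proof (rule the_equality)
  show "\<exists>\<phi>. represents \<phi> f \<and> (\<lambda>n. test_norm (\<phi> n)) \<longlonglongrightarrow> test_norm f"
    using test_function_represents[OF f] by (intro exI[of _ "\<lambda>n. f"]) simp
  fix r assume "\<exists>\<phi>. represents \<phi> f \<and> (\<lambda>n. test_norm (\<phi> n)) \<longlonglongrightarrow> r"
  then obtain \<phi> where rep: "represents \<phi> f" and lim: "(\<lambda>n. test_norm (\<phi> n)) \<longlonglongrightarrow> r" by blast
  have t: "\<phi> n \<in> test_functions" for n using rep by (simp add: represents_def)
  have Cf: "C1c f (grad f)" by (rule test_function_C1c[OF f])
  define \<psi> where "\<psi> n x = \<phi> n x - f x" for n x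
  have td: "\<psi> n \<in> test_functions" for n unfolding \<psi>_def[abs_def] by (rule test_function_diff[OF t f])
  have C: "C1c (\<psi> n) (grad (\<psi> n))" for n by (rule test_function_C1c[OF td])
  have "(\<lambda>n. Lp_norm 2 (\<psi> n)) \<longlonglongrightarrow> 0" using rep unfolding represents_def \<psi>_def[abs_def] by auto
  hence "(\<lambda>n. (Lp_norm 2 (\<psi> n))\<^sup>2) \<longlonglongrightarrow> 0\<^sup>2" by (intro tendsto_power)
  hence l2: "(\<lambda>n. LINT x|lborel. (\<psi> n x)\<^sup>2) \<longlonglongrightarrow> 0" unfolding Lp_norm_2_sq[OF C1c_Cc[OF C]] by simp
  have cauchy: "\<exists>N. \<forall>m\<ge>N. \<forall>n\<ge>N. test_norm (\<lambda>x. \<psi> m x - \<psi> n x) < e" if "e > 0" for e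
    using rep that unfolding represents_def \<psi>_def by simp
  have "(\<lambda>n. dirichlet (grad f) - hardy f + 2 * hardy_form (\<psi> n) (grad (\<psi> n)) f (grad f) + (dirichlet (grad (\<psi> n)) - hardy (\<psi> n)))
     \<longlonglongrightarrow> dirichlet (grad f) - hardy f + 2 * 0 + 0"
    by (intro tendsto_intros hardy_form_closable[OF td l2 cauchy] f)
  moreover have "dirichlet (grad f) - hardy f + 2 * hardy_form (\<psi> n) (grad (\<psi> n)) f (grad f) + (dirichlet (grad (\<psi> n)) - hardy (\<psi> n))
     = (test_norm (\<phi> n))\<^sup>2" for n
  proof -
    have "C1c (\<lambda>x. \<psi> n x + f x) (\<lambda>x. grad (\<psi> n) x + grad f x)" by (rule C1c_add[OF C Cf])
    moreover have e: "(\<lambda>x. \<psi> n x + f x) = \<phi> n" by (simp add: \<psi>_def)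
    ultimately have g: "grad (\<phi> n) = (\<lambda>x. grad (\<psi> n) x + grad f x)" using C1c_grad_eq by metis
    show ?thesis unfolding test_norm_sq[OF t] g using hardy_form_add[OF C[of n] Cf] unfolding e by simp
  qed
  ultimately have "(\<lambda>n. (test_norm (\<phi> n))\<^sup>2) \<longlonglongrightarrow> (test_norm f)\<^sup>2" unfolding test_norm_sq[OF f] by simp
  hence "(\<lambda>n. sqrt ((test_norm (\<phi> n))\<^sup>2)) \<longlonglongrightarrow> sqrt ((test_norm f)\<^sup>2)" by (intro tendsto_real_sqrt)
  moreover have nn: "test_norm g \<ge> 0" if "g \<in> test_functions" for g
    using test_norm_eq[OF that] hardy_le_dirichlet[OF test_function_C1c[OF that]] by simp
  ultimately have "(\<lambda>n. test_norm (\<phi> n)) \<longlonglongrightarrow> test_norm f" using nn[OF t] nn[OF f] by simp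
  thus "r = test_norm f" using lim LIMSEQ_unique by blast
qed

lemma lambda1_le_test_function:
  assumes f: "f \<in> test_functions"
  shows "lambda1 * (LINT x|lborel. (f x)\<^sup>2) \<le> dirichlet (grad f) - hardy f"
proof -
  have C: "C1c f (grad f)" by (rule test_function_C1c[OF f])
  have fc: "Cc f" by (rule C1c_Cc[OF C])
  have i: "integrable lborel (\<lambda>x. (f x)\<^sup>2)" by (intro Cc_integrable Cc_power2 fc)
  let ?I = "LINT x|lborel. (f x)\<^sup>2"
  have I0: "?I \<ge> 0" by simp
  show ?thesis
  proof (cases "?I = 0")
    case True
    then show ?thesis using hardy_le_dirichlet[OF C] by simp
  next
    case False
    have nz: "\<not> (AE x in disc_measure. f x = 0)"
    proof
      assume "AE x in disc_measure. f x = 0"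
      hence "AE x in disc_measure. (f x)\<^sup>2 = 0" by (rule AE_mp) (auto intro!: AE_I2)
      hence "(LINT x|disc_measure. (f x)\<^sup>2) = 0" by (rule integral_eq_zero_AE)
      thus False using False Cc_disc_integral[OF Cc_power2[OF fc]] by simp
    qed
    have mem: "f \<in> H_space" using test_function_represents[OF f] by (auto simp: H_space_def)
    let ?S = "{(H_norm u)\<^sup>2 / (Lp_norm 2 u)\<^sup>2 | u. u \<in> H_space \<and> \<not> (AE x in disc_measure. u x = 0)}"
    have "(H_norm f)\<^sup>2 / (Lp_norm 2 f)\<^sup>2 \<in> ?S" using mem nz by blast
    \<comment> \<open>Squares bound the quotients below by 0, so \<open>Inf\<close> on the reals is
      a genuine infimum.\<close>
    moreover have "bdd_below ?S" by (intro bdd_belowI[of _ 0]) auto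
    ultimately have "lambda1 \<le> (H_norm f)\<^sup>2 / (Lp_norm 2 f)\<^sup>2" unfolding lambda1_def by (rule cInf_lower)
    also have "\<dots> = (dirichlet (grad f) - hardy f) / ?I"
      by (simp add: H_norm_test_function[OF f] test_norm_sq[OF f] Lp_norm_2_sq[OF fc])
    finally show ?thesis using False I0 by (simp add: pos_le_divide_eq)
  qed
qed

section \<open>Mollification\<close>

text \<open>Powers of \<open>1/t\<close> times \<open>exp (-1/t)\<close>, extended by 0: the
  functions occurring in the derivatives of the standard smooth cutoff. The whole family is
  introduced because it is stable, up to linear combinations, under differentiation.\<close>

definition expker :: "nat \<Rightarrow> real \<Rightarrow> real" where
  "expker k t = (if t > 0 then inverse t ^ k / exp (inverse t) else 0)"

lemma expker_tendsto_0: "(expker k \<longlongrightarrow> 0) (at 0)"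
proof -
  have "((\<lambda>t::real. inverse t ^ k / exp (inverse t)) \<longlongrightarrow> 0) (at_right 0)"
    by (rule filterlim_compose[OF tendsto_power_div_exp_0 filterlim_inverse_at_top_right])
  hence R: "(expker k \<longlongrightarrow> 0) (at_right 0)"
    by (rule Lim_transform_eventually) (auto simp: expker_def eventually_at_right_less eventually_at_filter)
  have "((\<lambda>t::real. 0::real) \<longlongrightarrow> 0) (at_left 0)" by simp
  hence L: "(expker k \<longlongrightarrow> 0) (at_left 0)"
    by (rule Lim_transform_eventually) (auto simp: expker_def eventually_at_filter)
  show ?thesis using L R by (simp add: filterlim_at_split)
qed

lemma expker_derivative:
  "(expker k has_real_derivative expker (k + 2) t - real k * expker (k + 1) t) (at t)"
proof -
  consider "t > 0" | "t < 0" | "t = 0" by linarith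
  thus ?thesis
  proof cases
    case 1
    have "((\<lambda>t. inverse t ^ k / exp (inverse t)) has_real_derivative
       expker (k + 2) t - real k * expker (k + 1) t) (at t)"
      using 1 by (auto intro!: derivative_eq_intros simp: expker_def field_simps power2_eq_square)
        (cases k; simp add: field_simps)
    thus ?thesis
      by (rule has_field_derivative_transform_within_open[where S = "{0<..}"]) (use 1 in \<open>auto simp: expker_def\<close>)
  next
    case 2
    have "((\<lambda>t. 0) has_real_derivative 0) (at t)" by simp
    hence "(expker k has_real_derivative 0) (at t)"
      by (rule has_field_derivative_transform_within_open[where S = "{..<0}"]) (use 2 in \<open>auto simp: expker_def\<close>)
    thus ?thesis using 2 by (simp add: expker_def)
  next
    case 3
    \<comment> \<open>At the origin the difference quotient is itself the next member of the family,
      which tends to 0.\<close>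
    have "(\<lambda>u. (expker k u - expker k 0) / (u - 0)) = expker (Suc k)"
      by (auto simp: fun_eq_iff expker_def field_simps)
    hence "(expker k has_real_derivative 0) (at 0)"
      unfolding has_field_derivative_iff using expker_tendsto_0[of "Suc k"] by simp
    thus ?thesis using 3 by (simp add: expker_def)
  qed
qed

text \<open>Polynomials in the coordinates and in the cutoffs of \<open>1 - d * norm^2\<close>. This
  algebra is closed under partial derivatives, so its members are smooth by coinduction.\<close>

inductive_set bump_algebra :: "real \<Rightarrow> (plane \<Rightarrow> real) set" for d where
  ker: "(\<lambda>x. expker k (1 - d * (norm x)\<^sup>2)) \<in> bump_algebra d"
| comp: "(\<lambda>x. x $ i) \<in> bump_algebra d"
| const: "(\<lambda>x. c) \<in> bump_algebra d"
| add: "f \<in> bump_algebra d \<Longrightarrow> g \<in> bump_algebra d \<Longrightarrow> (\<lambda>x. f x + g x) \<in> bump_algebra d"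
| mult: "f \<in> bump_algebra d \<Longrightarrow> g \<in> bump_algebra d \<Longrightarrow> (\<lambda>x. f x * g x) \<in> bump_algebra d"

lemma bump_algebra_gradient:
  assumes "f \<in> bump_algebra d"
  shows "\<exists>G. (\<forall>x. (f has_derivative (\<lambda>h. G x \<bullet> h)) (at x)) \<and> (\<forall>i. (\<lambda>x. G x $ i) \<in> bump_algebra d)"
  using assms
proof induction
  case (ker k)
  let ?s = "\<lambda>x::plane. 1 - d * (norm x)\<^sup>2"
  let ?e = "\<lambda>x. expker (k + 2) (?s x) + (- real k) * expker (k + 1) (?s x)"
  have s: "(?s has_derivative (\<lambda>h. - d * ((2 *\<^sub>R x) \<bullet> h))) (at x)" for x
    by (auto intro!: derivative_eq_intros has_derivative_norm_sq)
  have "((\<lambda>x. expker k (?s x)) has_derivative (\<lambda>h. ((- 2 * d * ?e x) *\<^sub>R x) \<bullet> h)) (at x)" for x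
    using has_derivative_compose[OF s expker_derivative[THEN has_field_derivative_imp_has_derivative]]
    by (rule has_derivative_eq_rhs) (auto simp: fun_eq_iff algebra_simps)
  moreover have "(\<lambda>x. ((- 2 * d * ?e x) *\<^sub>R x) $ i) \<in> bump_algebra d" for i
    unfolding vector_scaleR_component real_scaleR_def
    by (intro bump_algebra.intros)
  ultimately show ?case by (intro exI[of _ "\<lambda>x. (- 2 * d * ?e x) *\<^sub>R x"] conjI allI)
next
  case (comp i)
  have "(\<lambda>x. axis i 1 $ j) \<in> bump_algebra d" for j by (rule const)
  thus ?case using has_derivative_component by (intro exI[of _ "\<lambda>x. axis i 1"]) blast
next
  case (const c)
  show ?case by (intro exI[of _ "\<lambda>x. 0"]) (auto intro: bump_algebra.const)
next
  case (add f g)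
  then obtain F G where "\<And>x. (f has_derivative (\<lambda>h. F x \<bullet> h)) (at x)" "\<And>i. (\<lambda>x. F x $ i) \<in> bump_algebra d"
    "\<And>x. (g has_derivative (\<lambda>h. G x \<bullet> h)) (at x)" "\<And>i. (\<lambda>x. G x $ i) \<in> bump_algebra d" by blast
  thus ?case
    by (intro exI[of _ "\<lambda>x. F x + G x"]) (auto intro!: derivative_eq_intros bump_algebra.add simp: inner_add_left)
next
  case (mult f g)
  then obtain F G where *: "\<And>x. (f has_derivative (\<lambda>h. F x \<bullet> h)) (at x)" "\<And>i. (\<lambda>x. F x $ i) \<in> bump_algebra d"
    "\<And>x. (g has_derivative (\<lambda>h. G x \<bullet> h)) (at x)" "\<And>i. (\<lambda>x. G x $ i) \<in> bump_algebra d" by blast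
  have "((\<lambda>x. f x * g x) has_derivative (\<lambda>h. (f x *\<^sub>R G x + g x *\<^sub>R F x) \<bullet> h)) (at x)" for x
    by (rule has_derivative_eq_rhs[OF has_derivative_mult[OF *(1) *(3)]]) (auto simp: inner_add_left)
  moreover have "(\<lambda>x. (f x *\<^sub>R G x + g x *\<^sub>R F x) $ i) \<in> bump_algebra d" for i
    unfolding vector_add_component vector_scaleR_component real_scaleR_def
    by (intro bump_algebra.add bump_algebra.mult mult *)
  ultimately show ?case by (intro exI[of _ "\<lambda>x. f x *\<^sub>R G x + g x *\<^sub>R F x"] conjI allI)
qed

lemma bump_algebra_smooth: "f \<in> bump_algebra d \<Longrightarrow> smooth f"
proof (rule smooth_coinduct)
  fix g x i assume "g \<in> bump_algebra d"
  from bump_algebra_gradient[OF this] obtain G where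
    G: "\<And>x. (g has_derivative (\<lambda>h. G x \<bullet> h)) (at x)" "\<And>i. (\<lambda>x. G x $ i) \<in> bump_algebra d" by blast
  show "g differentiable (at x)" using G(1) differentiable_def by blast
  have "partial i g = (\<lambda>x. G x $ i)" using partial_eq[OF G(1)] by (intro ext)
  thus "partial i g \<in> bump_algebra d" using G(2) by simp
qed

lemma mollifier_exists:
  assumes "\<epsilon> > 0"
  obtains K :: "plane \<Rightarrow> real" where "smooth K" "\<And>x. K x \<ge> 0" "\<And>x. norm x \<ge> \<epsilon> \<Longrightarrow> K x = 0"
    "\<And>x. (LINT y|lborel. K (x - y)) = 1" "\<And>x. integrable lborel (\<lambda>y. K (x - y))"
proof -
  define d where "d = 1 / \<epsilon>\<^sup>2"
  define b where "b x = expker 0 (1 - d * (norm x)\<^sup>2)" for x :: plane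
  have b0: "b x \<ge> 0" for x by (simp add: b_def expker_def)
  have bs: "b x = 0" if "norm x \<ge> \<epsilon>" for x
  proof -
    have "d * (norm x)\<^sup>2 \<ge> 1" using that assms by (simp add: d_def field_simps power_mono)
    thus ?thesis by (simp add: b_def expker_def)
  qed
  have bm: "b \<in> bump_algebra d" unfolding b_def[abs_def] by (rule ker)
  have bc: "continuous_on UNIV b" by (intro smooth_continuous bump_algebra_smooth[OF bm])
  have bi: "integrable lborel b" by (rule integrable_compact_support[OF bc bs])
  define c where "c = (LINT x|lborel. b x)"
  have "c \<noteq> 0"
  proof
    assume "c = 0"
    hence "AE x in lborel. b x = 0" using integral_nonneg_eq_0_iff_AE[OF bi] b0 by (auto simp: c_def)
    hence "AE x in lborel. indicator (ball (0::plane) \<epsilon>) x = (0::real)"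
    proof (rule eventually_mono)
      fix x :: plane assume "b x = 0"
      have "x \<notin> ball 0 \<epsilon>"
      proof
        assume "x \<in> ball 0 \<epsilon>"
        hence "(norm x)\<^sup>2 < \<epsilon>\<^sup>2" using assms by (intro power_strict_mono) auto
        hence "1 - d * (norm x)\<^sup>2 > 0" using assms by (simp add: d_def)
        hence "b x > 0" by (simp add: b_def expker_def)
        with \<open>b x = 0\<close> show False by simp
      qed
      thus "indicator (ball 0 \<epsilon>) x = (0::real)" by simp
    qed
    hence "(LINT x|lborel. indicator (ball (0::plane) \<epsilon>) x) = (0::real)" by (rule integral_eq_zero_AE)
    thus False using lborel_ball_plane[of \<epsilon> 0] assms by simp
  qed
  moreover have "c \<ge> 0" unfolding c_def using b0 by (intro Bochner_Integration.integral_nonneg) auto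
  ultimately have c: "c > 0" by simp
  define K where "K x = (1 / c) * b x" for x
  have sym: "K (x - y) = K (y + - x)" for x y by (simp add: K_def b_def norm_minus_commute)
  have Ki: "integrable lborel K" unfolding K_def[abs_def] using bi by simp
  have Km: "K \<in> borel_measurable borel" using Ki by auto
  show ?thesis
  proof (rule that)
    show "smooth K" unfolding K_def[abs_def]
      by (intro bump_algebra_smooth[of _ d] mult const bm)
    show "K x \<ge> 0" for x using b0 c by (simp add: K_def)
    show "norm x \<ge> \<epsilon> \<Longrightarrow> K x = 0" for x using bs by (simp add: K_def)
    show "integrable lborel (\<lambda>y. K (x - y))" for x
      unfolding sym integral_lborel_translate(2)[OF Km] by (rule Ki)
    have "(LINT y|lborel. K y) = 1" unfolding K_def[abs_def] using c by (simp add: c_def[symmetric])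
    thus "(LINT y|lborel. K (x - y)) = 1" for x
      unfolding sym integral_lborel_translate(1)[OF Km] .
  qed
qed

section \<open>Convolution with a smooth kernel\<close>

definition mollify :: "(plane \<Rightarrow> real) \<Rightarrow> (plane \<Rightarrow> real) \<Rightarrow> plane \<Rightarrow> real" where
  "mollify f K x = (LINT y|lborel. f y * K (x - y))"

lemma continuous_reflect: "continuous_on UNIV K \<Longrightarrow> continuous_on UNIV (\<lambda>y. K ((x::plane) - y))"
  by (rule continuous_on_compose2[of UNIV K UNIV "\<lambda>y. x - y"]) (auto intro!: continuous_intros)

text \<open>All derivatives fall on the kernel, so continuity of \<open>f\<close> is enough and the
  partial derivatives are again mollifications. The compact support of \<open>f\<close> confines the
  integral to a box, where the Leibniz rule applies.\<close>

lemma mollify_derivative: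
  assumes f: "Cc f" and K: "smooth K"
  shows "(mollify f K has_derivative (\<lambda>h. (\<chi> i. mollify f (partial i K) x) \<bullet> h)) (at x)"
proof -
  define a b :: plane where "a = (\<chi> i. -1)" and "b = (\<chi> i. 1)"
  have box: "x \<in> cbox a b" if "norm x \<le> 1" for x
  proof -
    have "\<bar>x $ i\<bar> \<le> 1" for i using component_le_norm_cart[of x i] that by linarith
    thus ?thesis by (auto simp: mem_box_cart a_def b_def abs_le_iff minus_le_iff)
  qed
  have Kc: "continuous_on UNIV K" by (rule smooth_continuous[OF K])
  have Gc: "continuous_on UNIV (grad K)" by (rule smooth_continuous_grad[OF K])
  have Pc: "continuous_on UNIV (partial i K)" for i by (intro smooth_continuous smooth_partial K)
  have fc: "continuous_on UNIV f" using f by (simp add: Cc_def)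
  obtain r where r: "r < 1" "\<And>x. r \<le> norm x \<Longrightarrow> f x = 0" using f unfolding Cc_def by blast
  have to_box: "(LINT y|lborel. g y) = integral (cbox a b) g" if "Cc g" "\<And>y. f y = 0 \<Longrightarrow> g y = 0" for g
  proof -
    have "(\<lambda>y. if y \<in> cbox a b then g y else 0) = g"
    proof
      fix y
      show "(if y \<in> cbox a b then g y else 0) = g y"
        using box[of y] r(1) r(2)[of y] that(2)[of y] by (cases "norm y \<le> 1") auto
    qed
    thus ?thesis
      using integral_lborel[OF Cc_integrable[OF that(1)]] Henstock_Kurzweil_Integration.integral_restrict_UNIV[of "cbox a b" g] by simp
  qed
  have mol: "mollify f H x = integral (cbox a b) (\<lambda>y. f y * H (x - y))" if "continuous_on UNIV H" for H x
    unfolding mollify_def by (intro to_box Cc_mult_right[OF f] continuous_reflect that) auto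
  let ?F = "\<lambda>x y. blinfun_inner_left (f y *\<^sub>R grad K (x - y))"
  have cF: "continuous_on (UNIV \<times> cbox a b) (\<lambda>(x, y). ?F x y)"
    unfolding case_prod_unfold
    by (intro bounded_linear.continuous_on[OF bounded_linear_blinfun_inner_left] continuous_intros
          continuous_on_compose2[OF fc] continuous_on_compose2[OF Gc]) auto
  have "((\<lambda>x. integral (cbox a b) (\<lambda>y. f y * K (x - y))) has_derivative
      blinfun_apply (integral (cbox a b) (?F x))) (at x within UNIV)"
  proof (rule leibniz_rule[where U = UNIV, OF _ _ cF])
    fix x t
    have "((\<lambda>x. K (x - t)) has_derivative (\<lambda>h. grad K (x - t) \<bullet> h)) (at x)"
      by (rule has_derivative_compose[OF _ has_derivative_grad[OF smooth_differentiable[OF K]], where f = "\<lambda>x. x - t", THEN has_derivative_eq_rhs])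
         (auto intro!: derivative_eq_intros)
    from has_derivative_mult_right[OF this, of "f t"]
    show "((\<lambda>x. f t * K (x - t)) has_derivative blinfun_apply (?F x t)) (at x within UNIV)"
      by (rule has_derivative_eq_rhs) (auto simp: inner_commute)
    show "(\<lambda>y. f y * K (x - y)) integrable_on cbox a b"
      by (intro integrable_continuous continuous_intros continuous_on_subset[OF fc] continuous_on_subset[OF continuous_reflect[OF Kc]]) auto
  qed auto
  hence "(mollify f K has_derivative blinfun_apply (integral (cbox a b) (?F x))) (at x)"
    unfolding mol[OF Kc, abs_def, symmetric] by simp
  moreover have "blinfun_apply (integral (cbox a b) (?F x)) = (\<lambda>h. (\<chi> i. mollify f (partial i K) x) \<bullet> h)"
  proof
    fix h
    have Fi: "?F x integrable_on cbox a b"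
      by (intro integrable_continuous bounded_linear.continuous_on[OF bounded_linear_blinfun_inner_left] continuous_intros
          continuous_on_subset[OF fc] continuous_on_subset[OF continuous_reflect[OF Gc]]) auto
    have Pi: "(\<lambda>y. f y * partial i K (x - y)) integrable_on cbox a b" for i
      by (intro integrable_continuous continuous_intros continuous_on_subset[OF fc] continuous_on_subset[OF continuous_reflect[OF Pc]]) auto
    have "blinfun_apply (integral (cbox a b) (?F x)) h = integral (cbox a b) (\<lambda>y. \<Sum>i\<in>UNIV. h $ i * (f y * partial i K (x - y)))"
      unfolding blinfun_apply_integral[OF Fi]
      by (simp add: inner_vec_def grad_def sum_distrib_left mult_ac)
    also have "\<dots> = (\<Sum>i\<in>UNIV. integral (cbox a b) (\<lambda>y. h $ i * (f y * partial i K (x - y))))"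
      by (intro integral_sum integrable_cmul[OF Pi, unfolded real_scaleR_def]) auto
    also have "\<dots> = (\<Sum>i\<in>UNIV. h $ i * mollify f (partial i K) x)"
      unfolding mol[OF Pc] by simp
    finally show "blinfun_apply (integral (cbox a b) (?F x)) h = (\<chi> i. mollify f (partial i K) x) \<bullet> h"
      by (simp add: inner_vec_def mult.commute)
  qed
  ultimately show ?thesis by simp
qed

lemma smooth_mollify:
  assumes f: "Cc f" and K: "smooth K"
  shows "smooth (mollify f K)"
proof (rule smooth_coinduct[where S = "{mollify f K | K. smooth K}"])
  show "mollify f K \<in> {mollify f K | K. smooth K}" using K by blast
  fix g x i assume "g \<in> {mollify f K | K. smooth K}"
  then obtain K where g: "g = mollify f K" and K: "smooth K" by blast
  show "g differentiable (at x)" unfolding g using mollify_derivative[OF f K] differentiable_def by blast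
  have "partial i g = mollify f (partial i K)"
    unfolding g using partial_eq[OF mollify_derivative[OF f K]] by (intro ext) simp
  thus "partial i g \<in> {mollify f K | K. smooth K}" using smooth_partial[OF K] by blast
qed

text \<open>Integration by parts moves the derivative from the kernel back to \<open>f\<close>; thus
  the gradient of the mollification approximates the gradient of \<open>f\<close> as well.\<close>

lemma mollify_partial:
  assumes f: "C1c f F" and K: "smooth K"
  shows "grad (mollify f K) x $ i = mollify (\<lambda>y. F y $ i) K x"
proof -
  have fc: "Cc f" by (rule C1c_Cc[OF f])
  have Fi: "Cc (\<lambda>x. F x $ i)" by (rule C1c_Cc_component[OF f])
  have d: "((\<lambda>y. K (x - y)) has_derivative (\<lambda>h. (- grad K (x - y)) \<bullet> h)) (at y)" for y
    by (rule has_derivative_compose[OF _ has_derivative_grad[OF smooth_differentiable[OF K]], where f = "\<lambda>y. x - y", THEN has_derivative_eq_rhs])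
       (auto intro!: derivative_eq_intros)
  have c: "continuous_on disc (\<lambda>y. - grad K (x - y))"
    by (intro continuous_intros continuous_on_subset[OF continuous_reflect[OF smooth_continuous_grad[OF K]]]) auto
  have "(LINT y|lborel. (K (x - y) *\<^sub>R F y + f y *\<^sub>R (- grad K (x - y))) \<bullet> axis i 1) = 0"
    by (rule C1c_integral_grad[OF C1c_mult_disc[OF f d c]])
  also have "(\<lambda>y. (K (x - y) *\<^sub>R F y + f y *\<^sub>R (- grad K (x - y))) \<bullet> axis i 1) = (\<lambda>y. F y $ i * K (x - y) - f y * partial i K (x - y))"
    by (auto simp: inner_axis grad_def)
  also have "(LINT y|lborel. F y $ i * K (x - y) - f y * partial i K (x - y)) = mollify (\<lambda>y. F y $ i) K x - mollify f (partial i K) x"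
    unfolding mollify_def
    by (intro Bochner_Integration.integral_diff Cc_integrable Cc_mult_right Fi fc continuous_reflect smooth_continuous K smooth_partial)
  finally have "mollify f (partial i K) x = mollify (\<lambda>y. F y $ i) K x" by simp
  thus ?thesis by (simp add: grad_eq[OF mollify_derivative[OF fc K]])
qed

context
  fixes K :: "plane \<Rightarrow> real" and \<epsilon> :: real
  assumes K: "smooth K" "\<And>x. K x \<ge> 0" "\<And>x. norm x \<ge> \<epsilon> \<Longrightarrow> K x = 0"
    "\<And>x. (LINT y|lborel. K (x - y)) = 1" "\<And>x. integrable lborel (\<lambda>y. K (x - y))"
begin

lemma mollify_near:
  assumes f: "Cc f" and osc: "\<And>y. norm (x - y) \<le> \<epsilon> \<Longrightarrow> \<bar>f y - c\<bar> \<le> e"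
  shows "\<bar>mollify f K x - c\<bar> \<le> e"
proof -
  have i: "integrable lborel (\<lambda>y. f y * K (x - y))" "integrable lborel (\<lambda>y. c * K (x - y))" "integrable lborel (\<lambda>y. e * K (x - y))"
    by (intro Cc_integrable Cc_mult_right f continuous_reflect smooth_continuous K(1), (intro integrable_mult_right K(5))+)
  have "mollify f K x - c = (LINT y|lborel. f y * K (x - y) - c * K (x - y))"
    unfolding mollify_def using i K(4) by simp
  also have "\<bar>\<dots>\<bar> \<le> (LINT y|lborel. \<bar>f y * K (x - y) - c * K (x - y)\<bar>)" by (rule integral_abs_bound)
  also have "\<dots> \<le> (LINT y|lborel. e * K (x - y))"
  proof (intro integral_mono i integrable_abs Bochner_Integration.integrable_diff)
    fix y
    show "\<bar>f y * K (x - y) - c * K (x - y)\<bar> \<le> e * K (x - y)"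
    proof (cases "norm (x - y) \<le> \<epsilon>")
      case True
      have "\<bar>f y * K (x - y) - c * K (x - y)\<bar> = \<bar>f y - c\<bar> * K (x - y)"
        using K(2) by (simp add: left_diff_distrib[symmetric] abs_mult)
      thus ?thesis using osc[OF True] K(2) by (simp add: mult_right_mono)
    qed (simp add: K(3))
  qed
  also have "\<dots> = e" using K(4) by simp
  finally show ?thesis .
qed

end

lemma Cc_uniformly_continuous:
  assumes "Cc f" "e > 0"
  shows "\<exists>d>0. \<forall>x y. norm (x - y) \<le> d \<longrightarrow> \<bar>f y - f x\<bar> \<le> e"
proof -
  obtain r where r: "r < 1" "\<And>x. r \<le> norm x \<Longrightarrow> f x = 0" using assms unfolding Cc_def by blast
  have "uniformly_continuous_on (cball 0 2) f"
    using assms unfolding Cc_def by (intro compact_uniformly_continuous) (auto intro: continuous_on_subset)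
  then obtain d where d: "d > 0" "\<And>x y. x \<in> cball 0 2 \<Longrightarrow> y \<in> cball 0 2 \<Longrightarrow> dist y x < d \<Longrightarrow> dist (f y) (f x) < e"
    unfolding uniformly_continuous_on_def using assms(2) by metis
  show ?thesis
  proof (intro exI[of _ "min (d/2) 1"] conjI allI impI)
    show "min (d/2) 1 > 0" using d(1) by simp
    fix x y :: plane assume xy: "norm (x - y) \<le> min (d/2) 1"
    show "\<bar>f y - f x\<bar> \<le> e"
    proof (cases "x \<in> cball 0 2 \<and> y \<in> cball 0 2")
      case True
      have "dist y x < d" using xy d(1) by (simp add: dist_norm norm_minus_commute)
      hence "dist (f y) (f x) < e" using True d(2) by blast
      thus ?thesis by (simp add: dist_real_def)
    next
      case False
      have "norm x \<le> norm y + norm (x - y)" "norm y \<le> norm x + norm (x - y)"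
        using norm_triangle_sub[of x y] norm_triangle_sub[of y x] by (auto simp: norm_minus_commute)
      hence "norm x \<ge> 1" "norm y \<ge> 1" using False xy by auto
      thus ?thesis using r assms(2) by simp
    qed
  qed
qed

text \<open>Mollification at scales tending to 0. Common support and common bounds are recorded
  along with pointwise convergence, as dominated convergence with a weight that is singular on the
  circle calls for all three.\<close>

lemma C1c_approx:
  assumes f: "C1c f F"
  obtains \<phi> r B where "r < 1" "\<And>n. \<phi> n \<in> test_functions" "\<And>n x. norm x > r \<Longrightarrow> \<phi> n x = 0"
    "\<And>n x. \<bar>\<phi> n x\<bar> \<le> B" "\<And>n x i. \<bar>grad (\<phi> n) x $ i\<bar> \<le> B"
    "\<And>x. (\<lambda>n. \<phi> n x) \<longlonglongrightarrow> f x" "\<And>x i. (\<lambda>n. grad (\<phi> n) x $ i) \<longlonglongrightarrow> F x $ i"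
proof -
  obtain r where r: "r < 1" "\<And>x. r \<le> norm x \<Longrightarrow> f x = 0" using C1c_Cc[OF f] unfolding Cc_def by blast
  \<comment> \<open>Half of the distance from the support to the circle is reserved for the growth
    of the support under mollification.\<close>
  define s where "s = (1 - r) / 2"
  have s: "s > 0" "r + s < 1" using r by (auto simp: s_def field_simps)
  have fc: "Cc f" by (rule C1c_Cc[OF f])
  have Fi: "Cc (\<lambda>x. F x $ i)" for i by (rule C1c_Cc_component[OF f])
  define P where "P n \<phi> \<longleftrightarrow> \<phi> \<in> test_functions \<and> (\<forall>x. norm x > r + s \<longrightarrow> \<phi> x = 0) \<and>
     (\<forall>x. \<bar>\<phi> x - f x\<bar> \<le> 1 / real (Suc n)) \<and> (\<forall>x i. \<bar>grad \<phi> x $ i - F x $ i\<bar> \<le> 1 / real (Suc n))" for n \<phi>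
  have "\<exists>\<phi>. P n \<phi>" for n
  proof -
    let ?e = "1 / real (Suc n)"
    have e: "?e > 0" by simp
    obtain d0 where d0: "d0 > 0" "\<And>x y. norm (x - y) \<le> d0 \<Longrightarrow> \<bar>f y - f x\<bar> \<le> ?e"
      using Cc_uniformly_continuous[OF fc e] by blast
    obtain d1 where d1: "d1 > 0" "\<And>x y. norm (x - y) \<le> d1 \<Longrightarrow> \<bar>F y $ 1 - F x $ 1\<bar> \<le> ?e"
      using Cc_uniformly_continuous[OF Fi[of 1] e] by blast
    obtain d2 where d2: "d2 > 0" "\<And>x y. norm (x - y) \<le> d2 \<Longrightarrow> \<bar>F y $ 2 - F x $ 2\<bar> \<le> ?e"
      using Cc_uniformly_continuous[OF Fi[of 2] e] by blast
    define \<epsilon> where "\<epsilon> = Min {s, d0, d1, d2}"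
    have ep: "\<epsilon> > 0" "\<epsilon> \<le> s" "\<epsilon> \<le> d0" "\<epsilon> \<le> d1" "\<epsilon> \<le> d2" using s d0 d1 d2 by (auto simp: \<epsilon>_def)
    obtain K where K: "smooth K" "\<And>x. K x \<ge> 0" "\<And>x. norm x \<ge> \<epsilon> \<Longrightarrow> K x = 0"
      "\<And>x. (LINT y|lborel. K (x - y)) = 1" "\<And>x. integrable lborel (\<lambda>y. K (x - y))"
      using mollifier_exists[OF ep(1)] by blast
    have supp: "mollify f K x = 0" if "norm x > r + s" for x
    proof -
      have z: "f y * K (x - y) = 0" for y
      proof (cases "norm (x - y) < \<epsilon>")
        case True
        have "norm x \<le> norm y + norm (x - y)" by (rule norm_triangle_sub)
        hence "r \<le> norm y" using True that ep by linarith
        then show ?thesis using r by simp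
      qed (use K(3)[of "x - y"] in simp)
      show ?thesis unfolding mollify_def z by simp
    qed
    have "P n (mollify f K)"
      unfolding P_def
    proof (intro conjI allI impI)
      show "mollify f K \<in> test_functions"
        by (rule test_functionI[OF smooth_mollify[OF fc K(1)] s(2) supp])
      show "norm x > r + s \<Longrightarrow> mollify f K x = 0" for x by (rule supp)
      show "\<bar>mollify f K x - f x\<bar> \<le> ?e" for x
      proof (rule mollify_near[OF K fc])
        fix y assume "norm (x - y) \<le> \<epsilon>"
        hence "norm (x - y) \<le> d0" using ep by linarith
        thus "\<bar>f y - f x\<bar> \<le> ?e" by (rule d0(2))
      qed
      show "\<bar>grad (mollify f K) x $ i - F x $ i\<bar> \<le> ?e" for x i
        unfolding mollify_partial[OF f K(1)]
      proof (rule mollify_near[OF K Fi])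
        fix y assume "norm (x - y) \<le> \<epsilon>"
        hence "norm (x - y) \<le> d1" "norm (x - y) \<le> d2" using ep by auto
        thus "\<bar>F y $ i - F x $ i\<bar> \<le> ?e" using d1(2) d2(2) exhaust_2[of i] by metis
      qed
    qed
    thus ?thesis by blast
  qed
  then obtain \<phi> where \<phi>: "\<And>n. P n (\<phi> n)" by metis
  obtain B0 where B0: "B0 \<ge> 0" "\<And>x. \<bar>f x\<bar> \<le> B0" using Cc_bounded[OF fc] by metis
  obtain M where M: "M \<ge> 0" "\<And>x. norm (F x) \<le> M" using C1c_bounded_grad[OF f] by metis
  have one: "1 / real (Suc n) \<le> 1" for n by (simp add: field_simps)
  have lim: "(\<lambda>n. g n) \<longlonglongrightarrow> c" if "\<And>n. \<bar>g n - c\<bar> \<le> 1 / real (Suc n)" for g :: "nat \<Rightarrow> real" and c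
  proof -
    have "(\<lambda>n. g n - c) \<longlonglongrightarrow> 0"
      by (rule tendsto_rabs_zero_cancel, rule tendsto_sandwich[OF _ _ tendsto_const LIMSEQ_Suc[OF lim_1_over_n]])
         (use that in auto)
    thus ?thesis by (simp add: LIM_zero_iff)
  qed
  show ?thesis
  proof (rule that[of "r + s" \<phi> "max B0 M + 1"])
    show "r + s < 1" by (rule s(2))
    show "\<phi> n \<in> test_functions" for n using \<phi> by (simp add: P_def)
    show "norm x > r + s \<Longrightarrow> \<phi> n x = 0" for n x using \<phi> by (simp add: P_def)
    show "\<bar>\<phi> n x\<bar> \<le> max B0 M + 1" for n x
    proof -
      have "\<bar>\<phi> n x - f x\<bar> \<le> 1" using \<phi>[of n] one[of n] unfolding P_def by (meson order_trans)
      thus ?thesis using B0(2)[of x] by linarith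
    qed
    show "\<bar>grad (\<phi> n) x $ i\<bar> \<le> max B0 M + 1" for n x i
    proof -
      have "\<bar>grad (\<phi> n) x $ i - F x $ i\<bar> \<le> 1" using \<phi>[of n] one[of n] unfolding P_def by (meson order_trans)
      thus ?thesis using M(2)[of x] component_le_norm_cart[of "F x" i] by linarith
    qed
    show "(\<lambda>n. \<phi> n x) \<longlonglongrightarrow> f x" for x using \<phi> by (intro lim) (auto simp: P_def)
    show "(\<lambda>n. grad (\<phi> n) x $ i) \<longlonglongrightarrow> F x $ i" for x i using \<phi> by (intro lim) (auto simp: P_def)
  qed
qed

section \<open>The eigenvalue inequality for continuously differentiable functions\<close>

lemma integral_sq_tendsto:
  fixes g :: "nat \<Rightarrow> plane \<Rightarrow> real"
  assumes g: "\<And>n. Cc (g n)" "\<And>n x. norm x > r \<Longrightarrow> g n x = 0" "\<And>n x. \<bar>g n x\<bar> \<le> B" and r: "r < 1"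
    and f: "Cc f" and lim: "\<And>x. (\<lambda>n. g n x) \<longlonglongrightarrow> f x" and v: "continuous_on disc v"
  shows "(\<lambda>n. LINT x|lborel. (g n x)\<^sup>2 * v x) \<longlonglongrightarrow> (LINT x|lborel. (f x)\<^sup>2 * v x)"
proof (rule integral_dominated_convergence[where w = "\<lambda>x. indicator (cball 0 r) x *\<^sub>R (B\<^sup>2 * \<bar>v x\<bar>)"])
  have "cball 0 r \<subseteq> (disc :: plane set)" using r by auto
  thus "integrable lborel (\<lambda>x::plane. indicator (cball 0 r) x *\<^sub>R (B\<^sup>2 * \<bar>v x\<bar>))"
    by (intro borel_integrable_compact continuous_intros continuous_on_subset[OF v]) auto
  show "(\<lambda>x. (f x)\<^sup>2 * v x) \<in> borel_measurable lborel"
    using Cc_measurable[OF Cc_mult_disc[OF Cc_power2[OF f] v]] by simp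
  show "(\<lambda>x. (g n x)\<^sup>2 * v x) \<in> borel_measurable lborel" for n
    using Cc_measurable[OF Cc_mult_disc[OF Cc_power2[OF g(1)] v]] by simp
  show "AE x in lborel. (\<lambda>n. (g n x)\<^sup>2 * v x) \<longlonglongrightarrow> (f x)\<^sup>2 * v x"
    by (intro AE_I2 tendsto_intros lim)
  show "AE x in lborel. norm ((g n x)\<^sup>2 * v x) \<le> indicator (cball 0 r) x *\<^sub>R (B\<^sup>2 * \<bar>v x\<bar>)" for n
  proof (rule AE_I2)
    fix x
    have "(g n x)\<^sup>2 \<le> B\<^sup>2" using g(3)[of n x] by (metis abs_ge_zero power2_abs power_mono)
    thus "norm ((g n x)\<^sup>2 * v x) \<le> indicator (cball 0 r) x *\<^sub>R (B\<^sup>2 * \<bar>v x\<bar>)"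
      using g(2)[of x n] by (cases "norm x \<le> r") (auto simp: abs_mult mult_right_mono)
  qed
qed

text \<open>Coercivity is applied to the difference of \<open>u\<close> and the parametrix. The
  parametrix is merely C^1, so the inequality has to be extended from test functions by
  approximation.\<close>

lemma lambda1_le_C1c:
  assumes f: "C1c f F"
  shows "lambda1 * (LINT x|lborel. (f x)\<^sup>2) \<le> dirichlet F - hardy f"
proof -
  obtain \<phi> r B where r: "r < 1" and t: "\<And>n. \<phi> n \<in> test_functions" and s: "\<And>n x. norm x > r \<Longrightarrow> \<phi> n x = 0"
    and B: "\<And>n x. \<bar>\<phi> n x\<bar> \<le> B" "\<And>n x i. \<bar>grad (\<phi> n) x $ i\<bar> \<le> B"
    and lim: "\<And>x. (\<lambda>n. \<phi> n x) \<longlonglongrightarrow> f x" "\<And>x i. (\<lambda>n. grad (\<phi> n) x $ i) \<longlonglongrightarrow> F x $ i"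
    by (rule C1c_approx[OF f]) (rule that)
  have C: "C1c (\<phi> n) (grad (\<phi> n))" for n by (rule test_function_C1c[OF t])
  have fc: "Cc f" by (rule C1c_Cc[OF f])
  have pc: "Cc (\<phi> n)" for n by (rule C1c_Cc[OF C])
  have Gi: "Cc (\<lambda>x. G x $ i)" if "C1c g G" for g G i by (rule C1c_Cc_component[OF that])
  obtain r' where r': "r < r'" "r' < 1" using dense[OF r] by blast
  have gs: "grad (\<phi> n) x $ i = 0" if "norm x > r" for n x i
  proof -
    have "open {x::plane. r < norm x}" by (intro open_Collect_less continuous_intros)
    hence "(\<phi> n has_derivative (\<lambda>h. 0)) (at x)"
      by (rule has_derivative_transform_within_open[OF has_derivative_const[of 0]]) (use that s in auto)
    hence "(\<phi> n has_derivative (\<lambda>h. 0 \<bullet> h)) (at x)" by simp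
    from grad_eq[OF this] show ?thesis by simp
  qed
  have l2: "(\<lambda>n. LINT x|lborel. (\<phi> n x)\<^sup>2) \<longlonglongrightarrow> (LINT x|lborel. (f x)\<^sup>2)"
    using integral_sq_tendsto[OF pc s B(1) r fc lim(1) continuous_on_const[of _ 1]] by simp
  have lh: "(\<lambda>n. hardy (\<phi> n)) \<longlonglongrightarrow> hardy f"
    using integral_sq_tendsto[OF pc s B(1) r fc lim(1) continuous_on_gap_power[of 2]] by (simp add: hardy_def)
  have dir: "dirichlet G = (LINT x|lborel. (G x $ 1)\<^sup>2 * 1) + (LINT x|lborel. (G x $ 2)\<^sup>2 * 1)" if G: "C1c g G" for g G
  proof -
    have "(\<lambda>x. (norm (G x))\<^sup>2) = (\<lambda>x. (G x $ 1)\<^sup>2 * 1 + (G x $ 2)\<^sup>2 * 1)"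
      unfolding power2_norm_eq_inner inner_vec_def by (simp add: sum_2 power2_eq_square)
    thus ?thesis unfolding dirichlet_def
      using Cc_integrable[OF Cc_power2[OF Gi[OF G]]] by simp
  qed
  have "(\<lambda>n. dirichlet (grad (\<phi> n))) \<longlonglongrightarrow> dirichlet F"
    unfolding dir[OF C] dir[OF f]
    by (intro tendsto_add integral_sq_tendsto[OF Gi[OF C] gs B(2) r Gi[OF f] lim(2) continuous_on_const])
  hence "(\<lambda>n. dirichlet (grad (\<phi> n)) - hardy (\<phi> n)) \<longlonglongrightarrow> dirichlet F - hardy f"
    by (intro tendsto_diff lh)
  moreover have "(\<lambda>n. lambda1 * (LINT x|lborel. (\<phi> n x)\<^sup>2)) \<longlonglongrightarrow> lambda1 * (LINT x|lborel. (f x)\<^sup>2)"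
    by (intro tendsto_mult_left l2)
  ultimately show ?thesis
    using lambda1_le_test_function[OF t] by (intro LIMSEQ_le[where X = "\<lambda>n. lambda1 * (LINT x|lborel. (\<phi> n x)\<^sup>2)"]) auto
qed

text \<open>The spectral inequality absorbs \<alpha> into the fraction
  \<open>\<alpha> / lambda1\<close> of the energy; what remains is coercivity with
  \<open>\<delta> = 1 - \<alpha> / lambda1\<close>.\<close>

lemma moser_onofri_subcritical:
  assumes "0 \<le> \<alpha>" "\<alpha> < lambda1"
  shows "\<exists>C. \<forall>u U. C1c u U \<longrightarrow>
     dirichlet U - hardy u - \<alpha> * (LINT x|lborel. (u x)\<^sup>2) - 16 * pi * ln (LINT x|lborel. indicator disc x * exp (u x)) \<ge> - C"
proof (rule moser_onofri_C1c[OF assms(1), of "1 - \<alpha> / lambda1"])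
  have l: "lambda1 > 0" using assms by linarith
  show "1 - \<alpha> / lambda1 > 0" using l assms by simp
  fix f F assume f: "C1c f F"
  have "\<alpha> / lambda1 * (lambda1 * (LINT x|lborel. (f x)\<^sup>2)) \<le> \<alpha> / lambda1 * (dirichlet F - hardy f)"
    using l assms lambda1_le_C1c[OF f] by (intro mult_left_mono) auto
  hence "\<alpha> * (LINT x|lborel. (f x)\<^sup>2) \<le> \<alpha> / lambda1 * (dirichlet F - hardy f)" using l by simp
  thus "(1 - \<alpha> / lambda1) * (dirichlet F - hardy f) \<le> dirichlet F - hardy f - \<alpha> * (LINT x|lborel. (f x)\<^sup>2)"
    by (simp add: left_diff_distrib)
qed

section \<open>Passage to the Sobolev space\<close>

lemma borel_measurable_disc_measure: "f \<in> borel_measurable borel \<Longrightarrow> f \<in> borel_measurable disc_measure"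
  by (intro measurable_restrict_space1 measurable_completion) simp

section \<open>Convergence in L^2 and Fatou's lemma\<close>

lemma integrable_mult_if_sq_integrable:
  fixes v w :: "'a \<Rightarrow> real"
  assumes "v \<in> borel_measurable M" "w \<in> borel_measurable M" "integrable M (\<lambda>x. (v x)\<^sup>2)" "integrable M (\<lambda>x. (w x)\<^sup>2)"
  shows "integrable M (\<lambda>x. v x * w x)"
proof (rule Bochner_Integration.integrable_bound[where f = "\<lambda>x. (v x)\<^sup>2 + (w x)\<^sup>2"])
  show "AE x in M. norm (v x * w x) \<le> norm ((v x)\<^sup>2 + (w x)\<^sup>2)"
  proof (rule AE_I2)
    fix x
    have "2 * (\<bar>v x\<bar> * \<bar>w x\<bar>) \<le> \<bar>v x\<bar>\<^sup>2 + \<bar>w x\<bar>\<^sup>2" using sum_squares_bound[of "\<bar>v x\<bar>" "\<bar>w x\<bar>"] by simp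
    moreover have "\<bar>v x\<bar> * \<bar>w x\<bar> \<ge> 0" by simp
    ultimately have "\<bar>v x\<bar> * \<bar>w x\<bar> \<le> \<bar>v x\<bar>\<^sup>2 + \<bar>w x\<bar>\<^sup>2" by linarith
    thus "norm (v x * w x) \<le> norm ((v x)\<^sup>2 + (w x)\<^sup>2)" by (simp add: abs_mult)
  qed
qed (use assms in auto)

lemma integrable_diff_sq:
  fixes v w :: "'a \<Rightarrow> real"
  assumes "v \<in> borel_measurable M" "w \<in> borel_measurable M" "integrable M (\<lambda>x. (v x)\<^sup>2)" "integrable M (\<lambda>x. (w x)\<^sup>2)"
  shows "integrable M (\<lambda>x. (v x - w x)\<^sup>2)"
proof -
  have "(\<lambda>x. (v x - w x)\<^sup>2) = (\<lambda>x. (v x)\<^sup>2 + (w x)\<^sup>2 - 2 * (v x * w x))" by (simp add: power2_diff algebra_simps)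
  thus ?thesis using assms integrable_mult_if_sq_integrable[OF assms] by simp
qed

text \<open>With a free weight,
  \<open>\<bar>v^2 - w^2\<bar> \<le> (1 + 1/t) * (v - w)^2 + t * w^2\<close>; first \<open>t\<close>
  is taken small, then \<open>n\<close> large.\<close>

lemma integral_sq_tendsto_if_L2_tendsto:
  fixes v :: "nat \<Rightarrow> 'a \<Rightarrow> real"
  assumes m: "\<And>n. v n \<in> borel_measurable M" "w \<in> borel_measurable M"
    and i: "\<And>n. integrable M (\<lambda>x. (v n x)\<^sup>2)" "integrable M (\<lambda>x. (w x)\<^sup>2)"
    and lim: "(\<lambda>n. LINT x|M. (v n x - w x)\<^sup>2) \<longlonglongrightarrow> 0"
  shows "(\<lambda>n. LINT x|M. (v n x)\<^sup>2) \<longlonglongrightarrow> (LINT x|M. (w x)\<^sup>2)"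
proof -
  define d where "d n = (LINT x|M. (v n x - w x)\<^sup>2)" for n
  define S where "S = (LINT x|M. (w x)\<^sup>2)"
  have S: "S \<ge> 0" by (simp add: S_def)
  have di: "integrable M (\<lambda>x. (v n x - w x)\<^sup>2)" for n by (intro integrable_diff_sq m i)
  have bound: "\<bar>(LINT x|M. (v n x)\<^sup>2) - S\<bar> \<le> (1 + 1 / t) * d n + t * S" if t: "t > 0" for n t
  proof -
    have ii: "integrable M (\<lambda>x. (1 + 1 / t) * (v n x - w x)\<^sup>2)" "integrable M (\<lambda>x. t * (w x)\<^sup>2)"
      by (intro integrable_mult_right di i)+
    have "\<bar>(LINT x|M. (v n x)\<^sup>2) - S\<bar> = \<bar>LINT x|M. (v n x)\<^sup>2 - (w x)\<^sup>2\<bar>" using i by (simp add: S_def)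
    also have "\<dots> \<le> (LINT x|M. \<bar>(v n x)\<^sup>2 - (w x)\<^sup>2\<bar>)" by (rule integral_abs_bound)
    also have "\<dots> \<le> (LINT x|M. (1 + 1 / t) * (v n x - w x)\<^sup>2 + t * (w x)\<^sup>2)"
    proof (intro integral_mono integrable_abs Bochner_Integration.integrable_diff Bochner_Integration.integrable_add ii i)
      fix x
      define p where "p = v n x - w x"
      define q where "q = w x"
      have "0 \<le> (\<bar>p\<bar> - t * \<bar>q\<bar>)\<^sup>2 / t" using t by simp
      also have "(\<bar>p\<bar> - t * \<bar>q\<bar>)\<^sup>2 = p\<^sup>2 + t\<^sup>2 * q\<^sup>2 - 2 * t * (\<bar>p\<bar> * \<bar>q\<bar>)" by (simp add: power2_diff power_mult_distrib)
      also have "\<dots> / t = 1 / t * p\<^sup>2 + t * q\<^sup>2 - 2 * (\<bar>p\<bar> * \<bar>q\<bar>)" using t by (simp add: field_simps power2_eq_square)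
      finally have "2 * (\<bar>p\<bar> * \<bar>q\<bar>) \<le> 1 / t * p\<^sup>2 + t * q\<^sup>2" by linarith
      moreover have "(v n x)\<^sup>2 - (w x)\<^sup>2 = p\<^sup>2 + 2 * (p * q)" by (simp add: p_def q_def power2_eq_square algebra_simps)
      moreover have "\<bar>p\<^sup>2 + 2 * (p * q)\<bar> \<le> p\<^sup>2 + 2 * (\<bar>p\<bar> * \<bar>q\<bar>)"
        using abs_triangle_ineq[of "p\<^sup>2" "2 * (p * q)"] by (simp add: abs_mult)
      ultimately have "\<bar>(v n x)\<^sup>2 - (w x)\<^sup>2\<bar> \<le> p\<^sup>2 + (1 / t * p\<^sup>2 + t * q\<^sup>2)" by linarith
      thus "\<bar>(v n x)\<^sup>2 - (w x)\<^sup>2\<bar> \<le> (1 + 1 / t) * (v n x - w x)\<^sup>2 + t * (w x)\<^sup>2"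
        by (simp add: p_def q_def distrib_right)
    qed
    also have "\<dots> = (1 + 1 / t) * d n + t * S"
      unfolding d_def S_def using Bochner_Integration.integral_add[OF ii] by simp
    finally show ?thesis .
  qed
  show ?thesis unfolding S_def[symmetric]
  proof (rule LIMSEQ_I)
    fix e :: real assume e: "e > 0"
    define t where "t = e / (2 * (S + 1))"
    have t: "t > 0" "t * S \<le> e / 2" using e S by (auto simp: t_def field_simps)
    have "(\<lambda>n. (1 + 1 / t) * d n) \<longlonglongrightarrow> (1 + 1 / t) * 0" using lim by (intro tendsto_mult_left) (simp add: d_def)
    then obtain N where N: "\<And>n. n \<ge> N \<Longrightarrow> norm ((1 + 1 / t) * d n - 0) < e / 2"
      using LIMSEQ_D[of _ _ "e / 2"] e by (metis half_gt_zero mult_zero_right)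
    have "norm ((LINT x|M. (v n x)\<^sup>2) - S) < e" if "n \<ge> N" for n
      using bound[OF t(1), of n] N[OF that] t(2) unfolding real_norm_def by linarith
    thus "\<exists>N. \<forall>n\<ge>N. norm ((LINT x|M. (v n x)\<^sup>2) - S) < e" by blast
  qed
qed

text \<open>The integrals need not converge; convergent upper bounds \<open>c\<close> suffice.
  Integrability of the limit is obtained together with the bound.\<close>

lemma Fatou_integrable_bound:
  fixes f :: "nat \<Rightarrow> 'a \<Rightarrow> real"
  assumes i: "\<And>n. integrable M (f n)" and nn: "\<And>n x. f n x \<ge> 0" and g: "g \<in> borel_measurable M"
    and lim: "AE x in M. (\<lambda>n. f n x) \<longlonglongrightarrow> g x" and b: "\<And>n. (LINT x|M. f n x) \<le> c n" and c: "c \<longlonglongrightarrow> l"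
  shows "integrable M g" "(LINT x|M. g x) \<le> l"
proof -
  have g0: "AE x in M. g x \<ge> 0"
    using lim by (rule eventually_mono) (use nn in \<open>auto intro: LIMSEQ_le_const\<close>)
  have l0: "l \<ge> 0"
  proof (rule LIMSEQ_le_const[OF c], intro exI[of _ 0] allI impI)
    show "0 \<le> c n" for n using b[of n] Bochner_Integration.integral_nonneg[of M "f n"] nn by fastforce
  qed
  have "(\<integral>\<^sup>+ x. ennreal (g x) \<partial>M) = (\<integral>\<^sup>+ x. liminf (\<lambda>n. ennreal (f n x)) \<partial>M)"
  proof (rule nn_integral_cong_AE, use lim in eventually_elim)
    fix x assume "(\<lambda>n. f n x) \<longlonglongrightarrow> g x"
    hence "(\<lambda>n. ennreal (f n x)) \<longlonglongrightarrow> ennreal (g x)" by (intro tendsto_ennrealI)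
    thus "ennreal (g x) = liminf (\<lambda>n. ennreal (f n x))" by (intro lim_imp_Liminf[symmetric]) auto
  qed
  also have "\<dots> \<le> liminf (\<lambda>n. \<integral>\<^sup>+ x. ennreal (f n x) \<partial>M)"
    using i by (intro nn_integral_liminf) auto
  also have "\<dots> \<le> liminf (\<lambda>n. ennreal (c n))"
  proof (rule Liminf_mono, intro always_eventually allI)
    fix n
    have "(\<integral>\<^sup>+ x. ennreal (f n x) \<partial>M) = ennreal (LINT x|M. f n x)"
      using i nn by (intro nn_integral_eq_integral) auto
    also have "\<dots> \<le> ennreal (c n)" using b by (intro ennreal_leI)
    finally show "(\<integral>\<^sup>+ x. ennreal (f n x) \<partial>M) \<le> ennreal (c n)" .
  qed
  also have "\<dots> = ennreal l"
    using c by (intro lim_imp_Liminf tendsto_ennrealI) auto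
  finally have le: "(\<integral>\<^sup>+ x. ennreal (g x) \<partial>M) \<le> ennreal l" .
  show gi: "integrable M g"
  proof (rule integrableI_nonneg[OF g g0])
    show "(\<integral>\<^sup>+ x. ennreal (g x) \<partial>M) < \<infinity>" using le by (rule le_less_trans) simp
  qed
  have "ennreal (LINT x|M. g x) \<le> ennreal l"
    using le nn_integral_eq_integral[OF gi g0] by simp
  thus "(LINT x|M. g x) \<le> l" using l0 by (simp add: ennreal_le_iff)
qed

lemma Lp_space_2D:
  assumes "v \<in> Lp_space 2"
  shows "v \<in> borel_measurable disc_measure" "integrable disc_measure (\<lambda>x. (v x)\<^sup>2)"
proof -
  have "\<bar>v x\<bar> powr 2 = (v x)\<^sup>2" for x by (simp add: powr_numeral)
  thus "v \<in> borel_measurable disc_measure" "integrable disc_measure (\<lambda>x. (v x)\<^sup>2)"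
    using assms by (auto simp: Lp_space_def)
qed

lemma Lp_norm_2_tendsto_0:
  assumes "(\<lambda>n. Lp_norm 2 (v n)) \<longlonglongrightarrow> 0"
  shows "(\<lambda>n. LINT x|disc_measure. (v n x)\<^sup>2) \<longlonglongrightarrow> 0"
proof -
  have "(Lp_norm 2 (v n))\<^sup>2 = (LINT x|disc_measure. (v n x)\<^sup>2)" for n
  proof -
    have e: "\<bar>v n x\<bar> powr 2 = (v n x)\<^sup>2" for x by (simp add: powr_numeral)
    show ?thesis unfolding Lp_norm_def e by (simp add: powr_half_sqrt)
  qed
  moreover have "(\<lambda>n. (Lp_norm 2 (v n))\<^sup>2) \<longlonglongrightarrow> 0\<^sup>2" by (intro tendsto_power assms)
  ultimately show ?thesis by simp
qed

lemma norm_sq_plane: "(norm (v :: plane))\<^sup>2 = (v $ 1)\<^sup>2 + (v $ 2)\<^sup>2"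
  unfolding power2_norm_eq_inner inner_vec_def by (simp add: sum_2 power2_eq_square)

text \<open>Along approximating test functions the Dirichlet and L^2 integrals converge, whereas the
  Hardy and exponential integrals are only lower semicontinuous. The latter two enter with a minus
  sign, so Fatou's lemma works in the right direction. The integrability claims ensure that these
  two integrals are not the default value 0.\<close>

theorem corollary2:
  fixes \<alpha> :: real
  assumes "0 \<le> \<alpha>" and "\<alpha> < lambda1"
  shows "\<exists>C>0. \<forall>u\<in>W012.
           integrable disc_measure (\<lambda>x. (u x)\<^sup>2 / (1 - (norm x)\<^sup>2)\<^sup>2) \<and>
           integrable disc_measure (\<lambda>x. exp (u x)) \<and>
           (LINT x|disc_measure. (norm (weak_grad u x))\<^sup>2)
             - (LINT x|disc_measure. (u x)\<^sup>2 / (1 - (norm x)\<^sup>2)\<^sup>2)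
             - \<alpha> * (LINT x|disc_measure. (u x)\<^sup>2)
             - 16 * pi * ln (LINT x|disc_measure. exp (u x)) \<ge> - C"
proof -
  obtain C where C: "\<And>u U. C1c u U \<Longrightarrow>
     dirichlet U - hardy u - \<alpha> * (LINT x|lborel. (u x)\<^sup>2) - 16 * pi * ln (LINT x|lborel. indicator disc x * exp (u x)) \<ge> - C"
    using moser_onofri_subcritical[OF assms] by blast
  let ?M = disc_measure
  show ?thesis
  proof (intro exI[of _ "max C 1"] conjI ballI)
    show "max C 1 > 0" by simp
    fix u assume u: "u \<in> W012"
    define G where "G = weak_grad u"
    have uL: "u \<in> Lp_space 2" using u by (simp add: W012_def W12_def)
    have "\<exists>G. has_weak_grad u G" using u by (simp add: W012_def W12_def)
    hence "has_weak_grad u G" unfolding G_def weak_grad_def by (rule someI_ex)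
    hence GL: "(\<lambda>x. G x $ i) \<in> Lp_space 2" for i by (simp add: has_weak_grad_def)
    obtain \<phi> where t: "\<And>n. \<phi> n \<in> test_functions"
      and l0: "(\<lambda>n. Lp_norm 2 (\<lambda>x. \<phi> n x - u x)) \<longlonglongrightarrow> 0"
      and l1: "(\<lambda>n. Lp_norm 2 (\<lambda>x. norm (grad (\<phi> n) x - G x))) \<longlonglongrightarrow> 0"
      using u unfolding W012_def G_def by blast
    have P: "C1c (\<phi> n) (grad (\<phi> n))" for n by (rule test_function_C1c[OF t])
    have pc: "Cc (\<phi> n)" for n by (rule C1c_Cc[OF P])
    have gc: "Cc (\<lambda>x. grad (\<phi> n) x $ i)" for n i by (rule C1c_Cc_component[OF P])
    note um = Lp_space_2D(1)[OF uL] and ui = Lp_space_2D(2)[OF uL]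
    note Gm = Lp_space_2D(1)[OF GL] and Gi = Lp_space_2D(2)[OF GL]
    have pm: "\<phi> n \<in> borel_measurable ?M" "integrable ?M (\<lambda>x. (\<phi> n x)\<^sup>2)" for n
      by (intro borel_measurable_disc_measure Cc_measurable pc, intro Cc_disc_integrable Cc_power2 pc)
    have gm: "(\<lambda>x. grad (\<phi> n) x $ i) \<in> borel_measurable ?M" "integrable ?M (\<lambda>x. (grad (\<phi> n) x $ i)\<^sup>2)" for n i
      by (intro borel_measurable_disc_measure Cc_measurable gc, intro Cc_disc_integrable Cc_power2 gc)
    have d0: "(\<lambda>n. LINT x|?M. (\<phi> n x - u x)\<^sup>2) \<longlonglongrightarrow> 0" by (rule Lp_norm_2_tendsto_0[OF l0])
    have d1: "(\<lambda>n. LINT x|?M. (norm (grad (\<phi> n) x - G x))\<^sup>2) \<longlonglongrightarrow> 0" by (rule Lp_norm_2_tendsto_0[OF l1])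
    have dgi: "integrable ?M (\<lambda>x. (grad (\<phi> n) x $ i - G x $ i)\<^sup>2)" for n i
      by (intro integrable_diff_sq gm Gm Gi)
    have d1i: "(\<lambda>n. LINT x|?M. (grad (\<phi> n) x $ i - G x $ i)\<^sup>2) \<longlonglongrightarrow> 0" for i
    proof (rule tendsto_sandwich[OF _ _ tendsto_const d1])
      show "\<forall>\<^sub>F n in sequentially. 0 \<le> (LINT x|?M. (grad (\<phi> n) x $ i - G x $ i)\<^sup>2)" by simp
      show "\<forall>\<^sub>F n in sequentially. (LINT x|?M. (grad (\<phi> n) x $ i - G x $ i)\<^sup>2) \<le> (LINT x|?M. (norm (grad (\<phi> n) x - G x))\<^sup>2)"
      proof (intro always_eventually allI integral_mono dgi)
        show "integrable ?M (\<lambda>x. (norm (grad (\<phi> n) x - G x))\<^sup>2)" for n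
          unfolding norm_sq_plane vector_minus_component by (intro Bochner_Integration.integrable_add dgi)
        show "(grad (\<phi> n) x $ i - G x $ i)\<^sup>2 \<le> (norm (grad (\<phi> n) x - G x))\<^sup>2" for n x
          using component_le_norm_cart[of "grad (\<phi> n) x - G x" i]
          by (metis abs_ge_zero power2_abs power_mono vector_minus_component)
      qed
    qed
    have S: "(\<lambda>n. LINT x|lborel. (\<phi> n x)\<^sup>2) \<longlonglongrightarrow> (LINT x|?M. (u x)\<^sup>2)"
      using integral_sq_tendsto_if_L2_tendsto[OF pm(1) um pm(2) ui d0] by (simp add: Cc_disc_integral[OF Cc_power2[OF pc]])
    have D: "(\<lambda>n. dirichlet (grad (\<phi> n))) \<longlonglongrightarrow> (LINT x|?M. (norm (G x))\<^sup>2)"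
    proof -
      have "dirichlet (grad (\<phi> n)) = (LINT x|?M. (grad (\<phi> n) x $ 1)\<^sup>2) + (LINT x|?M. (grad (\<phi> n) x $ 2)\<^sup>2)" for n
        unfolding dirichlet_def Cc_disc_integral[OF C1c_Cc_norm[OF P], symmetric]
        unfolding norm_sq_plane by (intro Bochner_Integration.integral_add gm)
      moreover have "(LINT x|?M. (norm (G x))\<^sup>2) = (LINT x|?M. (G x $ 1)\<^sup>2) + (LINT x|?M. (G x $ 2)\<^sup>2)"
        unfolding norm_sq_plane by (intro Bochner_Integration.integral_add Gi)
      ultimately show ?thesis
        by (simp only:) (intro tendsto_add integral_sq_tendsto_if_L2_tendsto gm Gm Gi d1i)
    qed
    \<comment> \<open>Fatou's lemma needs almost everywhere convergence, which L^2 convergence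
      provides along a subsequence.\<close>
    have "\<exists>r::nat\<Rightarrow>nat. strict_mono r \<and> (AE x in ?M. (\<lambda>n. (\<phi> (r n) x - u x)\<^sup>2) \<longlonglongrightarrow> 0)"
    proof (rule tendsto_L1_AE_subseq)
      show "integrable ?M (\<lambda>x. (\<phi> n x - u x)\<^sup>2)" for n by (intro integrable_diff_sq pm um ui)
      show "(\<lambda>n. LINT x|?M. norm ((\<phi> n x - u x)\<^sup>2)) \<longlonglongrightarrow> 0" using d0 by simp
    qed
    then obtain r0 :: "nat \<Rightarrow> nat" where r0: "strict_mono r0" "AE x in ?M. (\<lambda>n. (\<phi> (r0 n) x - u x)\<^sup>2) \<longlonglongrightarrow> 0" by blast
    have H0: "hardy (\<phi> n) \<ge> 0" for n by (simp add: hardy_def)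
    \<comment> \<open>The Hardy integrals are dominated by the convergent Dirichlet integrals. A
      further subsequence makes them converge to some \<open>h\<close>, which may exceed the Hardy
      integral of \<open>u\<close>.\<close>
    have "bounded (range (\<lambda>n. hardy (\<phi> (r0 n))))"
    proof -
      obtain B where B: "\<And>n. norm (dirichlet (grad (\<phi> n))) \<le> B"
        using convergent_imp_Bseq[OF convergentI[OF D]] unfolding Bseq_def by blast
      have "norm (hardy (\<phi> (r0 n))) \<le> B" for n
        using hardy_le_dirichlet[OF P[of "r0 n"]] H0[of "r0 n"] B[of "r0 n"] by simp
      thus ?thesis unfolding bounded_iff by blast
    qed
    from bounded_imp_convergent_subsequence[OF this] obtain h r1 where r1: "strict_mono (r1 :: nat \<Rightarrow> nat)"
      and h: "((\<lambda>n. hardy (\<phi> (r0 n))) \<circ> r1) \<longlonglongrightarrow> h" by blast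
    define r where "r = r0 \<circ> r1"
    have r: "strict_mono r" unfolding r_def by (rule strict_mono_o[OF r0(1) r1])
    have Hlim: "(\<lambda>n. hardy (\<phi> (r n))) \<longlonglongrightarrow> h" using h by (simp add: r_def o_def)
    have ae: "AE x in ?M. (\<lambda>n. \<phi> (r n) x) \<longlonglongrightarrow> u x"
      using r0(2)
    proof eventually_elim
      fix x assume "(\<lambda>n. (\<phi> (r0 n) x - u x)\<^sup>2) \<longlonglongrightarrow> 0"
      hence "(\<lambda>n. sqrt ((\<phi> (r0 n) x - u x)\<^sup>2)) \<longlonglongrightarrow> sqrt 0" by (intro tendsto_real_sqrt)
      hence "(\<lambda>n. \<phi> (r0 n) x - u x) \<longlonglongrightarrow> 0" by (simp add: tendsto_rabs_zero_iff)
      hence "(\<lambda>n. \<phi> (r0 n) x) \<longlonglongrightarrow> u x" by (simp add: LIM_zero_iff)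
      from LIMSEQ_subseq_LIMSEQ[OF this r1] show "(\<lambda>n. \<phi> (r n) x) \<longlonglongrightarrow> u x" by (simp add: r_def o_def)
    qed
    have Vm: "(\<lambda>x::plane. (1 - (norm x)\<^sup>2)\<^sup>2) \<in> borel_measurable ?M"
      by (intro borel_measurable_disc_measure borel_measurable_continuous_onI continuous_intros)
    have hardy_lim: "integrable ?M (\<lambda>x. (u x)\<^sup>2 / (1 - (norm x)\<^sup>2)\<^sup>2)"
      "(LINT x|?M. (u x)\<^sup>2 / (1 - (norm x)\<^sup>2)\<^sup>2) \<le> h"
    proof -
      note F = Fatou_integrable_bound[where M = ?M and f = "\<lambda>n x. (\<phi> (r n) x)\<^sup>2 / (1 - (norm x)\<^sup>2)\<^sup>2"
          and g = "\<lambda>x. (u x)\<^sup>2 / (1 - (norm x)\<^sup>2)\<^sup>2" and c = "\<lambda>n. hardy (\<phi> (r n))" and l = h]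
      have a: "integrable ?M (\<lambda>x. (\<phi> (r n) x)\<^sup>2 / (1 - (norm x)\<^sup>2)\<^sup>2)" for n
        by (intro Cc_disc_integrable Cc_hardy Cc_power2 pc)
      have b: "(LINT x|?M. (\<phi> (r n) x)\<^sup>2 / (1 - (norm x)\<^sup>2)\<^sup>2) \<le> hardy (\<phi> (r n))" for n
        unfolding hardy_def by (simp add: Cc_disc_integral[OF Cc_hardy[OF Cc_power2[OF pc]]])
      have c: "(\<lambda>x. (u x)\<^sup>2 / (1 - (norm x)\<^sup>2)\<^sup>2) \<in> borel_measurable ?M"
        by (intro borel_measurable_divide borel_measurable_power um Vm)
      have d: "AE x in ?M. (\<lambda>n. (\<phi> (r n) x)\<^sup>2 / (1 - (norm x)\<^sup>2)\<^sup>2) \<longlonglongrightarrow> (u x)\<^sup>2 / (1 - (norm x)\<^sup>2)\<^sup>2"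
        using ae
      proof (rule AE_mp, intro AE_I2 impI)
        fix x assume x: "x \<in> space ?M" and l: "(\<lambda>n. \<phi> (r n) x) \<longlonglongrightarrow> u x"
        have "(1 - (norm x)\<^sup>2)\<^sup>2 \<noteq> 0" using disc_gap[of x] x by simp
        thus "(\<lambda>n. (\<phi> (r n) x)\<^sup>2 / (1 - (norm x)\<^sup>2)\<^sup>2) \<longlonglongrightarrow> (u x)\<^sup>2 / (1 - (norm x)\<^sup>2)\<^sup>2"
          by (intro tendsto_divide tendsto_power l tendsto_const)
      qed
      show "integrable ?M (\<lambda>x. (u x)\<^sup>2 / (1 - (norm x)\<^sup>2)\<^sup>2)" "(LINT x|?M. (u x)\<^sup>2 / (1 - (norm x)\<^sup>2)\<^sup>2) \<le> h"
        using F[OF a _ c d b Hlim] by auto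
    qed
    show "integrable ?M (\<lambda>x. (u x)\<^sup>2 / (1 - (norm x)\<^sup>2)\<^sup>2)" by (rule hardy_lim)
    \<comment> \<open>\<open>E n\<close> is the right-hand side when the inequality for test
      functions is solved for \<open>16 * pi * ln\<close>; its limit \<open>L\<close> contains
      \<open>h\<close>, and the gap to the Hardy integral of \<open>u\<close> has the favourable
      sign.\<close>
    define E where "E n = dirichlet (grad (\<phi> n)) - hardy (\<phi> n) - \<alpha> * (LINT x|lborel. (\<phi> n x)\<^sup>2) + C" for n
    define L where "L = (LINT x|?M. (norm (G x))\<^sup>2) - h - \<alpha> * (LINT x|?M. (u x)\<^sup>2) + C"
    have Elim: "(\<lambda>n. E (r n)) \<longlonglongrightarrow> L"
      unfolding E_def L_def
      using LIMSEQ_subseq_LIMSEQ[OF D r] LIMSEQ_subseq_LIMSEQ[OF S r] Hlim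
      by (intro tendsto_intros) (simp_all add: o_def)
    have em: "(\<lambda>x. exp (\<phi> n x)) \<in> borel_measurable borel" for n
      using Cc_measurable[OF pc[of n]] by measurable
    have ei: "integrable ?M (\<lambda>x. exp (\<phi> n x))" for n
      using integrable_exp_Cc[OF pc[of n]] disc_measure_integral(2)[OF em] by simp
    have pos: "(LINT x|?M. exp (v x)) > (0::real)" if "integrable ?M (\<lambda>x. exp (v x))" for v :: "plane \<Rightarrow> real"
    proof -
      have "(LINT x|?M. exp (v x)) \<noteq> 0"
      proof
        assume "(LINT x|?M. exp (v x)) = 0"
        hence "AE x in ?M. exp (v x) = 0" using integral_nonneg_eq_0_iff_AE[OF that] by simp
        hence "AE x in ?M. (1::real) = 0" by (rule eventually_mono) simp
        hence "(LINT x|?M. (1::real)) = 0" by (rule integral_eq_zero_AE)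
        thus False using disc_measure_integral(1)[of "\<lambda>x. 1"] lborel_ball_plane[of 1 0] by simp
      qed
      moreover have "(LINT x|?M. exp (v x)) \<ge> 0" by (intro Bochner_Integration.integral_nonneg) auto
      ultimately show ?thesis by linarith
    qed
    \<comment> \<open>Fatou's lemma applies to the integrals of \<open>exp\<close>, not to their
      logarithms, so the inequality is exponentiated before the limit; the logarithm is taken again
      afterwards.\<close>
    have eb: "(LINT x|?M. exp (\<phi> n x)) \<le> exp (E n / (16 * pi))" for n
    proof -
      have "16 * pi * ln (LINT x|?M. exp (\<phi> n x)) \<le> E n"
        using C[OF P[of n]] unfolding E_def disc_measure_integral(1)[OF em] by linarith
      hence "ln (LINT x|?M. exp (\<phi> n x)) \<le> E n / (16 * pi)" by (simp add: field_simps)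
      thus ?thesis using pos[OF ei[of n]] by (metis exp_le_cancel_iff exp_ln)
    qed
    have exp_lim: "integrable ?M (\<lambda>x. exp (u x))" "(LINT x|?M. exp (u x)) \<le> exp (L / (16 * pi))"
    proof -
      note F = Fatou_integrable_bound[where M = ?M and f = "\<lambda>n x. exp (\<phi> (r n) x)"
          and g = "\<lambda>x. exp (u x)" and c = "\<lambda>n. exp (E (r n) / (16 * pi))" and l = "exp (L / (16 * pi))"]
      have a: "AE x in ?M. (\<lambda>n. exp (\<phi> (r n) x)) \<longlonglongrightarrow> exp (u x)"
        using ae by (rule eventually_mono) (intro tendsto_exp)
      have b: "(\<lambda>x. exp (u x)) \<in> borel_measurable ?M" using um by measurable
      have c: "(\<lambda>n. exp (E (r n) / (16 * pi))) \<longlonglongrightarrow> exp (L / (16 * pi))"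
        by (intro tendsto_intros Elim) auto
      show "integrable ?M (\<lambda>x. exp (u x))" "(LINT x|?M. exp (u x)) \<le> exp (L / (16 * pi))"
        using F[OF ei _ b a eb c] by auto
    qed
    show "integrable ?M (\<lambda>x. exp (u x))" by (rule exp_lim)
    have "ln (LINT x|?M. exp (u x)) \<le> L / (16 * pi)"
      using pos[OF exp_lim(1)] exp_lim(2) by (metis ln_exp ln_mono)
    hence "16 * pi * ln (LINT x|?M. exp (u x)) \<le> L" by (simp add: field_simps)
    moreover have "max C 1 \<ge> C" by simp
    ultimately show "- max C 1 \<le> (LINT x|?M. (norm (weak_grad u x))\<^sup>2)
             - (LINT x|?M. (u x)\<^sup>2 / (1 - (norm x)\<^sup>2)\<^sup>2)
             - \<alpha> * (LINT x|?M. (u x)\<^sup>2)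
             - 16 * pi * ln (LINT x|?M. exp (u x))"
      using hardy_lim(2) unfolding L_def G_def by linarith
  qed
qed

end
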